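(* Let $j\in\{1,\dots,p\}$ with $p$ fixed. Assume that $X$ is a Gaussian vector in $\mathbb{R}^p$ with invertible covariance matrix, that $y=X\beta+\epsilon$ with $\beta\in\mathbb{R}^p$ and $\epsilon\sim\mathcal{N}(0,\sigma^2)$ independent of $X$ (i.i.d. across observations), and that $X^j$ is independent of $y$ conditionally on $X^{-j}$. Let $\widehat{m}(x)=x\widehat{\beta}$, where $\widehat{\beta}$ is the least-squares estimator of the regression of $y$ on $X$, and let $\widehat{\nu}_{-j}$ be the least-squares linear regression of $X^j$ on $X^{-j}$, where $\widehat{\nu}_{-j}$ and $\widehat{\beta}$ are trained in different (independent) samples of size $n_{\mathrm{train}}$. Then, with the quadratic loss and the regression-based conditional sampler, $$\mathbb{E}\left[\widehat{\psi}^j_{\mathrm{CPI}}\right]=O\left(1/n_{\mathrm{train}}^2\right).$$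
   Context: For a vector $x\in\mathbb{R}^p$ (written as a row), $x^j$ is its $j$-th coordinate and $x^{-j}$ is $x$ with the $j$-th coordinate removed. Since $X$ is Gaussian, $\nu_{-j}(X^{-j}):=\mathbb{E}[X^j\mid X^{-j}]$ is a linear model in $X^{-j}$ (with an intercept if the mean is non-zero), estimated by $\widehat{\nu}_{-j}$. Given an i.i.d. test set $(x_i,y_i)_{i=1,\dots,n_{\mathrm{test}}}$ independent of the training data, the Conditional Permutation Importance with quadratic loss is $$\widehat{\psi}^j_{\mathrm{CPI}}=\frac{1}{n_{\mathrm{test}}}\sum_{i=1}^{n_{\mathrm{test}}}\left[\left(\widehat{m}(\widetilde{x}'^{(j)}_i)-y_i\right)^2-\left(\widehat{m}(x_i)-y_i\right)^2\right],$$ where the regression-based sampler is defined by $\widetilde{x}'^{(j)l}_i=x_i^l$ for $l\ne j$ and $\widetilde{x}'^{(j)j}_i=\widehat{\nu}_{-j}(x_i^{-j})+\left(x'^j-\widehat{\nu}_{-j}(x'^{-j})\right)$, the added (permuted) residual being that of another independent observation $x'$ of $X$. *)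

theory Defs
  imports "HOL-Probability.Probability"
begin

section \<open>Gaussian laws and covariance\<close>

text \<open>The law of \<open>m + s Z\<close> with \<open>Z\<close> standard normal, so that \<open>s = 0\<close> is the
  degenerate normal law (a Dirac mass), which \<^const>\<open>normal_density\<close> does not cover.\<close>

definition normal_law :: "real \<Rightarrow> real \<Rightarrow> real measure" where
  "normal_law m s = distr std_normal_distribution borel (\<lambda>z. m + s * z)"

lemma normal_law_eq_density:
  assumes "0 < s"
  shows "normal_law m s = density lborel (normal_density m s)"
proof -
  interpret N: prob_space std_normal_distribution
    by (rule prob_space_normal_density) simp
  have "distr std_normal_distribution lborel (\<lambda>x. x) = std_normal_distribution"
    by (rule distr_id2) simp
  hence "distributed std_normal_distribution lborel (\<lambda>x. x) (normal_density 0 1)"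
    by (simp add: distributed_def)
  from N.normal_density_affine[OF this, of s m] assms
  have "distributed std_normal_distribution lborel (\<lambda>z. m + s * z) (normal_density m s)"
    by simp
  hence "distr std_normal_distribution lborel (\<lambda>z. m + s * z) = density lborel (normal_density m s)"
    by (rule distributed_distr_eq_density)
  moreover have "distr std_normal_distribution lborel (\<lambda>z. m + s * z) = normal_law m s"
    unfolding normal_law_def by (rule distr_cong) simp_all
  ultimately show ?thesis by simp
qed

text \<open>\<open>X\<close> is a (possibly degenerate) Gaussian vector if it has the law of \<open>m + A Z\<close>, where the
  coordinates of \<open>Z\<close> are independent standard normal variables.\<close>

definition gaussian_vector :: "'w measure \<Rightarrow> ('w \<Rightarrow> real ^ 'p) \<Rightarrow> bool" where
  "gaussian_vector M X \<longleftrightarrow> X \<in> borel_measurable M \<and>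
     (\<exists>(m :: real ^ 'p) (A :: real ^ 'p ^ 'p).
        distr M borel X =
        distr (PiM UNIV (\<lambda>_ :: 'p. std_normal_distribution)) borel (\<lambda>z. m + A *v (\<chi> k. z k)))"

definition covariance_matrix :: "'w measure \<Rightarrow> ('w \<Rightarrow> real ^ 'p) \<Rightarrow> real ^ 'p ^ 'p" where
  "covariance_matrix M X =
     (\<chi> k l. LINT \<omega>|M. (X \<omega> $ k - (LINT \<omega>'|M. X \<omega>' $ k)) * (X \<omega> $ l - (LINT \<omega>'|M. X \<omega>' $ l)))"


section \<open>Conditional independence\<close>

definition cond_indep_var ::
  "'w measure \<Rightarrow> 'a measure \<Rightarrow> ('w \<Rightarrow> 'a) \<Rightarrow> 'b measure \<Rightarrow> ('w \<Rightarrow> 'b) \<Rightarrow> 'c measure \<Rightarrow> ('w \<Rightarrow> 'c) \<Rightarrow> bool"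
where
  "cond_indep_var M N1 U N2 V K Z \<longleftrightarrow>
     U \<in> measurable M N1 \<and> V \<in> measurable M N2 \<and> Z \<in> measurable M K \<and>
     (let F = vimage_algebra (space M) Z K in
      \<forall>A\<in>sets N1. \<forall>B\<in>sets N2. AE \<omega> in M.
        real_cond_exp M F (indicator (U -` A \<inter> V -` B \<inter> space M)) \<omega> =
        real_cond_exp M F (indicator (U -` A \<inter> space M)) \<omega> *
        real_cond_exp M F (indicator (V -` B \<inter> space M)) \<omega>)"


section \<open>Removing a coordinate, least squares\<close>

text \<open>The vector \<open>x\<close> without its \<open>j\<close>-th coordinate, as a function on the remaining indices.\<close>

definition drop_coord :: "'p \<Rightarrow> real ^ 'p \<Rightarrow> 'p \<Rightarrow> real" where
  "drop_coord j x = restrict (\<lambda>l. x $ l) (- {j})"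

text \<open>A least-squares solution need not be unique (it is almost surely so for the data considered
  here once \<open>n\<close> is large enough), hence a predicate. There is no intercept.\<close>

definition least_squares :: "nat \<Rightarrow> (nat \<Rightarrow> real ^ 'p) \<Rightarrow> (nat \<Rightarrow> real) \<Rightarrow> real ^ 'p \<Rightarrow> bool" where
  "least_squares n x y b \<longleftrightarrow> is_arg_min (\<lambda>b. \<Sum>i<n. (y i - x i \<bullet> b)\<^sup>2) (\<lambda>_. True) b"

definition linear_models :: "bool \<Rightarrow> 'p::finite \<Rightarrow> (('p \<Rightarrow> real) \<Rightarrow> real) set" where
  "linear_models intercept j =
     {\<lambda>v. a + (\<Sum>l\<in>- {j}. \<gamma> l * v l) | a \<gamma>. intercept \<or> a = 0}"

definition least_squares_coord ::
  "bool \<Rightarrow> 'p \<Rightarrow> nat \<Rightarrow> (nat \<Rightarrow> real ^ 'p) \<Rightarrow> (('p \<Rightarrow> real) \<Rightarrow> real) \<Rightarrow> bool" where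
  "least_squares_coord intercept j n x f \<longleftrightarrow>
     is_arg_min (\<lambda>f. \<Sum>i<n. (x i $ j - f (drop_coord j (x i)))\<^sup>2) (\<lambda>f. f \<in> linear_models intercept j) f"


section \<open>Conditional Permutation Importance\<close>

text \<open>The regression-based sampler: the \<open>j\<close>-th coordinate of \<open>x\<close> is replaced by its
  prediction plus the residual of \<open>x'\<close>.\<close>

definition cond_sample :: "(('p \<Rightarrow> real) \<Rightarrow> real) \<Rightarrow> 'p \<Rightarrow> real ^ 'p \<Rightarrow> real ^ 'p \<Rightarrow> real ^ 'p" where
  "cond_sample \<nu> j x x' =
     (\<chi> l. if l = j then \<nu> (drop_coord j x) + (x' $ j - \<nu> (drop_coord j x')) else x $ l)"

definition psi_CPI ::
  "(real ^ 'p \<Rightarrow> real) \<Rightarrow> (('p \<Rightarrow> real) \<Rightarrow> real) \<Rightarrow> 'p \<Rightarrow> nat \<Rightarrow>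
   (nat \<Rightarrow> real ^ 'p) \<Rightarrow> (nat \<Rightarrow> real) \<Rightarrow> (nat \<Rightarrow> real ^ 'p) \<Rightarrow> real" where
  "psi_CPI m \<nu> j n_test x y x' =
     (1 / real n_test) *
     (\<Sum>i<n_test. (m (cond_sample \<nu> j (x i) (x' i)) - y i)\<^sup>2 - (m (x i) - y i)\<^sup>2)"

datatype sample = Train_m | Train_nu | Test

end

theory Submission
  imports Defs
begin

text \<open>
  Write \<open>\<delta> = \<beta>_hat - \<beta>\<close> for the error of the regression of \<open>Y\<close> on \<open>X\<close>, and \<open>d\<close> for the error of the slopes of
  \<open>\<nu>_hat\<close>, with \<open>d\<^sub>j = 0\<close>. Let \<open>R = X\<^sub>j - E(X\<^sub>j | X\<^sub>-\<^sub>j)\<close>, which is independent of the other coordinates and has a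
  variance \<open>\<tau>\<^sup>2 > 0\<close>. Conditional independence forces \<open>\<beta>\<^sub>j = 0\<close>: it gives \<open>E(R Y) = 0\<close>, whereas
  \<open>E(R Y) = \<beta>\<^sub>j \<tau>\<^sup>2\<close>. Replacing the \<open>j\<close>-th coordinate of a test point \<open>x\<close> therefore changes its prediction by
  \<open>\<delta>\<^sub>j D\<close> with \<open>D = (R' - R) - d \<bullet> (x' - x)\<close>, where the intercept of \<open>\<nu>_hat\<close> has cancelled, and one summand of the
  importance is \<open>(\<delta>\<^sub>j D)\<^sup>2 + 2 \<delta>\<^sub>j D (x \<bullet> \<delta> - \<epsilon>)\<close>.

  Expand it into products of a function of \<open>\<delta>\<close>, a function of \<open>d\<close> and a function of the test observations. These
  three are independent, so expectations factorise. The terms that are linear in \<open>d\<close>, and the term \<open>\<delta>\<^sub>j D \<epsilon>\<close>,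
  vanish because \<open>\<delta>\<close> and \<open>d\<close> are centred. The terms without \<open>d\<close> cancel, since \<open>E(R' - R)\<^sup>2 = 2 \<tau>\<^sup>2\<close> while
  \<open>E((R' - R) x\<^sub>l)\<close> is \<open>- \<tau>\<^sup>2\<close> for \<open>l = j\<close> and \<open>0\<close> otherwise. What remains is
  \<open>E(\<delta>\<^sub>j\<^sup>2) \<Sum>\<^sub>k\<^sub>l E(d\<^sub>k d\<^sub>l) E((x' - x)\<^sub>k (x' - x)\<^sub>l)\<close> (lemma \<open>expectation_cpi_term\<close>), so the theorem follows once
  the second moments of \<open>\<delta>\<close> and of \<open>d\<close> are known to be \<open>O(1/n)\<close>.

  Conditionally on the design, the second moment of the error of a least-squares coefficient is the noise variance divided by
  the squared distance of its column from the span of the other columns (lemma \<open>ols_error_moments\<close>). By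
  Gaussianity that column is an affine function of the other coordinates plus independent normal residuals, so
  it suffices to bound the mean inverse of the residual sum of squares \<open>\<rho>\<close> of a normal sample regressed on
  independent covariates (lemma \<open>nn_integral_inverse_min_sq_residual_le\<close>). This avoids inverse Wishart laws:
  a sample of \<open>p + 1\<close> rows has a nonzero vector \<open>u\<close> orthogonal to the \<open>p\<close> covariate columns, hence \<open>\<rho>\<close> is at
  least a multiple of the square of a normal variable \<open>u \<bullet> R\<close>, which makes \<open>\<rho> powr (-1/4)\<close> integrable;
  the residual sum of squares of four such samples together has an integrable inverse, because
  \<open>(\<rho>\<^sub>0 + \<dots> + \<rho>\<^sub>3)\<^sup>-\<^sup>1 \<le> (\<rho>\<^sub>0 \<rho>\<^sub>1 \<rho>\<^sub>2 \<rho>\<^sub>3) powr (-1/4)\<close>; and cutting \<open>n\<close> rows into \<open>B\<close> such blocks,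
  the inequality between harmonic and arithmetic mean gives a bound of order \<open>1/B\<close>.

  The decomposition of a Gaussian vector rests on the rotation invariance of the standard Gaussian law
  (lemma \<open>std_gaussian_orthogonal_transformation\<close>).
\<close>

section \<open>Rotation invariance of the standard Gaussian law\<close>

lemma borel_measurable_vec_lambda [measurable (raw)]:
  fixes f :: "'a \<Rightarrow> 'n::finite \<Rightarrow> real"
  assumes "\<And>k. (\<lambda>x. f x k) \<in> borel_measurable M"
  shows "(\<lambda>x. \<chi> k. f x k) \<in> borel_measurable M"
proof (subst borel_measurable_euclidean_space, rule ballI)
  fix b :: "real ^ 'n" assume "b \<in> Basis"
  then obtain k where "b = axis k 1" by (auto simp: Basis_vec_def)
  thus "(\<lambda>x. (\<chi> k. f x k) \<bullet> b) \<in> borel_measurable M"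
    using assms[of k] by (simp add: inner_axis)
qed

lemma borel_measurable_vec_nth [measurable (raw)]:
  fixes f :: "'a \<Rightarrow> real ^ 'n"
  assumes "f \<in> borel_measurable M"
  shows "(\<lambda>x. f x $ k) \<in> borel_measurable M"
proof -
  have "(\<lambda>x. f x \<bullet> axis k 1) \<in> borel_measurable M" using assms by measurable
  thus ?thesis by (simp add: inner_axis)
qed

text \<open>The law on \<open>\<real>\<^sup>n\<close> of a vector with independent standard normal coordinates.\<close>

definition std_gaussian :: "(real ^ 'n) measure" where
  "std_gaussian = distr (PiM UNIV (\<lambda>_. std_normal_distribution)) borel (\<lambda>z. \<chi> k. (z k :: real))"

lemma vec_lambda_measurable_PiM [measurable]:
  "(\<lambda>z. \<chi> k::'n::finite. z k) \<in> borel_measurable (PiM UNIV (\<lambda>_. borel::real measure))"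
  by (rule borel_measurable_vec_lambda) measurable

lemma sets_std_gaussian [measurable_cong, simp]: "sets std_gaussian = sets borel"
  by (simp add: std_gaussian_def)

lemma lborel_vec_eq_distr_PiM:
  "(lborel :: (real ^ 'n) measure) = distr (PiM UNIV (\<lambda>_. lborel)) borel (\<lambda>z. \<chi> k. (z k :: real))"
proof (rule lborel_eqI)
  interpret product_sigma_finite "\<lambda>_::'n. lborel :: real measure" ..
  fix l u :: "real ^ 'n" assume lu: "\<And>b. b \<in> Basis \<Longrightarrow> l \<bullet> b \<le> u \<bullet> b"
  have lu': "l $ k \<le> u $ k" for k
    using lu[of "axis k 1"] by (simp add: inner_axis axis_in_Basis_iff)
  have [measurable]: "(\<lambda>z. \<chi> k::'n. (z k :: real)) \<in> borel_measurable (PiM UNIV (\<lambda>_. lborel))"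
    by (rule borel_measurable_vec_lambda) measurable
  have "(\<lambda>z. \<chi> k. (z k :: real)) -` box l u \<inter> space (PiM UNIV (\<lambda>_. lborel)) = Pi\<^sub>E UNIV (\<lambda>k. {l $ k<..<u $ k})"
    by (auto simp: mem_box_cart space_PiM PiE_iff)
  hence "emeasure (distr (PiM UNIV (\<lambda>_. lborel)) borel (\<lambda>z. \<chi> k. (z k :: real))) (box l u)
     = emeasure (PiM UNIV (\<lambda>_. lborel)) (Pi\<^sub>E UNIV (\<lambda>k. {l $ k<..<u $ k}))"
    by (subst emeasure_distr) auto
  also have "\<dots> = (\<Prod>k\<in>UNIV. ennreal (u $ k - l $ k))"
    by (subst emeasure_PiM) (auto simp: lu')
  also have "\<dots> = (\<Prod>b\<in>Basis. ennreal ((u - l) \<bullet> b))"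
    by (rule prod.reindex_bij_betw[symmetric, where h="\<lambda>k. axis k (1::real)", THEN sym, THEN trans[rotated]], rule bij_betwI')
       (auto simp: axis_eq_axis Basis_vec_def inner_axis)
  also have "\<dots> = ennreal (\<Prod>b\<in>Basis. (u - l) \<bullet> b)"
    using lu by (intro prod_ennreal) (auto simp: inner_diff_left)
  finally show "emeasure (distr (PiM UNIV (\<lambda>_. lborel)) borel (\<lambda>z. \<chi> k. (z k :: real))) (box l u)
     = ennreal (\<Prod>b\<in>Basis. (u - l) \<bullet> b)" .
qed simp

lemma std_gaussian_eq_density:
  "std_gaussian = density lborel (\<lambda>x :: real ^ 'n. \<Prod>k\<in>UNIV. ennreal (std_normal_density (x $ k)))"
proof -
  interpret L: product_sigma_finite "\<lambda>_::'n. lborel :: real measure" ..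
  interpret N: prob_space std_normal_distribution
    by (rule prob_space_normal_density) simp
  interpret N: product_sigma_finite "\<lambda>_::'n. std_normal_distribution" ..
  let ?f = "\<lambda>z::'n\<Rightarrow>real. \<Prod>k\<in>UNIV. ennreal (std_normal_density (z k))"
  have m[measurable]: "(\<lambda>z. \<chi> k::'n. (z k :: real)) \<in> borel_measurable (PiM UNIV (\<lambda>_. lborel))"
    by (rule borel_measurable_vec_lambda) measurable
  have "density (PiM UNIV (\<lambda>_. lborel)) ?f = PiM UNIV (\<lambda>_. std_normal_distribution)"
  proof (rule N.PiM_eqI)
    show "sets (density (PiM UNIV (\<lambda>_. lborel)) ?f) = sets (PiM UNIV (\<lambda>_::'n. std_normal_distribution))"
      by (auto intro!: sets_PiM_cong)
    fix A :: "'n \<Rightarrow> real set" assume A: "\<And>i. i \<in> UNIV \<Longrightarrow> A i \<in> sets std_normal_distribution"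
    hence A'[measurable]: "A i \<in> sets lborel" for i by simp
    have [measurable]: "Pi\<^sub>E UNIV A \<in> sets (PiM UNIV (\<lambda>_. lborel))" 
      by (rule sets_PiM_I_finite) (use A' in auto)
    have "emeasure (density (PiM UNIV (\<lambda>_. lborel)) ?f) (Pi\<^sub>E UNIV A)
       = (\<integral>\<^sup>+z. ?f z * indicator (Pi\<^sub>E UNIV A) z \<partial>(PiM UNIV (\<lambda>_. lborel)))"
      by (subst emeasure_density) auto
    also have "\<dots> = (\<integral>\<^sup>+z. (\<Prod>k\<in>UNIV. ennreal (std_normal_density (z k)) * indicator (A k) (z k)) \<partial>(PiM UNIV (\<lambda>_. lborel)))"
      by (intro nn_integral_cong) (auto simp: prod.distrib indicator_def PiE_iff prod_zero_iff)
    also have "\<dots> = (\<Prod>k\<in>UNIV. \<integral>\<^sup>+x. ennreal (std_normal_density x) * indicator (A k) x \<partial>lborel)"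
      by (rule L.product_nn_integral_prod) auto
    also have "\<dots> = (\<Prod>k\<in>UNIV. emeasure std_normal_distribution (A k))"
      by (intro prod.cong refl, subst emeasure_density) (use A in auto)
    finally show "emeasure (density (PiM UNIV (\<lambda>_. lborel)) ?f) (Pi\<^sub>E UNIV A) = (\<Prod>k\<in>UNIV. emeasure std_normal_distribution (A k))" .
  qed simp
  hence "std_gaussian = distr (density (PiM UNIV (\<lambda>_. lborel)) ?f) borel (\<lambda>z. \<chi> k. (z k :: real))"
    by (simp add: std_gaussian_def)
  also have "\<dots> = density (distr (PiM UNIV (\<lambda>_. lborel)) borel (\<lambda>z. \<chi> k. (z k :: real))) (\<lambda>x :: real ^ 'n. \<Prod>k\<in>UNIV. ennreal (std_normal_density (x $ k)))"
    by (subst density_distr) auto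
  finally show ?thesis by (simp add: lborel_vec_eq_distr_PiM)
qed

lemma prob_space_std_gaussian: "prob_space (std_gaussian :: (real ^ 'n) measure)"
proof -
  interpret N: prob_space std_normal_distribution
    by (rule prob_space_normal_density) simp
  interpret product_prob_space "\<lambda>_::'n. std_normal_distribution" UNIV ..
  show ?thesis unfolding std_gaussian_def
    by (rule prob_space.prob_space_distr[OF prob_space_axioms]) measurable
qed

lemma prod_std_normal_density_eq_norm:
  "(\<Prod>k\<in>UNIV. std_normal_density (x $ k)) = (1 / sqrt (2 * pi)) ^ CARD('n) * exp (- (norm (x::real^'n))\<^sup>2 / 2)"
proof -
  have "(\<Prod>k\<in>UNIV. std_normal_density (x $ k)) = (1 / sqrt (2 * pi)) ^ CARD('n) * exp (\<Sum>k\<in>UNIV. - (x $ k)\<^sup>2 / 2)"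
    by (simp add: std_normal_density_def prod.distrib exp_sum power_one_over prod_dividef flip: prod_constant)
  also have "(\<Sum>k\<in>UNIV. - (x $ k)\<^sup>2 / 2) = - (norm x)\<^sup>2 / 2"
    unfolding power2_norm_eq_inner by (simp add: inner_vec_def sum_negf power2_eq_square flip: sum_divide_distrib)
  finally show ?thesis .
qed

lemma nn_integral_lborel_affine_isometry:
  fixes f :: "'a::euclidean_space \<Rightarrow> ennreal"
  assumes [measurable]: "f \<in> borel_measurable borel" and c: "\<bar>c\<bar> = 1"
  shows "(\<integral>\<^sup>+x. f (t + c *\<^sub>R x) \<partial>lborel) = (\<integral>\<^sup>+x. f x \<partial>lborel)"
proof -
  have "lborel = distr lborel borel (\<lambda>x::'a. t + c *\<^sub>R x)"
    using lborel_affine[of c t] c by (auto simp: density_1)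
  hence "(\<integral>\<^sup>+x. f x \<partial>lborel) = (\<integral>\<^sup>+x. f x \<partial>distr lborel borel (\<lambda>x::'a. t + c *\<^sub>R x))"
    by simp
  also have "\<dots> = (\<integral>\<^sup>+x. f (t + c *\<^sub>R x) \<partial>lborel)"
    by (rule nn_integral_distr) auto
  finally show ?thesis ..
qed

text \<open>The pushforward of Lebesgue measure under \<open>T\<close> is translation invariant, and two translation invariant
  measures are proportional: computing the integral of \<open>1\<^sub>A(x + T y) 1\<^sub>B(T y)\<close> in both orders gives
  \<open>\<lambda>(A) \<lambda>(T\<^sup>-\<^sup>1 B) = \<lambda>(T\<^sup>-\<^sup>1 A) \<lambda>(B)\<close>. Taking for \<open>B\<close> the unit ball shows that the factor is \<open>1\<close>.\<close>

lemma lborel_orthogonal_transformation: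
  fixes T :: "'a::euclidean_space \<Rightarrow> 'a"
  assumes T: "orthogonal_transformation T"
  shows "distr lborel borel T = lborel"
proof -
  have lin: "linear T" using T by (rule orthogonal_transformation_linear)
  hence [measurable]: "T \<in> borel_measurable borel"
    by (intro borel_measurable_continuous_onI linear_continuous_on) (simp add: linear_conv_bounded_linear)
  have linS: "linear (inv T)"
    using orthogonal_transformation_inv[OF T] by (rule orthogonal_transformation_linear)
  hence [measurable]: "inv T \<in> borel_measurable borel"
    by (intro borel_measurable_continuous_onI linear_continuous_on) (simp add: linear_conv_bounded_linear)
  have TS: "T (inv T x) = x" for x
    using orthogonal_transformation_surj[OF T] by (rule surj_f_inv_f)
  have swap: "emeasure lborel A * emeasure lborel (T -` B) = emeasure lborel (T -` A) * emeasure lborel B"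
    if [measurable]: "A \<in> sets borel" "B \<in> sets borel" for A B
  proof -
    let ?i = "\<lambda>A. indicator A :: 'a \<Rightarrow> ennreal"
    have [measurable]: "T -` B \<in> sets borel" "T -` A \<in> sets borel"
      using measurable_sets[of T borel borel B] measurable_sets[of T borel borel A] by simp_all
    have "emeasure lborel A * emeasure lborel (T -` B) = (\<integral>\<^sup>+y. (\<integral>\<^sup>+x. ?i A x * ?i B (T y) \<partial>lborel) \<partial>lborel)"
      by (simp add: nn_integral_multc nn_integral_cmult flip: indicator_vimage)
    also have "\<dots> = (\<integral>\<^sup>+y. (\<integral>\<^sup>+x. ?i A (x + T y) * ?i B (T y) \<partial>lborel) \<partial>lborel)"
      using nn_integral_lborel_affine_isometry[of "\<lambda>x. ?i A x * ?i B (T y)" 1 "T y" for y]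
      by (simp add: add.commute)
    also have "\<dots> = (\<integral>\<^sup>+x. (\<integral>\<^sup>+y. ?i A (x + T y) * ?i B (T y) \<partial>lborel) \<partial>lborel)"
      by (rule lborel_pair.Fubini') measurable
    also have "\<dots> = (\<integral>\<^sup>+x. (\<integral>\<^sup>+y. ?i A (T y) * ?i B (T y - x) \<partial>lborel) \<partial>lborel)"
    proof (rule nn_integral_cong)
      fix x :: 'a
      show "(\<integral>\<^sup>+y. ?i A (x + T y) * ?i B (T y) \<partial>lborel) = (\<integral>\<^sup>+y. ?i A (T y) * ?i B (T y - x) \<partial>lborel)"
        using nn_integral_lborel_affine_isometry[of "\<lambda>y. ?i A (T y) * ?i B (T y - x)" 1 "inv T x"]
        by (simp add: linear_add[OF lin] TS)
    qed
    also have "\<dots> = (\<integral>\<^sup>+y. (\<integral>\<^sup>+x. ?i A (T y) * ?i B (T y - x) \<partial>lborel) \<partial>lborel)"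
      by (rule lborel_pair.Fubini') measurable
    also have "\<dots> = (\<integral>\<^sup>+y. (\<integral>\<^sup>+x. ?i A (T y) * ?i B x \<partial>lborel) \<partial>lborel)"
      using nn_integral_lborel_affine_isometry[of "\<lambda>x. ?i A (T y) * ?i B x" "-1" "T y" for y] by simp
    also have "\<dots> = emeasure lborel (T -` A) * emeasure lborel B"
      by (simp add: nn_integral_multc nn_integral_cmult flip: indicator_vimage)
    finally show ?thesis .
  qed
  \<comment> \<open>The unit ball is invariant under \<open>T\<close> and has a finite positive measure.\<close>
  have ball: "T -` ball 0 1 = ball 0 1"
    using orthogonal_transformation_norm[OF T] by (auto simp: dist_norm)
  have pos: "emeasure lborel (ball (0::'a) 1) \<noteq> 0" "emeasure lborel (ball (0::'a) 1) \<noteq> \<infinity>"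
    using emeasure_lborel_ball_finite[of "0::'a" 1] open_not_negligible[of "ball (0::'a) 1"]
    by (auto simp: negligible_iff_emeasure0)
  show ?thesis
  proof (rule measure_eqI)
    fix A assume "A \<in> sets (distr lborel borel T)"
    hence [measurable]: "A \<in> sets borel" by simp
    have "emeasure lborel A * emeasure lborel (ball (0::'a) 1) = emeasure lborel (T -` A) * emeasure lborel (ball (0::'a) 1)"
      using swap[of A "ball 0 1"] by (simp add: ball)
    hence "emeasure lborel A = emeasure lborel (T -` A)"
      using pos by (metis mult_divide_eq_ennreal infinity_ennreal_def)
    thus "emeasure (distr lborel borel T) A = emeasure lborel A"
      by (subst emeasure_distr) auto
  qed simp
qed

lemma std_gaussian_orthogonal_transformation:
  fixes f :: "real ^ 'n \<Rightarrow> real ^ 'n"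
  assumes f: "orthogonal_transformation f"
  shows "distr std_gaussian borel f = std_gaussian"
proof -
  have lin: "linear f" using f by (rule orthogonal_transformation_linear)
  hence [measurable]: "f \<in> borel_measurable borel"
    by (intro borel_measurable_continuous_onI linear_continuous_on) (simp add: linear_conv_bounded_linear)
  let ?d = "\<lambda>x :: real ^ 'n. \<Prod>k\<in>UNIV. ennreal (std_normal_density (x $ k))"
  have d: "?d = (\<lambda>x. ennreal ((1 / sqrt (2 * pi)) ^ CARD('n) * exp (- (norm x)\<^sup>2 / 2)))"
    using prod_std_normal_density_eq_norm[where ?'n='n] by (subst prod_ennreal) auto
  have "density lborel ?d = density (distr lborel borel f) ?d"
    by (simp add: lborel_orthogonal_transformation[OF f])
  also have "\<dots> = distr (density lborel (\<lambda>x. ?d (f x))) borel f"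
    by (subst density_distr) auto
  also have "(\<lambda>x. ?d (f x)) = ?d"
    using orthogonal_transformation_norm[OF f] by (simp add: fun_eq_iff d[unfolded fun_eq_iff])
  finally show ?thesis by (simp add: std_gaussian_eq_density)
qed

section \<open>Independence of two random variables with different value types\<close>

text \<open>Independence of two random variables, stated through their joint law, the product of their laws.
  Their value types may differ; \<open>indep_var\<close> is the special case of equal types.\<close>

definition indep_pair :: "'w measure \<Rightarrow> 'a measure \<Rightarrow> ('w \<Rightarrow> 'a) \<Rightarrow> 'b measure \<Rightarrow> ('w \<Rightarrow> 'b) \<Rightarrow> bool" where
  "indep_pair M S X T Y \<longleftrightarrow> X \<in> measurable M S \<and> Y \<in> measurable M T \<and>
     distr M S X \<Otimes>\<^sub>M distr M T Y = distr M (S \<Otimes>\<^sub>M T) (\<lambda>\<omega>. (X \<omega>, Y \<omega>))"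

lemma (in prob_space) indep_var_iff_indep_pair: "indep_var S X T Y \<longleftrightarrow> indep_pair M S X T Y"
  by (simp add: indep_pair_def indep_var_distribution_eq)

lemma (in prob_space) indep_pair_iff_prob:
  "indep_pair M S X T Y \<longleftrightarrow> X \<in> measurable M S \<and> Y \<in> measurable M T \<and>
     (\<forall>A\<in>sets S. \<forall>B\<in>sets T. prob (X -` A \<inter> Y -` B \<inter> space M) = prob (X -` A \<inter> space M) * prob (Y -` B \<inter> space M))"
proof (cases "X \<in> measurable M S \<and> Y \<in> measurable M T")
  case True
  hence [measurable]: "X \<in> measurable M S" "Y \<in> measurable M T" by auto
  interpret X: prob_space "distr M S X" by (rule prob_space_distr) measurable
  interpret Y: prob_space "distr M T Y" by (rule prob_space_distr) measurable
  let ?J = "distr M (S \<Otimes>\<^sub>M T) (\<lambda>\<omega>. (X \<omega>, Y \<omega>))"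
  have J: "emeasure ?J (A \<times> B) = ennreal (prob (X -` A \<inter> Y -` B \<inter> space M))"
    if [measurable]: "A \<in> sets S" "B \<in> sets T" for A B
  proof -
    have "(\<lambda>\<omega>. (X \<omega>, Y \<omega>)) -` (A \<times> B) \<inter> space M = X -` A \<inter> Y -` B \<inter> space M" by auto
    thus ?thesis by (subst emeasure_distr) (auto simp: emeasure_eq_measure)
  qed
  have E: "emeasure (distr M S X) A * emeasure (distr M T Y) B = ennreal (prob (X -` A \<inter> space M) * prob (Y -` B \<inter> space M))"
    if "A \<in> sets S" "B \<in> sets T" for A B
    using that by (simp add: emeasure_distr emeasure_eq_measure ennreal_mult)
  show ?thesis
  proof (intro iffI conjI ballI; (elim conjE)?)
    fix A B assume AB: "A \<in> sets S" "B \<in> sets T" and "indep_pair M S X T Y"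
    hence "ennreal (prob (X -` A \<inter> Y -` B \<inter> space M)) = emeasure (distr M S X \<Otimes>\<^sub>M distr M T Y) (A \<times> B)"
      by (simp add: J[OF AB] indep_pair_def)
    also have "\<dots> = ennreal (prob (X -` A \<inter> space M) * prob (Y -` B \<inter> space M))"
      using AB by (simp add: Y.emeasure_pair_measure_Times E)
    finally show "prob (X -` A \<inter> Y -` B \<inter> space M) = prob (X -` A \<inter> space M) * prob (Y -` B \<inter> space M)"
      by (subst (asm) ennreal_inj) simp_all
  next
    assume *: "\<forall>A\<in>sets S. \<forall>B\<in>sets T. prob (X -` A \<inter> Y -` B \<inter> space M) = prob (X -` A \<inter> space M) * prob (Y -` B \<inter> space M)"
    have "distr M S X \<Otimes>\<^sub>M distr M T Y = ?J"
    proof (rule pair_measure_eqI)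
      show "sigma_finite_measure (distr M S X)" by (rule X.sigma_finite_measure_axioms)
      show "sigma_finite_measure (distr M T Y)" by (rule Y.sigma_finite_measure_axioms)
      show "sets (distr M S X \<Otimes>\<^sub>M distr M T Y) = sets ?J"
        using sets_pair_measure_cong[OF sets_distr[of M S X] sets_distr[of M T Y]] by (simp only: sets_distr)
    next
      fix A B assume "A \<in> sets (distr M S X)" "B \<in> sets (distr M T Y)"
      hence AB: "A \<in> sets S" "B \<in> sets T" by simp_all
      show "emeasure (distr M S X) A * emeasure (distr M T Y) B = emeasure ?J (A \<times> B)"
        using *[rule_format, OF AB] by (simp only: J[OF AB] E[OF AB])
    qed
    thus "indep_pair M S X T Y" by (simp add: indep_pair_def)
  qed (auto simp: indep_pair_def)
qed (auto simp: indep_pair_def)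

lemma (in prob_space) indep_pair_compose:
  assumes "indep_pair M S X T Y" and [measurable]: "\<phi> \<in> measurable S S'" "\<psi> \<in> measurable T T'"
  shows "indep_pair M S' (\<lambda>\<omega>. \<phi> (X \<omega>)) T' (\<lambda>\<omega>. \<psi> (Y \<omega>))"
proof -
  have [measurable]: "X \<in> measurable M S" "Y \<in> measurable M T" using assms(1) by (auto simp: indep_pair_def)
  have "prob ((\<lambda>\<omega>. \<phi> (X \<omega>)) -` A \<inter> (\<lambda>\<omega>. \<psi> (Y \<omega>)) -` B \<inter> space M) =
        prob ((\<lambda>\<omega>. \<phi> (X \<omega>)) -` A \<inter> space M) * prob ((\<lambda>\<omega>. \<psi> (Y \<omega>)) -` B \<inter> space M)"
    if "A \<in> sets S'" "B \<in> sets T'" for A B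
  proof -
    have "\<phi> -` A \<inter> space S \<in> sets S" "\<psi> -` B \<inter> space T \<in> sets T" using that by measurable
    moreover have "X -` (\<phi> -` A \<inter> space S) \<inter> space M = (\<lambda>\<omega>. \<phi> (X \<omega>)) -` A \<inter> space M"
      "Y -` (\<psi> -` B \<inter> space T) \<inter> space M = (\<lambda>\<omega>. \<psi> (Y \<omega>)) -` B \<inter> space M"
      "X -` (\<phi> -` A \<inter> space S) \<inter> Y -` (\<psi> -` B \<inter> space T) \<inter> space M = (\<lambda>\<omega>. \<phi> (X \<omega>)) -` A \<inter> (\<lambda>\<omega>. \<psi> (Y \<omega>)) -` B \<inter> space M"
      by (auto intro: measurable_space[OF \<open>X \<in> measurable M S\<close>] measurable_space[OF \<open>Y \<in> measurable M T\<close>])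
    ultimately show ?thesis using assms(1) unfolding indep_pair_iff_prob by metis
  qed
  thus ?thesis by (simp add: indep_pair_iff_prob)
qed

lemma distr_compose_cong_law:
  assumes [measurable]: "X \<in> measurable M L" "Z \<in> measurable N L"
    and law: "distr M L X = distr N L Z" and [measurable]: "\<theta> \<in> measurable L K"
  shows "distr M K (\<lambda>\<omega>. \<theta> (X \<omega>)) = distr N K (\<lambda>\<omega>. \<theta> (Z \<omega>))"
  using arg_cong[OF law, of "\<lambda>D. distr D K \<theta>"] by (simp add: distr_distr comp_def)

lemma indep_pair_cong_law:
  assumes [measurable]: "X \<in> measurable M L" "Z \<in> measurable N L"
    and law: "distr M L X = distr N L Z"
    and [measurable]: "\<phi> \<in> measurable L S" "\<psi> \<in> measurable L T"
    and ind: "indep_pair N S (\<lambda>z. \<phi> (Z z)) T (\<lambda>z. \<psi> (Z z))"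
  shows "indep_pair M S (\<lambda>\<omega>. \<phi> (X \<omega>)) T (\<lambda>\<omega>. \<psi> (X \<omega>))"
proof -
  note d = distr_compose_cong_law[OF assms(1-3)]
  have "distr M S (\<lambda>\<omega>. \<phi> (X \<omega>)) \<Otimes>\<^sub>M distr M T (\<lambda>\<omega>. \<psi> (X \<omega>)) = distr M (S \<Otimes>\<^sub>M T) (\<lambda>\<omega>. (\<phi> (X \<omega>), \<psi> (X \<omega>)))"
    using ind d[of \<phi> S] d[of \<psi> T] d[of "\<lambda>x. (\<phi> x, \<psi> x)" "S \<Otimes>\<^sub>M T"] by (simp add: indep_pair_def)
  thus ?thesis by (simp add: indep_pair_def)
qed

lemma (in prob_space) indep_pair_integral:
  fixes X Y :: "'a \<Rightarrow> real"
  assumes "indep_pair M borel X borel Y" "integrable M X" "integrable M Y"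
  shows "integrable M (\<lambda>\<omega>. X \<omega> * Y \<omega>)" "(\<integral>\<omega>. X \<omega> * Y \<omega> \<partial>M) = (\<integral>\<omega>. X \<omega> \<partial>M) * (\<integral>\<omega>. Y \<omega> \<partial>M)"
  using indep_var_integrable[of X Y] indep_var_lebesgue_integral[of X Y] assms
  by (auto simp: indep_var_iff_indep_pair)

section \<open>Regression of one coordinate of a Gaussian vector on the others\<close>

lemma distr_std_gaussian_nth: "distr std_gaussian borel (\<lambda>z. z $ k) = std_normal_distribution"
proof -
  interpret N: prob_space std_normal_distribution
    by (rule prob_space_normal_density) simp
  interpret product_prob_space "\<lambda>_. std_normal_distribution" UNIV ..
  have "distr std_gaussian borel (\<lambda>z. z $ k) = distr (PiM UNIV (\<lambda>_. std_normal_distribution)) borel (\<lambda>z. z k)"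
    unfolding std_gaussian_def by (subst distr_distr) (auto simp: comp_def)
  also have "\<dots> = distr (PiM UNIV (\<lambda>_. std_normal_distribution)) std_normal_distribution (\<lambda>z. z k)"
    by (rule distr_cong) auto
  also have "\<dots> = std_normal_distribution" by (rule PiM_component) simp
  finally show ?thesis .
qed

lemma integrable_std_gaussian_nth_sq: "integrable std_gaussian (\<lambda>z. (z $ k)\<^sup>2)"
proof -
  have "integrable (distr std_gaussian borel (\<lambda>z. z $ k)) (\<lambda>x::real. x\<^sup>2)"
    unfolding distr_std_gaussian_nth
    using integrable_std_normal_moment[of 2] by (subst integrable_density) auto
  thus ?thesis by (subst (asm) integrable_distr_eq) auto
qed

lemma indep_pair_std_gaussian_nth:
  "indep_pair std_gaussian borel (\<lambda>z. z $ k) borel (\<lambda>z::real^'n. \<chi> l. if l = k then 0 else z $ l)"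
proof -
  let ?P = "PiM UNIV (\<lambda>_::'n. std_normal_distribution)"
  interpret N: prob_space std_normal_distribution
    by (rule prob_space_normal_density) simp
  interpret P: product_prob_space "\<lambda>_::'n. std_normal_distribution" UNIV ..
  have "distr ?P ?P (\<lambda>z. restrict z UNIV) = ?P"
    by (simp add: restrict_def distr_id)
  hence "P.indep_vars (\<lambda>_. std_normal_distribution) (\<lambda>k z. z k) UNIV"
    by (subst P.indep_vars_iff_distr_eq_PiM') (auto simp: P.PiM_component distr_id)
  hence "P.indep_vars (\<lambda>_. borel) (\<lambda>k z. z k) UNIV"
    by (rule P.indep_vars_compose2[of _ _ _ "\<lambda>_ x. x"]) auto
  hence ind: "indep_pair ?P (PiM {k} (\<lambda>_. borel)) (\<lambda>z. restrict (\<lambda>i. z i) {k}) (PiM (-{k}) (\<lambda>_. borel)) (\<lambda>z. restrict (\<lambda>i. z i) (-{k}))"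
    unfolding P.indep_var_iff_indep_pair[symmetric] by (rule P.indep_var_restrict) auto
  have m1: "(\<lambda>w. w k) \<in> borel_measurable (PiM {k} (\<lambda>_. borel))" by measurable
  have m2: "(\<lambda>w. \<chi> l::'n. if l = k then 0 else (w l :: real)) \<in> borel_measurable (PiM (-{k}) (\<lambda>_. borel))"
  proof (rule borel_measurable_vec_lambda)
    fix l show "(\<lambda>w. if l = k then 0 else (w l :: real)) \<in> borel_measurable (PiM (-{k}) (\<lambda>_. borel))"
      by (cases "l = k") auto
  qed
  from P.indep_pair_compose[OF ind m1 m2]
  have *: "indep_pair ?P borel (\<lambda>z. (\<chi> k. z k) $ k) borel (\<lambda>z. (\<lambda>z::real^'n. \<chi> l. if l = k then 0 else z $ l) (\<chi> k. z k))"
    by (simp cong: if_cong)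
  have [measurable]: "(\<lambda>z::real^'n. \<chi> l. if l = k then 0 else z $ l) \<in> borel_measurable borel"
  proof (rule borel_measurable_vec_lambda)
    fix l show "(\<lambda>z::real^'n. if l = k then 0 else z $ l) \<in> borel_measurable borel" by (cases "l = k") auto
  qed
  show ?thesis
    by (rule indep_pair_cong_law[OF _ _ _ _ _ *, where X="\<lambda>x. x" and L=borel])
       (auto simp: std_gaussian_def distr_distr comp_def)
qed

text \<open>The vector \<open>x\<close> with its \<open>k\<close>-th coordinate replaced by \<open>1\<close>: at the same time the information carried by the
  other coordinates and the row of covariates of the regression of the \<open>k\<close>-th coordinate on the others with
  an intercept.\<close>

definition with_one :: "'n::finite \<Rightarrow> real ^ 'n \<Rightarrow> real ^ 'n" where
  "with_one k x = (\<chi> l. if l = k then 1 else x $ l)"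

lemma measurable_with_one [measurable]: "with_one (k::'n::finite) \<in> borel_measurable borel"
  unfolding with_one_def[abs_def]
proof (rule borel_measurable_vec_lambda)
  fix l show "(\<lambda>x::real^'n. if l = k then 1 else x $ l) \<in> borel_measurable borel" by (cases "l = k") auto
qed

lemma borel_measurable_matrix_vector_mult [measurable]:
  "(\<lambda>z. (A :: real^'n^'m) *v z) \<in> borel_measurable borel"
  by (intro borel_measurable_continuous_onI matrix_vector_mult_linear_continuous_on)

lemma gaussian_vector_representation:
  fixes X :: "'w \<Rightarrow> real ^ 'n"
  assumes "gaussian_vector M X"
  obtains m and A :: "real ^ 'n ^ 'n" where "distr M borel X = distr std_gaussian borel (\<lambda>z. m + A *v z)"
proof -
  from assms obtain m and A :: "real ^ 'n ^ 'n" where *: "distr M borel X =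
        distr (PiM UNIV (\<lambda>_. std_normal_distribution)) borel (\<lambda>z. m + A *v (\<chi> k. z k))"
    unfolding gaussian_vector_def by blast
  have "distr M borel X = distr std_gaussian borel (\<lambda>z. m + A *v z)"
    unfolding * std_gaussian_def by (subst distr_distr) (auto simp: comp_def)
  thus ?thesis by (rule that)
qed

lemma integrable_mult_of_sq:
  fixes f g :: "'a \<Rightarrow> real"
  assumes [measurable]: "f \<in> borel_measurable M" "g \<in> borel_measurable M"
    and "integrable M (\<lambda>x. (f x)\<^sup>2)" "integrable M (\<lambda>x. (g x)\<^sup>2)"
  shows "integrable M (\<lambda>x. f x * g x)"
proof (rule Bochner_Integration.integrable_bound)
  show "integrable M (\<lambda>x. (f x)\<^sup>2 + (g x)\<^sup>2)" using assms by auto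
  have "\<bar>a * b\<bar> \<le> a\<^sup>2 + b\<^sup>2" for a b :: real
  proof -
    have "2 * \<bar>a * b\<bar> \<le> a\<^sup>2 + b\<^sup>2" using sum_squares_bound[of "\<bar>a\<bar>" "\<bar>b\<bar>"] by (simp add: abs_mult)
    thus ?thesis by linarith
  qed
  thus "AE x in M. norm (f x * g x) \<le> norm ((f x)\<^sup>2 + (g x)\<^sup>2)" by simp
qed simp

lemma integrable_sq_add:
  fixes f g :: "'a \<Rightarrow> real"
  assumes "f \<in> borel_measurable M" "g \<in> borel_measurable M"
    and "integrable M (\<lambda>x. (f x)\<^sup>2)" "integrable M (\<lambda>x. (g x)\<^sup>2)"
  shows "integrable M (\<lambda>x. (f x + g x)\<^sup>2)"
  using integrable_mult_of_sq[OF assms] assms by (simp add: power2_sum mult.assoc)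

lemma integrable_sq_sum:
  fixes f :: "'i \<Rightarrow> 'a \<Rightarrow> real"
  assumes "\<And>i. i \<in> I \<Longrightarrow> f i \<in> borel_measurable M" "\<And>i. i \<in> I \<Longrightarrow> integrable M (\<lambda>x. (f i x)\<^sup>2)"
  shows "integrable M (\<lambda>x. (\<Sum>i\<in>I. f i x)\<^sup>2)"
  using assms
proof (induction I rule: infinite_finite_induct)
  case (insert i I)
  have "integrable M (\<lambda>x. (f i x + (\<Sum>i\<in>I. f i x))\<^sup>2)"
    by (rule integrable_sq_add) (use insert in auto)
  thus ?case using insert by simp
qed auto

lemma gaussian_vector_integrable_sq:
  fixes X :: "'w \<Rightarrow> real ^ 'n"
  assumes M: "prob_space M" and X: "gaussian_vector M X"
  shows "integrable M (\<lambda>\<omega>. (X \<omega> $ k)\<^sup>2)"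
proof -
  interpret G: prob_space "std_gaussian :: (real^'n) measure" by (rule prob_space_std_gaussian)
  have [measurable]: "X \<in> borel_measurable M" using X by (simp add: gaussian_vector_def)
  from X obtain m and A :: "real ^ 'n ^ 'n" where law: "distr M borel X = distr std_gaussian borel (\<lambda>z. m + A *v z)"
    by (rule gaussian_vector_representation)
  have "integrable std_gaussian (\<lambda>z. (m $ k + (\<Sum>l\<in>UNIV. A $ k $ l * z $ l))\<^sup>2)"
    by (intro integrable_sq_add integrable_sq_sum)
       (auto simp: power_mult_distrib intro!: integrable_std_gaussian_nth_sq G.integrable_const)
  hence "integrable (distr std_gaussian borel (\<lambda>z. m + A *v z)) (\<lambda>x. (x $ k)\<^sup>2)"
    by (subst integrable_distr_eq) (auto simp: matrix_vector_mult_def)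
  hence "integrable (distr M borel X) (\<lambda>x. (x $ k)\<^sup>2)" by (simp add: law)
  thus ?thesis by (subst (asm) integrable_distr_eq) auto
qed

lemma gaussian_vector_representation_invertible:
  fixes X :: "'w \<Rightarrow> real ^ 'n" and A :: "real ^ 'n ^ 'n"
  assumes M: "prob_space M" and X: "gaussian_vector M X"
    and inv: "invertible (covariance_matrix M X)"
    and law: "distr M borel X = distr std_gaussian borel (\<lambda>z. m + A *v z)"
  shows "invertible A"
proof (rule ccontr)
  interpret prob_space M by fact
  have [measurable]: "X \<in> borel_measurable M" using X by (simp add: gaussian_vector_def)
  assume "\<not> invertible A"
  hence "\<not> invertible (transpose A)" by (metis transpose_invertible transpose_transpose)
  hence "\<not> (\<exists>B. B ** transpose A = mat 1)" by (simp add: invertible_left_inverse)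
  then obtain v where v: "v \<noteq> 0" "transpose A *v v = 0"
    using matrix_left_invertible_ker by blast
  have "v \<bullet> (A *v z) = 0" for z
    using v(2) dot_lmul_matrix[of v A z] by (simp add: transpose_matrix_vector)
  hence "AE x in distr M borel X. v \<bullet> x = v \<bullet> m"
    unfolding law by (subst AE_distr_iff) (auto simp: inner_add_right)
  hence ae: "AE \<omega> in M. v \<bullet> X \<omega> = v \<bullet> m" by (subst (asm) AE_distr_iff) auto
  have sq: "integrable M (\<lambda>\<omega>. (X \<omega> $ l)\<^sup>2)" for l
    by (rule gaussian_vector_integrable_sq[OF M X])
  have i1: "integrable M (\<lambda>\<omega>. X \<omega> $ l)" for l
    using square_integrable_imp_integrable[OF _ sq[of l]] by simp
  define \<mu> where "\<mu> l = (LINT \<omega>|M. X \<omega> $ l)" for l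
  have "(\<Sum>l\<in>UNIV. v $ l * \<mu> l) = (LINT \<omega>|M. v \<bullet> X \<omega>)"
    using i1 by (simp add: inner_vec_def \<mu>_def)
  also have "\<dots> = (LINT \<omega>|M. v \<bullet> m)"
    by (rule integral_cong_AE) (use ae in auto)
  finally have mean: "(\<Sum>l\<in>UNIV. v $ l * \<mu> l) = v \<bullet> m" by (simp add: prob_space)
  have isq: "integrable M (\<lambda>\<omega>. (X \<omega> $ l - \<mu> l)\<^sup>2)" for l
    using integrable_sq_add[of "\<lambda>\<omega>. X \<omega> $ l" M "\<lambda>_. - \<mu> l"] sq by simp
  have "covariance_matrix M X *v v = 0"
  proof (rule vec_eq_iff[THEN iffD2], rule allI)
    fix k
    have "(covariance_matrix M X *v v) $ k = (\<Sum>l\<in>UNIV. (LINT \<omega>|M. (X \<omega> $ k - \<mu> k) * (X \<omega> $ l - \<mu> l)) * v $ l)"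
      by (simp add: covariance_matrix_def matrix_vector_mult_def \<mu>_def)
    also have "\<dots> = (LINT \<omega>|M. (\<Sum>l\<in>UNIV. (X \<omega> $ k - \<mu> k) * (X \<omega> $ l - \<mu> l) * v $ l))"
      by (subst Bochner_Integration.integral_sum) (auto intro!: integrable_mult_of_sq isq)
    also have "\<dots> = (LINT \<omega>|M. 0)"
    proof (rule integral_cong_AE)
      show "AE \<omega> in M. (\<Sum>l\<in>UNIV. (X \<omega> $ k - \<mu> k) * (X \<omega> $ l - \<mu> l) * v $ l) = 0"
        using ae
      proof eventually_elim
        case (elim \<omega>)
        have "(\<Sum>l\<in>UNIV. (X \<omega> $ k - \<mu> k) * (X \<omega> $ l - \<mu> l) * v $ l)
           = (X \<omega> $ k - \<mu> k) * (v \<bullet> X \<omega> - (\<Sum>l\<in>UNIV. v $ l * \<mu> l))"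
          by (simp add: inner_vec_def sum_distrib_left sum_subtractf[symmetric] algebra_simps)
        thus ?case using elim mean by simp
      qed
    qed auto
    finally show "(covariance_matrix M X *v v) $ k = 0 $ k" by simp
  qed
  thus False
    using inv v(1) invertible_left_inverse matrix_left_invertible_ker by blast
qed

text \<open>The best affine prediction of one coordinate of a nondegenerate Gaussian vector \<open>m + A Z\<close> from the others has
  a normal residual that is independent of the other coordinates. Let \<open>n\<close> be the unit vector proportional
  to \<open>A\<^sup>-\<^sup>1 e\<^sub>k\<close>; it is orthogonal to all rows of \<open>A\<close> but the \<open>k\<close>-th one. After a rotation that moves
  \<open>e\<^sub>k\<close> to \<open>n\<close>, the coordinate \<open>z\<^sub>k\<close> enters only the \<open>k\<close>-th coordinate of the vector.\<close>

lemma gaussian_vector_coordinate_regression: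
  fixes X :: "'w \<Rightarrow> real ^ 'n"
  assumes M: "prob_space M" and X: "gaussian_vector M X"
    and inv: "invertible (covariance_matrix M X)"
  obtains a g \<tau> where "0 < \<tau>" "g $ k = 0"
    "distr M borel (\<lambda>\<omega>. X \<omega> $ k - (a + g \<bullet> X \<omega>)) = normal_law 0 \<tau>"
    "indep_pair M borel (\<lambda>\<omega>. X \<omega> $ k - (a + g \<bullet> X \<omega>)) borel (\<lambda>\<omega>. with_one k (X \<omega>))"
proof -
  interpret prob_space M by fact
  interpret G: prob_space "std_gaussian :: (real^'n) measure" by (rule prob_space_std_gaussian)
  have [measurable]: "X \<in> borel_measurable M" using X by (simp add: gaussian_vector_def)
  from X obtain m and A :: "real ^ 'n ^ 'n" where law: "distr M borel X = distr std_gaussian borel (\<lambda>z. m + A *v z)"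
    by (rule gaussian_vector_representation)
  have A: "invertible A"
    by (rule gaussian_vector_representation_invertible[OF M X inv law])
  then obtain B where B: "A ** B = mat 1" "B ** A = mat 1" by (auto simp: invertible_def)
  define n0 where "n0 = B *v axis k 1"
  have An0: "A *v n0 = axis k 1"
    using B by (simp add: n0_def matrix_vector_mul_assoc)
  hence "n0 \<noteq> 0" by auto
  define \<tau> where "\<tau> = 1 / norm n0"
  have \<tau>: "\<tau> > 0" using \<open>n0 \<noteq> 0\<close> by (simp add: \<tau>_def)
  define n where "n = \<tau> *\<^sub>R n0"
  have n: "norm n = 1" using \<open>n0 \<noteq> 0\<close> by (simp add: n_def \<tau>_def)
  have An: "A *v n = \<tau> *\<^sub>R axis k 1" by (simp add: n_def matrix_vector_mult_scaleR An0)
  obtain f :: "real ^ 'n \<Rightarrow> real ^ 'n" where f: "orthogonal_transformation f" "f (axis k 1) = n"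
    by (rule orthogonal_transformation_exists_1[of "axis k 1" n]) (use n in auto)
  have lin: "linear f" using f(1) by (rule orthogonal_transformation_linear)
  hence [measurable]: "f \<in> borel_measurable borel"
    by (intro borel_measurable_continuous_onI linear_continuous_on) (simp add: linear_conv_bounded_linear)
  define c where "c = \<tau> *\<^sub>R (transpose B *v n)"
  have c: "c \<bullet> (A *v z) = \<tau> * (n \<bullet> z)" for z
  proof -
    have "c \<bullet> (A *v z) = \<tau> * ((n v* B) \<bullet> (A *v z))"
      by (simp add: c_def transpose_matrix_vector)
    also have "\<dots> = \<tau> * (n \<bullet> z)"
      using B by (simp add: dot_lmul_matrix matrix_vector_mul_assoc)
    finally show ?thesis .
  qed
  have "\<tau> * c $ k = \<tau>"
    using c[of n] n by (simp add: An inner_axis dot_square_norm)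
  hence ck: "c $ k = 1" using \<tau> by simp
  define g where "g = axis k 1 - c"
  define a where "a = c \<bullet> m"
  have R: "x $ k - (a + g \<bullet> x) = c \<bullet> (x - m)" for x
    by (simp add: g_def a_def inner_diff_left inner_diff_right inner_axis inner_commute)
  let ?Z = "\<lambda>z. m + A *v f z"
  have law': "distr M borel X = distr std_gaussian borel ?Z"
    unfolding law by (subst std_gaussian_orthogonal_transformation[OF f(1), symmetric], subst distr_distr)
      (auto simp: comp_def)
  have RZ: "?Z z $ k - (a + g \<bullet> ?Z z) = \<tau> * z $ k" for z
  proof -
    have "?Z z $ k - (a + g \<bullet> ?Z z) = \<tau> * (n \<bullet> f z)" by (subst R) (simp add: c)
    also have "n \<bullet> f z = axis k 1 \<bullet> z"
      using f unfolding orthogonal_transformation_def by metis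
    finally show ?thesis by (simp add: inner_axis')
  qed
  let ?z0 = "\<lambda>z::real^'n. \<chi> l. if l = k then 0 else z $ l"
  have WZ: "with_one k (?Z z) = with_one k (?Z (?z0 z))" for z
  proof -
    have "z = ?z0 z + z $ k *\<^sub>R axis k 1" by (simp add: vec_eq_iff axis_def)
    hence "A *v f z = A *v f (?z0 z + z $ k *\<^sub>R axis k 1)" by simp
    also have "\<dots> = A *v f (?z0 z) + (z $ k * \<tau>) *\<^sub>R axis k 1"
      by (simp add: linear_add[OF lin] linear_scale[OF lin] f(2) matrix_vector_right_distrib
          matrix_vector_mult_scaleR An)
    finally show ?thesis by (simp add: with_one_def vec_eq_iff axis_def)
  qed
  have mR[measurable]: "(\<lambda>x::real^'n. x $ k - (a + g \<bullet> x)) \<in> borel_measurable borel" by measurable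
  show ?thesis
  proof (rule that[OF \<tau>])
    show "g $ k = 0" by (simp add: g_def ck)
    have "distr M borel (\<lambda>\<omega>. X \<omega> $ k - (a + g \<bullet> X \<omega>)) = distr (distr M borel X) borel (\<lambda>x. x $ k - (a + g \<bullet> x))"
      by (subst distr_distr) (auto simp: comp_def)
    also have "\<dots> = distr std_gaussian borel (\<lambda>z. \<tau> * z $ k)"
      unfolding law' by (subst distr_distr) (simp_all only: comp_def RZ, simp_all)
    also have "\<dots> = distr (distr std_gaussian borel (\<lambda>z::real^'n. z $ k)) borel (\<lambda>x. \<tau> * x)"
      by (subst distr_distr) (auto simp: comp_def)
    finally show "distr M borel (\<lambda>\<omega>. X \<omega> $ k - (a + g \<bullet> X \<omega>)) = normal_law 0 \<tau>"
      by (simp add: distr_std_gaussian_nth normal_law_def)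
    have "indep_pair std_gaussian borel (\<lambda>z. \<tau> * z $ k) borel (\<lambda>z. with_one k (?Z (?z0 z)))"
      by (rule G.indep_pair_compose[OF indep_pair_std_gaussian_nth]) auto
    hence ind: "indep_pair std_gaussian borel (\<lambda>z. ?Z z $ k - (a + g \<bullet> ?Z z)) borel (\<lambda>z. with_one k (?Z z))"
      by (simp only: RZ WZ[symmetric])
    show "indep_pair M borel (\<lambda>\<omega>. X \<omega> $ k - (a + g \<bullet> X \<omega>)) borel (\<lambda>\<omega>. with_one k (X \<omega>))"
      by (rule indep_pair_cong_law[OF _ _ law' mR measurable_with_one ind]) auto
  qed
qed

section \<open>Conditional independence forces a zero coefficient\<close>

lemma normal_law_moments:
  assumes [measurable]: "U \<in> borel_measurable M" and law: "distr M borel U = normal_law 0 s"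
  shows "integrable M U" "integrable M (\<lambda>\<omega>. (U \<omega>)\<^sup>2)" "(\<integral>\<omega>. U \<omega> \<partial>M) = 0" "(\<integral>\<omega>. (U \<omega>)\<^sup>2 \<partial>M) = s\<^sup>2"
proof -
  have i: "integrable std_normal_distribution (\<lambda>z. z ^ k)" for k
    using integrable_std_normal_moment[of k] by (subst integrable_density) auto
  have e1: "(\<integral>z. z \<partial>std_normal_distribution) = 0"
    using integral_std_normal_moment_odd[of 0] by (subst integral_density) auto
  have e2: "(\<integral>z. z\<^sup>2 \<partial>std_normal_distribution) = 1"
    using integral_std_normal_moment_even[of 1] by (subst integral_density) auto
  have iU: "integrable M (\<lambda>\<omega>. U \<omega> ^ k)" for k
  proof -
    have "integrable std_normal_distribution (\<lambda>z. s ^ k * z ^ k)" using i[of k] by (rule integrable_mult_right)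
    hence "integrable (distr M borel U) (\<lambda>x. x ^ k)"
      unfolding law normal_law_def by (subst integrable_distr_eq) (auto simp flip: power_mult_distrib)
    thus ?thesis by (subst (asm) integrable_distr_eq) auto
  qed
  show "integrable M U" "integrable M (\<lambda>\<omega>. (U \<omega>)\<^sup>2)" using iU[of 1] iU[of 2] by simp_all
  have "(\<integral>\<omega>. U \<omega> \<partial>M) = (\<integral>x. x \<partial>distr M borel U)" by (subst integral_distr) auto
  also have "\<dots> = 0" unfolding law normal_law_def by (subst integral_distr) (auto simp: e1)
  finally show "(\<integral>\<omega>. U \<omega> \<partial>M) = 0" .
  have "(\<integral>\<omega>. (U \<omega>)\<^sup>2 \<partial>M) = (\<integral>x. x\<^sup>2 \<partial>distr M borel U)" by (subst integral_distr) auto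
  also have "\<dots> = s\<^sup>2" unfolding law normal_law_def by (subst integral_distr) (auto simp: e2 power_mult_distrib)
  finally show "(\<integral>\<omega>. (U \<omega>)\<^sup>2 \<partial>M) = s\<^sup>2" .
qed

lemma coordinate_regression_orthogonal:
  fixes X :: "'w \<Rightarrow> real ^ 'n"
  assumes M: "prob_space M" and [measurable]: "X \<in> borel_measurable M"
    and sq: "\<And>l. integrable M (\<lambda>\<omega>. (X \<omega> $ l)\<^sup>2)" and g: "g $ k = 0"
    and law: "distr M borel (\<lambda>\<omega>. X \<omega> $ k - (a + g \<bullet> X \<omega>)) = normal_law 0 \<tau>"
    and ind: "indep_pair M borel (\<lambda>\<omega>. X \<omega> $ k - (a + g \<bullet> X \<omega>)) borel (\<lambda>\<omega>. with_one k (X \<omega>))"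
  shows "integrable M (\<lambda>\<omega>. (X \<omega> $ k - (a + g \<bullet> X \<omega>)) * X \<omega> $ l)"
    and "(\<integral>\<omega>. (X \<omega> $ k - (a + g \<bullet> X \<omega>)) * X \<omega> $ l \<partial>M) = (if l = k then \<tau>\<^sup>2 else 0)"
proof -
  interpret prob_space M by fact
  define R where "R \<omega> = X \<omega> $ k - (a + g \<bullet> X \<omega>)" for \<omega>
  have Rm[measurable]: "R \<in> borel_measurable M" unfolding R_def by measurable
  have lawR: "distr M borel R = normal_law 0 \<tau>" using law by (simp only: R_def[abs_def])
  note R = normal_law_moments[OF Rm lawR]
  have i1: "integrable M (\<lambda>\<omega>. X \<omega> $ l)" for l
    using square_integrable_imp_integrable[OF _ sq[of l]] by simp
  have ne: "integrable M (\<lambda>\<omega>. R \<omega> * X \<omega> $ l)" "(\<integral>\<omega>. R \<omega> * X \<omega> $ l \<partial>M) = 0" if "l \<noteq> k" for l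
  proof -
    have "indep_pair M borel R borel (\<lambda>\<omega>. with_one k (X \<omega>) $ l)"
      using indep_pair_compose[OF ind, of "\<lambda>x. x" borel "\<lambda>v. v $ l" borel] by (simp add: R_def[abs_def])
    moreover have "(\<lambda>\<omega>. with_one k (X \<omega>) $ l) = (\<lambda>\<omega>. X \<omega> $ l)" using that by (simp add: with_one_def)
    ultimately show "integrable M (\<lambda>\<omega>. R \<omega> * X \<omega> $ l)" "(\<integral>\<omega>. R \<omega> * X \<omega> $ l \<partial>M) = 0"
      using indep_pair_integral[of R "\<lambda>\<omega>. X \<omega> $ l"] R i1[of l] by auto
  qed
  have i: "integrable M (\<lambda>\<omega>. R \<omega> * X \<omega> $ l)" for l
    by (rule integrable_mult_of_sq) (use R sq in auto)
  have XR: "X \<omega> $ k = R \<omega> + (a + g \<bullet> X \<omega>)" for \<omega> by (simp add: R_def)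
  have "(\<integral>\<omega>. R \<omega> * X \<omega> $ k \<partial>M) = (\<integral>\<omega>. (R \<omega>)\<^sup>2 + a * R \<omega> + (\<Sum>l\<in>UNIV. g $ l * (R \<omega> * X \<omega> $ l)) \<partial>M)"
    by (intro Bochner_Integration.integral_cong refl)
       (simp only: XR, simp add: inner_vec_def power2_eq_square algebra_simps sum_distrib_left)
  also have "\<dots> = \<tau>\<^sup>2 + (\<Sum>l\<in>UNIV. g $ l * (\<integral>\<omega>. R \<omega> * X \<omega> $ l \<partial>M))"
    using R i by simp
  also have "(\<Sum>l\<in>UNIV. g $ l * (\<integral>\<omega>. R \<omega> * X \<omega> $ l \<partial>M)) = 0"
    using ne(2) g by (intro sum.neutral) (metis mult_zero_left mult_zero_right)
  finally have "(\<integral>\<omega>. R \<omega> * X \<omega> $ k \<partial>M) = \<tau>\<^sup>2" by simp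
  thus "integrable M (\<lambda>\<omega>. (X \<omega> $ k - (a + g \<bullet> X \<omega>)) * X \<omega> $ l)"
    "(\<integral>\<omega>. (X \<omega> $ k - (a + g \<bullet> X \<omega>)) * X \<omega> $ l \<partial>M) = (if l = k then \<tau>\<^sup>2 else 0)"
    using i[of l] ne[of l] by (auto simp: R_def)
qed

text \<open>If the finite measures with densities \<open>f1\<close> and \<open>f2\<close> have the same image under \<open>V\<close>, then \<open>V\<close> has the same
  integral for both; \<open>V\<close> need not be integrable.\<close>

lemma integral_mult_eq_if_indicator:
  fixes f1 f2 V :: "'w \<Rightarrow> real"
  assumes f: "integrable M f1" "integrable M f2" "AE x in M. 0 \<le> f1 x" "AE x in M. 0 \<le> f2 x"
    and [measurable]: "V \<in> borel_measurable M"
    and eq: "\<And>A. A \<in> sets borel \<Longrightarrow> (\<integral>x. f1 x * indicator A (V x) \<partial>M) = (\<integral>x. f2 x * indicator A (V x) \<partial>M)"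
  shows "(\<integral>x. f1 x * V x \<partial>M) = (\<integral>x. f2 x * V x \<partial>M)"
proof -
  have [measurable]: "f1 \<in> borel_measurable M" "f2 \<in> borel_measurable M" using f by auto
  have em: "emeasure (distr (density M (\<lambda>x. ennreal (f x))) borel V) A = ennreal (\<integral>x. f x * indicator A (V x) \<partial>M)"
    if [measurable]: "A \<in> sets borel" and f: "integrable M f" "AE x in M. 0 \<le> f x" for A and f :: "'w \<Rightarrow> real"
  proof -
    have [measurable]: "f \<in> borel_measurable M" using f by auto
    have "emeasure (distr (density M (\<lambda>x. ennreal (f x))) borel V) A = (\<integral>\<^sup>+x. ennreal (f x) * indicator (V -` A \<inter> space M) x \<partial>M)"
      by (simp add: emeasure_distr emeasure_density)
    also have "\<dots> = (\<integral>\<^sup>+x. ennreal (f x * indicator A (V x)) \<partial>M)"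
      by (intro nn_integral_cong) (auto simp: indicator_def)
    also have "\<dots> = ennreal (\<integral>x. f x * indicator A (V x) \<partial>M)"
    proof (rule nn_integral_eq_integral)
      show "integrable M (\<lambda>x. f x * indicator A (V x))"
        by (rule Bochner_Integration.integrable_bound[OF f(1)]) (auto simp: indicator_def)
    qed (use f(2) in \<open>auto simp: indicator_def\<close>)
    finally show ?thesis .
  qed
  have "distr (density M (\<lambda>x. ennreal (f1 x))) borel V = distr (density M (\<lambda>x. ennreal (f2 x))) borel V"
    by (rule measure_eqI) (use f in \<open>auto simp: em eq\<close>)
  hence "(\<integral>v. v \<partial>distr (density M (\<lambda>x. ennreal (f1 x))) borel V) = (\<integral>v. v \<partial>distr (density M (\<lambda>x. ennreal (f2 x))) borel V)"
    by simp
  thus ?thesis using f by (simp add: integral_distr integral_density)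
qed

text \<open>For a Borel set \<open>B\<close> put \<open>q = P(Y \<in> B | X\<^sub>-\<^sub>j)\<close>. Conditional independence yields
  \<open>E(1\<^sub>A(X\<^sub>j) 1\<^sub>B(Y)) = E(1\<^sub>A(X\<^sub>j) q)\<close> for all \<open>A\<close>, hence \<open>E(X\<^sub>j 1\<^sub>B(Y)) = E(X\<^sub>j q)\<close> and \<open>E(R 1\<^sub>B(Y)) = E(R q) = 0\<close>,
  the residual \<open>R\<close> having conditional mean \<open>0\<close>. Therefore \<open>0 = E(R Y) = \<beta>\<^sub>j E(R\<^sup>2)\<close>.\<close>

lemma cond_indep_coefficient_eq_zero:
  fixes X :: "'w \<Rightarrow> real ^ 'n" and Y \<epsilon> :: "'w \<Rightarrow> real"
  assumes M: "prob_space M" and X[measurable]: "X \<in> borel_measurable M"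
    and sq: "\<And>l. integrable M (\<lambda>\<omega>. (X \<omega> $ l)\<^sup>2)"
    and g: "g $ j = 0" and \<tau>: "\<tau> > 0"
    and law: "distr M borel (\<lambda>\<omega>. X \<omega> $ j - (a + g \<bullet> X \<omega>)) = normal_law 0 \<tau>"
    and ind: "indep_pair M borel (\<lambda>\<omega>. X \<omega> $ j - (a + g \<bullet> X \<omega>)) borel (\<lambda>\<omega>. with_one j (X \<omega>))"
    and \<epsilon>: "integrable M \<epsilon>" "indep_pair M borel X borel \<epsilon>"
    and Y: "Y = (\<lambda>\<omega>. X \<omega> \<bullet> \<beta> + \<epsilon> \<omega>)"
    and ci: "cond_indep_var M borel (\<lambda>\<omega>. X \<omega> $ j) borel Y
           (PiM (- {j}) (\<lambda>_. borel)) (\<lambda>\<omega>. drop_coord j (X \<omega>))"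
  shows "\<beta> $ j = 0"
proof -
  interpret prob_space M by fact
  let ?K = "PiM (- {j}) (\<lambda>_. borel :: real measure)"
  define R where "R \<omega> = X \<omega> $ j - (a + g \<bullet> X \<omega>)" for \<omega>
  define Z where "Z \<omega> = drop_coord j (X \<omega>)" for \<omega>
  define F where "F = vimage_algebra (space M) Z ?K"
  have Rm[measurable]: "R \<in> borel_measurable M" unfolding R_def by measurable
  have lawR: "distr M borel R = normal_law 0 \<tau>" using law by (simp only: R_def[abs_def])
  note R = normal_law_moments[OF Rm lawR]
  have [measurable]: "\<epsilon> \<in> borel_measurable M" using \<epsilon> by auto
  have [measurable]: "Y \<in> borel_measurable M" unfolding Y by measurable
  have Z[measurable]: "Z \<in> measurable M ?K" using ci by (simp add: cond_indep_var_def Z_def[abs_def])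
  have i1: "integrable M (\<lambda>\<omega>. X \<omega> $ l)" for l
    using square_integrable_imp_integrable[OF _ sq[of l]] by simp
  have setsF: "sets F = {Z -` A \<inter> space M |A. A \<in> sets ?K}"
    unfolding F_def by (rule sets_vimage_algebra2) (use measurable_space[OF Z] in auto)
  have sub: "subalgebra M F"
    unfolding subalgebra_def setsF using measurable_sets[OF Z] by (auto simp: F_def)
  interpret sigma_finite_subalgebra M F
    using sub by (intro finite_measure_subalgebra_is_sigma_finite) unfold_locales
  have ZF[measurable]: "Z \<in> measurable F ?K"
    unfolding F_def by (rule measurable_vimage_algebra1, rule funcsetI, rule measurable_space[OF Z])
  have indZ: "indep_pair M borel R ?K Z"
  proof -
    have "(\<lambda>v. restrict (\<lambda>l. v $ l) (- {j})) \<in> measurable borel ?K" by measurable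
    from indep_pair_compose[OF ind _ this, of "\<lambda>x. x" borel]
    have "indep_pair M borel R ?K (\<lambda>\<omega>. restrict (\<lambda>l. with_one j (X \<omega>) $ l) (- {j}))" by (simp add: R_def[abs_def])
    also have "(\<lambda>\<omega>. restrict (\<lambda>l. with_one j (X \<omega>) $ l) (- {j})) = Z"
      by (auto simp: Z_def drop_coord_def with_one_def restrict_def fun_eq_iff)
    finally show ?thesis .
  qed
  have lin: "g \<bullet> X \<omega> = (\<Sum>l\<in>-{j}. g $ l * Z \<omega> l)" for \<omega>
    unfolding inner_vec_def Z_def drop_coord_def
    by (rule sum.mono_neutral_cong_right) (use g in auto)
  have linF[measurable]: "(\<lambda>\<omega>. a + g \<bullet> X \<omega>) \<in> borel_measurable F"
  proof -
    have "(\<lambda>\<omega>. Z \<omega> l) \<in> borel_measurable F" if "l \<in> -{j}" for l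
      using measurable_compose[OF ZF measurable_component_singleton[OF that]] .
    thus ?thesis unfolding lin by (intro borel_measurable_add borel_measurable_const borel_measurable_sum borel_measurable_times) auto
  qed
  have ceR: "AE \<omega> in M. real_cond_exp M F R \<omega> = 0"
  proof (rule real_cond_exp_charact)
    fix C assume "C \<in> sets F"
    then obtain D where D[measurable]: "D \<in> sets ?K" and C: "C = Z -` D \<inter> space M"
      unfolding setsF by auto
    have "set_lebesgue_integral M C R = (\<integral>\<omega>. R \<omega> * indicator D (Z \<omega>) \<partial>M)"
      unfolding set_lebesgue_integral_def C
      by (intro Bochner_Integration.integral_cong refl) (auto simp: indicator_def)
    also have "\<dots> = (\<integral>\<omega>. R \<omega> \<partial>M) * (\<integral>\<omega>. indicator D (Z \<omega>) \<partial>M)"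
    proof (rule indep_pair_integral)
      show "indep_pair M borel R borel (\<lambda>\<omega>. indicator D (Z \<omega>))"
        using indep_pair_compose[OF indZ, of "\<lambda>x. x" borel "indicator D" borel] by simp
    qed (auto intro: R integrable_const_bound[where B=1] simp: indicator_def)
    finally show "set_lebesgue_integral M C R = set_lebesgue_integral M C (\<lambda>_. 0)"
      by (simp add: R set_lebesgue_integral_def)
  qed (use R in auto)
  have main: "(\<integral>\<omega>. R \<omega> * indicator B (Y \<omega>) \<partial>M) = 0" if [measurable]: "B \<in> sets borel" for B
  proof -
    let ?b = "indicator (Y -` B \<inter> space M) :: 'w \<Rightarrow> real"
    define q where "q = real_cond_exp M F ?b"
    have [measurable]: "q \<in> borel_measurable F" "q \<in> borel_measurable M" unfolding q_def by auto
    have ib: "integrable M ?b" by (rule integrable_const_bound[where B=1]) (auto simp: indicator_def)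
    have q0: "AE \<omega> in M. 0 \<le> q \<omega>" unfolding q_def by (rule real_cond_exp_pos) (auto simp: indicator_def)
    have q1: "AE \<omega> in M. q \<omega> \<le> 1"
      unfolding q_def by (rule real_cond_exp_le_c[OF ib]) (auto simp: indicator_def)
    have qn: "AE \<omega> in M. \<bar>q \<omega>\<bar> \<le> 1" using q0 q1 by eventually_elim auto
    have iq: "integrable M q" unfolding q_def using ib by (rule real_cond_exp_int)
    have Xq: "integrable M (\<lambda>\<omega>. V \<omega> * q \<omega>)" if "integrable M V" for V :: "'w \<Rightarrow> real"
    proof (rule Bochner_Integration.integrable_bound[OF that])
      show "AE \<omega> in M. norm (V \<omega> * q \<omega>) \<le> norm (V \<omega>)"
        using qn by eventually_elim (auto simp: abs_mult intro: mult_left_le)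
    qed (use that in auto)
    have Xb: "integrable M (\<lambda>\<omega>. V \<omega> * ?b \<omega>)" if "integrable M V" for V :: "'w \<Rightarrow> real"
      by (rule Bochner_Integration.integrable_bound[OF that]) (use that in \<open>auto simp: indicator_def\<close>)
    have "(\<integral>\<omega>. ?b \<omega> * X \<omega> $ j \<partial>M) = (\<integral>\<omega>. q \<omega> * X \<omega> $ j \<partial>M)"
    proof (rule integral_mult_eq_if_indicator)
      fix A :: "real set" assume A[measurable]: "A \<in> sets borel"
      let ?a = "indicator ((\<lambda>\<omega>. X \<omega> $ j) -` A \<inter> space M) :: 'w \<Rightarrow> real"
      have ia: "integrable M ?a" by (rule integrable_const_bound[where B=1]) (auto simp: indicator_def)
      have ab: "indicator ((\<lambda>\<omega>. X \<omega> $ j) -` A \<inter> Y -` B \<inter> space M) = (\<lambda>\<omega>. ?a \<omega> * ?b \<omega>)"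
        by (auto simp: indicator_def fun_eq_iff)
      have iab: "integrable M (\<lambda>\<omega>. ?a \<omega> * ?b \<omega>)" using ia by (rule Xb)
      have ce: "AE \<omega> in M. real_cond_exp M F (\<lambda>\<omega>. ?a \<omega> * ?b \<omega>) \<omega> = real_cond_exp M F ?a \<omega> * q \<omega>"
        using ci A that unfolding cond_indep_var_def Let_def F_def Z_def[abs_def] q_def ab[symmetric] by blast
      have "(\<integral>\<omega>. ?b \<omega> * indicator A (X \<omega> $ j) \<partial>M) = (\<integral>\<omega>. ?a \<omega> * ?b \<omega> \<partial>M)"
        by (intro Bochner_Integration.integral_cong refl) (auto simp: indicator_def)
      also have "\<dots> = (\<integral>\<omega>. real_cond_exp M F (\<lambda>\<omega>. ?a \<omega> * ?b \<omega>) \<omega> \<partial>M)"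
        using real_cond_exp_int(2)[OF iab] by simp
      also have "\<dots> = (\<integral>\<omega>. q \<omega> * real_cond_exp M F ?a \<omega> \<partial>M)"
        by (rule integral_cong_AE) (use ce in \<open>auto simp: mult.commute\<close>)
      also have "\<dots> = (\<integral>\<omega>. q \<omega> * ?a \<omega> \<partial>M)"
        by (rule real_cond_exp_intg(2)) (use Xq[OF ia] in \<open>auto simp: mult.commute\<close>)
      also have "\<dots> = (\<integral>\<omega>. q \<omega> * indicator A (X \<omega> $ j) \<partial>M)"
        by (intro Bochner_Integration.integral_cong refl) (auto simp: indicator_def)
      finally show "(\<integral>\<omega>. ?b \<omega> * indicator A (X \<omega> $ j) \<partial>M) = (\<integral>\<omega>. q \<omega> * indicator A (X \<omega> $ j) \<partial>M)" .
    qed (use ib iq q0 in auto)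
    moreover have il: "integrable M (\<lambda>\<omega>. a + g \<bullet> X \<omega>)" unfolding inner_vec_def using i1 by simp
    have "(\<integral>\<omega>. (a + g \<bullet> X \<omega>) * q \<omega> \<partial>M) = (\<integral>\<omega>. (a + g \<bullet> X \<omega>) * ?b \<omega> \<partial>M)"
      unfolding q_def by (rule real_cond_exp_intg(2)) (use Xb[OF il] in auto)
    moreover have "(\<integral>\<omega>. R \<omega> * V \<omega> \<partial>M) = (\<integral>\<omega>. V \<omega> * X \<omega> $ j \<partial>M) - (\<integral>\<omega>. (a + g \<bullet> X \<omega>) * V \<omega> \<partial>M)"
      if "integrable M (\<lambda>\<omega>. X \<omega> $ j * V \<omega>)" "integrable M (\<lambda>\<omega>. (a + g \<bullet> X \<omega>) * V \<omega>)" for V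
      using that by (subst Bochner_Integration.integral_diff[symmetric])
        (auto simp: R_def algebra_simps intro!: Bochner_Integration.integral_cong)
    note this[of ?b] this[of q]
    ultimately have "(\<integral>\<omega>. R \<omega> * ?b \<omega> \<partial>M) = (\<integral>\<omega>. R \<omega> * q \<omega> \<partial>M)"
      using Xq Xb il i1 by auto
    also have "\<dots> = (\<integral>\<omega>. q \<omega> * R \<omega> \<partial>M)" by (simp add: mult.commute)
    also have "\<dots> = (\<integral>\<omega>. q \<omega> * real_cond_exp M F R \<omega> \<partial>M)"
      by (rule real_cond_exp_intg(2)[symmetric]) (use Xq[OF R(1)] in \<open>auto simp: mult.commute\<close>)
    also have "\<dots> = (\<integral>\<omega>. 0 \<partial>M)"
      by (rule integral_cong_AE) (use ceR in auto)
    finally have "(\<integral>\<omega>. R \<omega> * ?b \<omega> \<partial>M) = 0" by simp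
    moreover have "(\<integral>\<omega>. R \<omega> * ?b \<omega> \<partial>M) = (\<integral>\<omega>. R \<omega> * indicator B (Y \<omega>) \<partial>M)"
      by (intro Bochner_Integration.integral_cong refl) (auto simp: indicator_def)
    ultimately show ?thesis by simp
  qed
  have iRX: "integrable M (\<lambda>\<omega>. R \<omega> * X \<omega> $ l)"
    and eRX: "(\<integral>\<omega>. R \<omega> * X \<omega> $ l \<partial>M) = (if l = j then \<tau>\<^sup>2 else 0)" for l
    using coordinate_regression_orthogonal[OF M X sq g law ind, of l] by (simp_all add: R_def)
  have "indep_pair M borel R borel \<epsilon>"
    unfolding R_def[abs_def]
    by (rule indep_pair_compose[OF \<epsilon>(2), of "\<lambda>x. x $ j - (a + g \<bullet> x)" borel "\<lambda>x. x" borel]) measurable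
  from indep_pair_integral[OF this R(1) \<epsilon>(1)] have R\<epsilon>: "integrable M (\<lambda>\<omega>. R \<omega> * \<epsilon> \<omega>)" "(\<integral>\<omega>. R \<omega> * \<epsilon> \<omega> \<partial>M) = 0"
    by (simp_all add: R)
  have RY: "R \<omega> * Y \<omega> = (\<Sum>l\<in>UNIV. \<beta> $ l * (R \<omega> * X \<omega> $ l)) + R \<omega> * \<epsilon> \<omega>" for \<omega>
    by (simp add: Y inner_vec_def algebra_simps sum_distrib_left)
  have iRY: "integrable M (\<lambda>\<omega>. R \<omega> * Y \<omega>)" unfolding RY using iRX R\<epsilon> by auto
  have "(\<integral>\<omega>. R \<omega> * Y \<omega> \<partial>M) = \<beta> $ j * \<tau>\<^sup>2"
  proof -
    have "(\<integral>\<omega>. R \<omega> * Y \<omega> \<partial>M) = (\<Sum>l\<in>UNIV. \<beta> $ l * (\<integral>\<omega>. R \<omega> * X \<omega> $ l \<partial>M)) + (\<integral>\<omega>. R \<omega> * \<epsilon> \<omega> \<partial>M)"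
      unfolding RY using iRX R\<epsilon>(1) by simp
    also have "(\<Sum>l\<in>UNIV. \<beta> $ l * (\<integral>\<omega>. R \<omega> * X \<omega> $ l \<partial>M)) = (\<Sum>l\<in>UNIV. if l = j then \<beta> $ j * \<tau>\<^sup>2 else 0)"
      by (intro sum.cong refl) (auto simp: eRX)
    finally show ?thesis by (simp add: R\<epsilon>(2))
  qed
  moreover have "(\<integral>\<omega>. R \<omega> * Y \<omega> \<partial>M) = 0"
  proof -
    \<comment> \<open>The positive and the negative part of \<open>R\<close> integrate all indicators of \<open>Y\<close> alike, hence also \<open>Y\<close>.\<close>
    define p where "p \<omega> = max 0 (R \<omega>)" for \<omega>
    define m where "m \<omega> = max 0 (- R \<omega>)" for \<omega>
    have pm: "R \<omega> = p \<omega> - m \<omega>" for \<omega> by (auto simp: p_def m_def)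
    have pm0: "0 \<le> p \<omega>" "0 \<le> m \<omega>" for \<omega> by (auto simp: p_def m_def)
    have ip: "integrable M p" "integrable M m" unfolding p_def m_def using R by auto
    have [measurable]: "p \<in> borel_measurable M" "m \<in> borel_measurable M" using ip by auto
    have "(\<integral>\<omega>. p \<omega> * Y \<omega> \<partial>M) = (\<integral>\<omega>. m \<omega> * Y \<omega> \<partial>M)"
    proof (rule integral_mult_eq_if_indicator)
      fix B :: "real set" assume B[measurable]: "B \<in> sets borel"
      have "integrable M (\<lambda>\<omega>. V \<omega> * indicator B (Y \<omega>))" if "integrable M V" for V :: "'w \<Rightarrow> real"
        by (rule Bochner_Integration.integrable_bound[OF that]) (use that in \<open>auto simp: indicator_def\<close>)
      note this[OF ip(1)] this[OF ip(2)]
      thus "(\<integral>\<omega>. p \<omega> * indicator B (Y \<omega>) \<partial>M) = (\<integral>\<omega>. m \<omega> * indicator B (Y \<omega>) \<partial>M)"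
        using main[OF B] by (simp add: pm left_diff_distrib)
    qed (use ip pm0 in auto)
    moreover have "integrable M (\<lambda>\<omega>. p \<omega> * Y \<omega>)" "integrable M (\<lambda>\<omega>. m \<omega> * Y \<omega>)"
      by (rule Bochner_Integration.integrable_bound[OF iRY]; auto simp: p_def m_def abs_mult mult_right_mono)+
    ultimately show ?thesis by (simp add: pm left_diff_distrib)
  qed
  ultimately show ?thesis using \<tau> by simp
qed

section \<open>A negative moment of the residual sum of squares of a small sample\<close>

lemma ennreal_inverse_antimono: "a \<le> b \<Longrightarrow> inverse b \<le> inverse (a :: ennreal)"
proof (cases "a = 0 \<or> b = top")
  case False
  moreover assume "a \<le> b"
  ultimately obtain r s where "a = ennreal r" "b = ennreal s" "0 < r" "r \<le> s"
    by (cases a; cases b) (auto simp: top_unique)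
  thus ?thesis by (simp add: inverse_ennreal ennreal_leI le_imp_inverse_le)
qed auto

lemma nn_integral_inverse_sqrt_unit_interval:
  "(\<integral>\<^sup>+u. inverse (ennreal (sqrt \<bar>u\<bar>)) * indicator {-1..1} u \<partial>lborel) \<le> 4"
proof -
  let ?f = "\<lambda>u::real. inverse (ennreal (sqrt \<bar>u\<bar>))"
  let ?g = "\<lambda>x::real. if x \<in> {0..1} then x powr (-1/2) else 0"
  have half: "(\<integral>\<^sup>+u. ?f u * indicator {0..1} u \<partial>lborel) = 2"
  proof -
    have "((\<lambda>x::real. x powr (-1/2)) has_integral (1 powr (-1/2+1) / (-1/2+1))) {0..1}"
      by (rule has_integral_powr_from_0) auto
    hence "(?g has_integral 2) UNIV" by (subst has_integral_restrict_UNIV) simp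
    hence "(\<integral>\<^sup>+x. ennreal (?g x) \<partial>lborel) = ennreal 2"
      by (intro nn_integral_has_integral_lborel) auto
    moreover have "(\<integral>\<^sup>+u. ?f u * indicator {0..1} u \<partial>lborel) = (\<integral>\<^sup>+x. ennreal (?g x) \<partial>lborel)"
    proof (rule nn_integral_cong_AE)
      have "AE u in lborel. u \<noteq> (0::real)" by (rule AE_lborel_singleton)
      thus "AE u in lborel. ?f u * indicator {0..1} u = ennreal (?g u)"
        by eventually_elim (auto simp: indicator_def inverse_ennreal powr_minus powr_half_sqrt powr_minus_divide)
    qed
    ultimately show ?thesis by simp
  qed
  have "(\<integral>\<^sup>+u. ?f u * indicator {-1..1} u \<partial>lborel)
      \<le> (\<integral>\<^sup>+u. ?f u * indicator {0..1} u + ?f (-u) * indicator {0..1} (-u) \<partial>lborel)"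
    by (intro nn_integral_mono) (auto simp: indicator_def)
  also have "\<dots> = (\<integral>\<^sup>+u. ?f u * indicator {0..1} u \<partial>lborel) + (\<integral>\<^sup>+u. ?f (-u) * indicator {0..1} (-u) \<partial>lborel)"
    by (rule nn_integral_add) auto
  also have "(\<integral>\<^sup>+u. ?f (-u) * indicator {0..1} (-u) \<partial>lborel) = (\<integral>\<^sup>+u. ?f u * indicator {0..1} u \<partial>lborel)"
    using nn_integral_lborel_affine_isometry[of "\<lambda>u. ?f u * indicator {0..1} u" "-1" 0] by simp
  finally show ?thesis by (simp add: half)
qed

lemma normal_law_nn_integral_inverse_sqrt_le:
  assumes \<tau>: "0 < \<tau>"
  shows "(\<integral>\<^sup>+r. inverse (ennreal (sqrt \<bar>t + r\<bar>)) \<partial>normal_law 0 \<tau>) \<le> ennreal (1 + 4 / (\<tau> * sqrt (2 * pi)))"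
proof -
  let ?f = "\<lambda>u::real. inverse (ennreal (sqrt \<bar>u\<bar>))"
  let ?c = "1 / (\<tau> * sqrt (2 * pi))"
  have c: "?c > 0" using \<tau> by simp
  have d: "normal_density 0 \<tau> r \<le> ?c" for r
  proof -
    have "normal_density 0 \<tau> r = ?c * exp (- r\<^sup>2 / (2 * \<tau>\<^sup>2))"
      using \<tau> by (simp add: normal_density_def real_sqrt_mult)
    also have "\<dots> \<le> ?c * 1" by (rule mult_left_mono) (use c in auto)
    finally show ?thesis by simp
  qed
  have pw: "ennreal (normal_density 0 \<tau> r) * ?f (t + r)
      \<le> ennreal (normal_density 0 \<tau> r) + ennreal ?c * (?f (t + r) * indicator {-1..1} (t + r))" for r
  proof (cases "t + r \<in> {-1..1}")
    case True
    have "ennreal (normal_density 0 \<tau> r) * ?f (t + r) \<le> ennreal ?c * ?f (t + r)"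
      by (intro mult_right_mono ennreal_leI d) simp
    thus ?thesis using True by (simp add: add_increasing)
  next
    case False
    hence "1 \<le> sqrt \<bar>t + r\<bar>" by auto
    hence "?f (t + r) \<le> 1" using ennreal_inverse_antimono[of 1 "ennreal (sqrt \<bar>t + r\<bar>)"] by simp
    hence "ennreal (normal_density 0 \<tau> r) * ?f (t + r) \<le> ennreal (normal_density 0 \<tau> r) * 1"
      by (rule mult_left_mono) simp
    thus ?thesis using False by simp
  qed
  have "(\<integral>\<^sup>+r. ?f (t + r) \<partial>normal_law 0 \<tau>) = (\<integral>\<^sup>+r. ennreal (normal_density 0 \<tau> r) * ?f (t + r) \<partial>lborel)"
    unfolding normal_law_eq_density[OF \<tau>] by (rule nn_integral_density) auto
  also have "\<dots> \<le> (\<integral>\<^sup>+r. ennreal (normal_density 0 \<tau> r) + ennreal ?c * (?f (t + r) * indicator {-1..1} (t + r)) \<partial>lborel)"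
    by (intro nn_integral_mono pw)
  also have "\<dots> = (\<integral>\<^sup>+r. ennreal (normal_density 0 \<tau> r) \<partial>lborel)
      + (\<integral>\<^sup>+r. ennreal ?c * (?f (t + r) * indicator {-1..1} (t + r)) \<partial>lborel)"
    by (rule nn_integral_add) auto
  also have "(\<integral>\<^sup>+r. ennreal (normal_density 0 \<tau> r) \<partial>lborel) = 1"
    using \<tau> by (subst nn_integral_eq_integral) (auto simp: integral_normal_density)
  also have "(\<integral>\<^sup>+r. ennreal ?c * (?f (t + r) * indicator {-1..1} (t + r)) \<partial>lborel)
      = ennreal ?c * (\<integral>\<^sup>+r. ?f (t + r) * indicator {-1..1} (t + r) \<partial>lborel)"
    by (rule nn_integral_cmult) auto
  also have "(\<integral>\<^sup>+r. ?f (t + r) * indicator {-1..1} (t + r) \<partial>lborel) = (\<integral>\<^sup>+u. ?f u * indicator {-1..1} u \<partial>lborel)"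
    using nn_integral_lborel_affine_isometry[of "\<lambda>u. ?f u * indicator {-1..1} u" 1 t] by simp
  also have "1 + ennreal ?c * (\<integral>\<^sup>+u. ?f u * indicator {-1..1} u \<partial>lborel) \<le> 1 + ennreal ?c * 4"
    by (intro add_left_mono mult_left_mono nn_integral_inverse_sqrt_unit_interval) simp
  also have "\<dots> = ennreal (1 + 4 / (\<tau> * sqrt (2 * pi)))"
    using c ennreal_mult[of ?c 4] \<tau> by simp
  finally show ?thesis .
qed

text \<open>The normalisation keeps a coefficient equal to \<open>1\<close>, so that integrating over the corresponding residual alone
  gives a bound that does not depend on the relation.\<close>

lemma exists_normalized_linear_relation:
  fixes v :: "'i \<Rightarrow> real ^ 'n"
  assumes I: "finite I" "CARD('n) < card I"
  obtains u i0 where "i0 \<in> I" "u i0 = 1" "\<forall>i\<in>I. \<bar>u i\<bar> \<le> 1" "(\<Sum>i\<in>I. u i *\<^sub>R v i) = 0"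
proof -
  have "\<exists>u. (\<exists>i\<in>I. u i \<noteq> 0) \<and> (\<Sum>i\<in>I. u i *\<^sub>R v i) = 0"
  proof (cases "inj_on v I")
    case True
    have "dependent (v ` I)"
      by (rule dependent_biggerset) (use I True in \<open>auto simp: card_image\<close>)
    then obtain w where w: "\<exists>x\<in>v ` I. w x \<noteq> 0" "(\<Sum>x\<in>v ` I. w x *\<^sub>R x) = 0"
      using I(1) by (subst (asm) real_vector.dependent_finite) auto
    thus ?thesis
      by (intro exI[of _ "\<lambda>i. w (v i)"]) (auto simp: sum.reindex[OF True])
  next
    case False
    then obtain i i' where i: "i \<in> I" "i' \<in> I" "i \<noteq> i'" "v i = v i'" by (auto simp: inj_on_def)
    let ?u = "\<lambda>l. if l = i then 1 else if l = i' then -1 else 0 :: real"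
    have "(\<Sum>l\<in>I. ?u l *\<^sub>R v l) = (\<Sum>l\<in>I. (if l = i then v i else 0) - (if l = i' then v i' else 0))"
      using i(3) by (intro sum.cong refl) auto
    also have "\<dots> = 0" using I(1) i by (simp add: sum_subtractf)
    finally show ?thesis using i(1) by (intro exI[of _ ?u]) auto
  qed
  then obtain u where u: "\<exists>i\<in>I. u i \<noteq> 0" "(\<Sum>i\<in>I. u i *\<^sub>R v i) = 0" by blast
  have "Max ((\<lambda>i. \<bar>u i\<bar>) ` I) \<in> (\<lambda>i. \<bar>u i\<bar>) ` I" by (rule Max_in) (use I u in auto)
  then obtain i0 where i0: "i0 \<in> I" "\<bar>u i0\<bar> = Max ((\<lambda>i. \<bar>u i\<bar>) ` I)" by auto
  have le: "\<bar>u i\<bar> \<le> \<bar>u i0\<bar>" if "i \<in> I" for i unfolding i0(2) by (rule Max_ge) (use I that in auto)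
  have "u i0 \<noteq> 0" using u(1) le by force
  show ?thesis
  proof (rule that[of i0 "\<lambda>i. u i / u i0"])
    show "\<forall>i\<in>I. \<bar>u i / u i0\<bar> \<le> 1" using le \<open>u i0 \<noteq> 0\<close> by (simp add: abs_divide)
    have "(\<Sum>i\<in>I. (u i / u i0) *\<^sub>R v i) = (1 / u i0) *\<^sub>R (\<Sum>i\<in>I. u i *\<^sub>R v i)"
      by (simp add: scaleR_sum_right)
    thus "(\<Sum>i\<in>I. (u i / u i0) *\<^sub>R v i) = 0" using u(2) by simp
  qed (use i0 \<open>u i0 \<noteq> 0\<close> in auto)
qed

text \<open>The residual sum of squares of the regression of \<open>r\<close> on the covariates \<open>z\<close> (up to the sign of \<open>b\<close>), as an
  infimum, which makes sense without any rank condition.\<close>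

definition min_sq_residual :: "'i set \<Rightarrow> ('i \<Rightarrow> real) \<Rightarrow> ('i \<Rightarrow> real ^ 'n) \<Rightarrow> real" where
  "min_sq_residual I r z = (INF b. \<Sum>i\<in>I. (r i + b \<bullet> z i)\<^sup>2)"

lemma min_sq_residual_le: "min_sq_residual I r z \<le> (\<Sum>i\<in>I. (r i + b \<bullet> z i)\<^sup>2)"
  unfolding min_sq_residual_def
  by (rule cINF_lower) (auto intro!: bdd_belowI[of _ 0] sum_nonneg)

lemma min_sq_residual_nonneg: "0 \<le> min_sq_residual I r z"
  unfolding min_sq_residual_def by (rule cINF_greatest) (auto intro!: sum_nonneg)

lemma min_sq_residual_ge:
  assumes "finite I" "(\<Sum>i\<in>I. u i *\<^sub>R z i) = 0" "\<And>i. i \<in> I \<Longrightarrow> \<bar>u i\<bar> \<le> 1" 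
  shows "(\<Sum>i\<in>I. u i * r i)\<^sup>2 / real (card I) \<le> min_sq_residual I r z"
  unfolding min_sq_residual_def
proof (rule cINF_greatest)
  fix b
  have "(\<Sum>i\<in>I. u i * (b \<bullet> z i)) = b \<bullet> (\<Sum>i\<in>I. u i *\<^sub>R z i)" by (simp add: inner_sum_right)
  hence "(\<Sum>i\<in>I. u i * r i) = (\<Sum>i\<in>I. u i * (r i + b \<bullet> z i))"
    using assms(2) by (simp add: distrib_left sum.distrib)
  also have "\<dots>\<^sup>2 \<le> (\<Sum>i\<in>I. (u i)\<^sup>2) * (\<Sum>i\<in>I. (r i + b \<bullet> z i)\<^sup>2)"
    by (rule Cauchy_Schwarz_ineq_sum)
  also have "\<dots> \<le> real (card I) * (\<Sum>i\<in>I. (r i + b \<bullet> z i)\<^sup>2)"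
  proof (rule mult_right_mono)
    have "(\<Sum>i\<in>I. (u i)\<^sup>2) \<le> (\<Sum>i\<in>I. 1)"
      using assms(3) by (intro sum_mono) (simp add: abs_square_le_1)
    thus "(\<Sum>i\<in>I. (u i)\<^sup>2) \<le> real (card I)" by simp
  qed (auto intro!: sum_nonneg)
  finally show "(\<Sum>i\<in>I. u i * r i)\<^sup>2 / real (card I) \<le> (\<Sum>i\<in>I. (r i + b \<bullet> z i)\<^sup>2)"
    by (cases "card I = 0") (auto simp: field_simps intro!: sum_nonneg)
qed simp

text \<open>By continuity in \<open>b\<close> the infimum may be taken over a countable dense set.\<close>

lemma borel_measurable_min_sq_residual [measurable (raw)]:
  fixes r :: "'i \<Rightarrow> 'a \<Rightarrow> real" and z :: "'i \<Rightarrow> 'a \<Rightarrow> real ^ 'n"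
  assumes "\<And>i. i \<in> I \<Longrightarrow> r i \<in> borel_measurable M" "\<And>i. i \<in> I \<Longrightarrow> z i \<in> borel_measurable M"
  shows "(\<lambda>x. min_sq_residual I (\<lambda>i. r i x) (\<lambda>i. z i x)) \<in> borel_measurable M"
proof -
  obtain D :: "(real ^ 'n) set" where D: "countable D" "\<And>X. open X \<Longrightarrow> X \<noteq> {} \<Longrightarrow> \<exists>d\<in>D. d \<in> X"
    by (rule countable_dense_setE) blast
  have "D \<noteq> {}" using D(2)[of UNIV] by auto
  have bdd: "bdd_below ((\<lambda>b. \<Sum>i\<in>I. (r i + b \<bullet> z i)\<^sup>2) ` A)" for A :: "(real ^ 'n) set" and r :: "'i \<Rightarrow> real" and z
    by (auto intro!: bdd_belowI[of _ 0] sum_nonneg)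
  have eq: "min_sq_residual I r z = (INF b\<in>D. \<Sum>i\<in>I. (r i + b \<bullet> z i)\<^sup>2)" for r :: "'i \<Rightarrow> real" and z :: "'i \<Rightarrow> real ^ 'n"
  proof (rule antisym)
    show "min_sq_residual I r z \<le> (INF b\<in>D. \<Sum>i\<in>I. (r i + b \<bullet> z i)\<^sup>2)"
      by (rule cINF_greatest) (use \<open>D \<noteq> {}\<close> in \<open>auto intro: min_sq_residual_le\<close>)
    let ?f = "\<lambda>b. \<Sum>i\<in>I. (r i + b \<bullet> z i)\<^sup>2"
    let ?m = "INF b\<in>D. ?f b"
    have cl: "closed {b. ?m \<le> ?f b}" by (intro closed_Collect_le continuous_intros)
    have "- {b. ?m \<le> ?f b} = {}"
    proof (rule ccontr)
      assume "- {b. ?m \<le> ?f b} \<noteq> {}"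
      then obtain d where "d \<in> D" "d \<in> - {b. ?m \<le> ?f b}" using D(2) cl open_Compl by blast
      thus False using cINF_lower[OF bdd, of d D r z] by auto
    qed
    hence "?m \<le> ?f b" for b by auto
    thus "?m \<le> min_sq_residual I r z" unfolding min_sq_residual_def by (intro cINF_greatest) auto
  qed
  show ?thesis unfolding eq
    by (rule borel_measurable_cINF[OF D(1)]) (use assms bdd in auto)
qed

text \<open>The power \<open>d powr (-1/4)\<close>, with the value \<open>\<infinity>\<close> at \<open>d = 0\<close>.\<close>

definition inv_root4 :: "real \<Rightarrow> ennreal" where
  "inv_root4 d = inverse (ennreal (sqrt (sqrt d)))"

lemma measurable_inv_root4 [measurable]: "inv_root4 \<in> borel_measurable borel"
  unfolding inv_root4_def[abs_def] by measurable

lemma inv_root4_antimono: "a \<le> b \<Longrightarrow> inv_root4 b \<le> inv_root4 a"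
  unfolding inv_root4_def by (intro ennreal_inverse_antimono ennreal_leI) simp

text \<open>A bound for \<open>E(\<rho> powr (-1/4))\<close>, where \<open>\<rho>\<close> is the residual sum of squares of \<open>m\<close> independent normal variables of
  standard deviation \<open>\<tau>\<close> regressed on fewer than \<open>m\<close> covariates, uniform in the covariates. The term \<open>4 / (\<tau> * sqrt (2 * pi))\<close> is the maximum of the
  normal density times the integral of \<open>1 / sqrt \<bar>u\<bar>\<close> over \<open>[-1, 1]\<close>.\<close>

definition residual_bound :: "real \<Rightarrow> nat \<Rightarrow> real" where
  "residual_bound \<tau> m = sqrt (sqrt (real m)) * (1 + 4 / (\<tau> * sqrt (2 * pi)))"

lemma inv_root4_square_divide:
  assumes "m > 0"
  shows "inv_root4 (w\<^sup>2 / m) = ennreal (sqrt (sqrt m)) * inverse (ennreal (sqrt \<bar>w\<bar>))"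
proof -
  have "sqrt (sqrt (w\<^sup>2 / m)) = inverse (sqrt (sqrt m)) * sqrt \<bar>w\<bar>"
    by (simp add: real_sqrt_divide) (simp add: divide_inverse mult.commute)
  hence "inv_root4 (w\<^sup>2 / m) = inverse (ennreal (inverse (sqrt (sqrt m))) * ennreal (sqrt \<bar>w\<bar>))"
    using assms unfolding inv_root4_def by (simp add: ennreal_mult)
  also have "\<dots> = inverse (ennreal (inverse (sqrt (sqrt m)))) * inverse (ennreal (sqrt \<bar>w\<bar>))"
    by (rule ennreal_inverse_mult) auto
  also have "inverse (ennreal (inverse (sqrt (sqrt m)))) = ennreal (sqrt (sqrt m))"
    using assms by (subst inverse_ennreal) auto
  finally show ?thesis .
qed

lemma prob_space_normal_law: "prob_space (normal_law m s)"
proof -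
  interpret N: prob_space std_normal_distribution
    by (rule prob_space_normal_density) simp
  show ?thesis unfolding normal_law_def by (rule N.prob_space_distr) simp
qed

lemma sets_normal_law [measurable_cong, simp]: "sets (normal_law m s) = sets borel"
  by (simp add: normal_law_def)

lemma space_normal_law [simp]: "space (normal_law m s) = UNIV"
  by (simp add: normal_law_def)

text \<open>The covariates are fixed here. They satisfy a linear relation \<open>u\<close> with \<open>u i0 = 1\<close>, so the residual sum of
  squares is at least \<open>(\<Sum>i. u i * r i)\<^sup>2 / card I\<close>; integrate over \<open>r i0\<close> first.\<close>

lemma nn_integral_inv_root4_min_sq_residual_le:
  fixes z :: "'i \<Rightarrow> real ^ 'n"
  assumes I: "finite I" "CARD('n) < card I" and \<tau>: "0 < \<tau>"
  shows "(\<integral>\<^sup>+r. inv_root4 (min_sq_residual I r z) \<partial>PiM I (\<lambda>_. normal_law 0 \<tau>)) \<le> ennreal (residual_bound \<tau> (card I))"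
proof -
  interpret N: prob_space "normal_law 0 \<tau>" by (rule prob_space_normal_law)
  interpret product_prob_space "\<lambda>_. normal_law 0 \<tau>" UNIV ..
  obtain u i0 where u: "i0 \<in> I" "u i0 = 1" "\<forall>i\<in>I. \<bar>u i\<bar> \<le> 1" "(\<Sum>i\<in>I. u i *\<^sub>R z i) = 0"
    by (rule exists_normalized_linear_relation[OF I, of z])
  define J where "J = I - {i0}"
  have J: "finite J" "i0 \<notin> J" "insert i0 J = I" using I u(1) by (auto simp: J_def)
  let ?N = "\<lambda>_::'i. normal_law 0 \<tau>"
  let ?c = "ennreal (sqrt (sqrt (real (card I))))"
  have m0: "0 < real (card I)" using I by linarith
  have [measurable]: "(\<lambda>r. inv_root4 (min_sq_residual I r z)) \<in> borel_measurable (PiM I ?N)"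
  proof -
    have "(\<lambda>r. min_sq_residual I (\<lambda>i. r i) (\<lambda>i. z i)) \<in> borel_measurable (PiM I ?N)"
      by (rule borel_measurable_min_sq_residual) measurable
    from measurable_compose[OF this measurable_inv_root4] show ?thesis .
  qed
  have "(\<integral>\<^sup>+r. inv_root4 (min_sq_residual I r z) \<partial>PiM I ?N)
     = (\<integral>\<^sup>+r. (\<integral>\<^sup>+y. inv_root4 (min_sq_residual I (r(i0 := y)) z) \<partial>normal_law 0 \<tau>) \<partial>PiM J ?N)"
    using product_nn_integral_insert[OF J(1,2), of "\<lambda>r. inv_root4 (min_sq_residual I r z)"] J(3) by simp
  also have "\<dots> \<le> (\<integral>\<^sup>+r. ennreal (residual_bound \<tau> (card I)) \<partial>PiM J ?N)"
  proof (rule nn_integral_mono)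
    fix r
    define t where "t = (\<Sum>i\<in>J. u i * r i)"
    have "(\<integral>\<^sup>+y. inv_root4 (min_sq_residual I (r(i0 := y)) z) \<partial>normal_law 0 \<tau>)
       \<le> (\<integral>\<^sup>+y. ?c * inverse (ennreal (sqrt \<bar>t + y\<bar>)) \<partial>normal_law 0 \<tau>)"
    proof (rule nn_integral_mono)
      fix y
      have "(\<Sum>i\<in>I. u i * (r(i0 := y)) i) = y + (\<Sum>i\<in>J. u i * (r(i0 := y)) i)"
        using J u(2) by (subst J(3)[symmetric], subst sum.insert) auto
      also have "(\<Sum>i\<in>J. u i * (r(i0 := y)) i) = t"
        unfolding t_def using J(2) by (intro sum.cong) auto
      finally have s: "(\<Sum>i\<in>I. u i * (r(i0 := y)) i) = t + y" by simp
      have "(t + y)\<^sup>2 / real (card I) \<le> min_sq_residual I (r(i0 := y)) z"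
        using min_sq_residual_ge[where I=I and u=u and r="r(i0 := y)" and z=z] I(1) u s by simp
      thus "inv_root4 (min_sq_residual I (r(i0 := y)) z) \<le> ?c * inverse (ennreal (sqrt \<bar>t + y\<bar>))"
        using inv_root4_antimono inv_root4_square_divide[OF m0, of "t + y"] by metis
    qed
    also have "\<dots> = ?c * (\<integral>\<^sup>+y. inverse (ennreal (sqrt \<bar>t + y\<bar>)) \<partial>normal_law 0 \<tau>)"
      by (rule nn_integral_cmult) simp
    also have "\<dots> \<le> ?c * ennreal (1 + 4 / (\<tau> * sqrt (2 * pi)))"
      by (intro mult_left_mono normal_law_nn_integral_inverse_sqrt_le \<tau>) simp
    also have "\<dots> = ennreal (residual_bound \<tau> (card I))"
      using \<tau> unfolding residual_bound_def by (subst ennreal_mult) auto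
    finally show "(\<integral>\<^sup>+y. inv_root4 (min_sq_residual I (r(i0 := y)) z) \<partial>normal_law 0 \<tau>) \<le> ennreal (residual_bound \<tau> (card I))" .
  qed
  also have "\<dots> = ennreal (residual_bound \<tau> (card I))"
  proof -
    interpret J: product_prob_space "\<lambda>_. normal_law 0 \<tau>" J ..
    show ?thesis by (simp add: J.P.emeasure_space_1)
  qed
  finally show ?thesis .
qed

lemma Int_stable_vimage: "Int_stable {f -` A \<inter> \<Omega> |A. A \<in> sets S}"
proof (rule Int_stableI, clarify)
  fix A B assume "A \<in> sets S" "B \<in> sets S"
  thus "\<exists>C. f -` A \<inter> \<Omega> \<inter> (f -` B \<inter> \<Omega>) = f -` C \<inter> \<Omega> \<and> C \<in> sets S"
    by (intro exI[of _ "A \<inter> B"]) auto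
qed

lemma vimage_restrict_in_sigma_sets:
  assumes G: "G \<subseteq> sets M" "\<And>i B. i \<in> I \<Longrightarrow> B \<in> sets K \<Longrightarrow> (\<lambda>\<omega>. \<theta> (x i \<omega>)) -` B \<inter> space M \<in> G"
    and x: "\<And>i. i \<in> I \<Longrightarrow> x i \<in> measurable M L"
    and \<theta>: "\<theta> \<in> measurable L K" and A: "A \<in> sets (PiM I (\<lambda>_. K))"
  shows "(\<lambda>\<omega>. \<lambda>i\<in>I. \<theta> (x i \<omega>)) -` A \<inter> space M \<in> sigma_sets (space M) G"
proof -
  have GP: "G \<subseteq> Pow (space M)" using G(1) sets.sets_into_space by blast
  have "(\<lambda>\<omega>. \<lambda>i\<in>I. \<theta> (x i \<omega>)) \<in> measurable (sigma (space M) G) (PiM I (\<lambda>_. K))"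
  proof (rule measurable_restrict, rule measurableI)
    fix i \<omega> assume "i \<in> I" "\<omega> \<in> space (sigma (space M) G)"
    thus "\<theta> (x i \<omega>) \<in> space K" using measurable_space[OF x] measurable_space[OF \<theta>] GP by auto
  next
    fix i B assume "i \<in> I" "B \<in> sets K"
    thus "(\<lambda>\<omega>. \<theta> (x i \<omega>)) -` B \<inter> space (sigma (space M) G) \<in> sets (sigma (space M) G)"
      using G(2) GP by (auto intro: sigma_sets.Basic)
  qed
  from measurable_sets[OF this A] show ?thesis using GP by simp
qed

text \<open>If the \<open>x i\<close> are independent and two functions of each \<open>x i\<close> are independent of each other, then the two
  families of these functions are independent.\<close>

lemma (in prob_space) indep_pair_PiM:
  assumes I: "finite I" "I \<noteq> {}"
    and ind: "indep_vars (\<lambda>_. L) x I"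
    and [measurable]: "\<phi> \<in> measurable L S" "\<psi> \<in> measurable L T"
    and pair: "\<And>i. i \<in> I \<Longrightarrow> indep_pair M S (\<lambda>\<omega>. \<phi> (x i \<omega>)) T (\<lambda>\<omega>. \<psi> (x i \<omega>))"
  shows "indep_pair M (PiM I (\<lambda>_. S)) (\<lambda>\<omega>. \<lambda>i\<in>I. \<phi> (x i \<omega>)) (PiM I (\<lambda>_. T)) (\<lambda>\<omega>. \<lambda>i\<in>I. \<psi> (x i \<omega>))"
proof -
  have x[measurable]: "x i \<in> measurable M L" if "i \<in> I" for i using ind that by (auto simp: indep_vars_def)
  define E where "E = (\<lambda>(i, b). if b then {(\<lambda>\<omega>. \<phi> (x i \<omega>)) -` A \<inter> space M |A. A \<in> sets S}
     else {(\<lambda>\<omega>. \<psi> (x i \<omega>)) -` A \<inter> space M |A. A \<in> sets T})"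
  have E1: "E (i, True) = {(\<lambda>\<omega>. \<phi> (x i \<omega>)) -` A \<inter> space M |A. A \<in> sets S}"
    and E2: "E (i, False) = {(\<lambda>\<omega>. \<psi> (x i \<omega>)) -` A \<inter> space M |A. A \<in> sets T}" for i
    by (simp_all add: E_def)
  have Eev: "E (i, b) \<subseteq> events" if "i \<in> I" for i b
    using x[OF that] by (cases b) (auto simp: E1 E2 intro!: measurable_sets)
  have Esp: "space M \<in> E (i, b)" if "i \<in> I" for i b
  proof (cases b)
    case True
    have "space M = (\<lambda>\<omega>. \<phi> (x i \<omega>)) -` space S \<inter> space M"
      using measurable_space[OF x[OF that]] measurable_space[OF assms(4)] by auto
    thus ?thesis using True by (auto simp: E1)
  next
    case False
    have "space M = (\<lambda>\<omega>. \<psi> (x i \<omega>)) -` space T \<inter> space M"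
      using measurable_space[OF x[OF that]] measurable_space[OF assms(5)] by auto
    thus ?thesis using False by (auto simp: E2)
  qed
  have "indep_sets E (I \<times> UNIV)"
  proof (subst indep_sets_finite)
    show "\<forall>A\<in>Pi (I \<times> UNIV) E. prob (\<Inter>j\<in>I \<times> UNIV. A j) = (\<Prod>j\<in>I \<times> UNIV. prob (A j))"
    proof
      fix A assume A: "A \<in> Pi (I \<times> UNIV) E"
      have "\<exists>B\<in>sets S. A (i, True) = (\<lambda>\<omega>. \<phi> (x i \<omega>)) -` B \<inter> space M" if "i \<in> I" for i
        using Pi_mem[OF A, of "(i, True)"] that by (auto simp: E1)
      then obtain B where B: "\<And>i. i \<in> I \<Longrightarrow> B i \<in> sets S" "\<And>i. i \<in> I \<Longrightarrow> A (i, True) = (\<lambda>\<omega>. \<phi> (x i \<omega>)) -` B i \<inter> space M" by metis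
      have "\<exists>C\<in>sets T. A (i, False) = (\<lambda>\<omega>. \<psi> (x i \<omega>)) -` C \<inter> space M" if "i \<in> I" for i
        using Pi_mem[OF A, of "(i, False)"] that by (auto simp: E2)
      then obtain C where C: "\<And>i. i \<in> I \<Longrightarrow> C i \<in> sets T" "\<And>i. i \<in> I \<Longrightarrow> A (i, False) = (\<lambda>\<omega>. \<psi> (x i \<omega>)) -` C i \<inter> space M" by metis
      define D where "D i = (\<phi> -` B i \<inter> space L) \<inter> (\<psi> -` C i \<inter> space L)" for i
      have D: "D i \<in> sets L" if "i \<in> I" for i
        unfolding D_def using B(1)[OF that] C(1)[OF that] by (intro sets.Int measurable_sets[OF assms(4)] measurable_sets[OF assms(5)])
      have AD: "A (i, True) \<inter> A (i, False) = x i -` D i \<inter> space M" if "i \<in> I" for i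
        using measurable_space[OF x[OF that]] by (auto simp: B(2)[OF that] C(2)[OF that] D_def)
      have "(\<Inter>j\<in>I \<times> UNIV. A j) = (\<Inter>i\<in>I. A (i, True) \<inter> A (i, False))"
        by (auto simp: UNIV_bool)
      also have "\<dots> = (\<Inter>i\<in>I. x i -` D i \<inter> space M)" using AD by auto
      also have "prob \<dots> = (\<Prod>i\<in>I. prob (x i -` D i \<inter> space M))"
        by (rule indep_varsD_finite[OF ind I(2,1)]) (use D in auto)
      also have "\<dots> = (\<Prod>i\<in>I. prob (A (i, True)) * prob (A (i, False)))"
      proof (rule prod.cong)
        fix i assume i: "i \<in> I"
        have "x i -` D i \<inter> space M = (\<lambda>\<omega>. \<phi> (x i \<omega>)) -` B i \<inter> (\<lambda>\<omega>. \<psi> (x i \<omega>)) -` C i \<inter> space M"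
          unfolding AD[OF i, symmetric] B(2)[OF i] C(2)[OF i] by auto
        thus "prob (x i -` D i \<inter> space M) = prob (A (i, True)) * prob (A (i, False))"
          using pair[OF i] B[OF i] C[OF i] unfolding indep_pair_iff_prob by metis
      qed simp
      also have "\<dots> = (\<Prod>j\<in>I \<times> UNIV. prob (A j))"
        using prod.cartesian_product[of "\<lambda>i b. prob (A (i, b))" "UNIV :: bool set" I]
        by (simp add: UNIV_bool mult.commute)
      finally show "prob (\<Inter>j\<in>I \<times> UNIV. A j) = (\<Prod>j\<in>I \<times> UNIV. prob (A j))" .
    qed
  qed (use I Eev Esp in auto)
  hence "indep_sets E (\<Union>b\<in>UNIV. I \<times> {b})" by (rule indep_sets_mono_index[rotated]) auto
  hence "indep_sets (\<lambda>b. sigma_sets (space M) (\<Union>i\<in>I \<times> {b}. E i)) UNIV"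
  proof (rule indep_sets_collect_sigma)
    fix b :: bool and i assume "i \<in> I \<times> {b}"
    show "Int_stable (E i)"
      by (cases i) (auto simp: E_def intro: Int_stable_vimage)
  qed (auto simp: disjoint_family_on_def)
  hence *: "prob (A \<inter> B) = prob A * prob B"
    if "A \<in> sigma_sets (space M) (\<Union>i\<in>I \<times> {True}. E i)" "B \<in> sigma_sets (space M) (\<Union>i\<in>I \<times> {False}. E i)" for A B
    using that indep_setsD[of "\<lambda>b. sigma_sets (space M) (\<Union>i\<in>I \<times> {b}. E i)" UNIV UNIV "case_bool A B"]
    by (auto simp: UNIV_bool ac_simps split: bool.split)
  have G0: "(\<Union>i\<in>I \<times> {b}. E i) \<subseteq> events" for b using Eev by blast
  have G1: "(\<lambda>\<omega>. \<phi> (x i \<omega>)) -` B \<inter> space M \<in> (\<Union>i\<in>I \<times> {True}. E i)" if "i \<in> I" "B \<in> sets S" for i B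
    using that by (intro UN_I[of "(i, True)"]) (auto simp: E1)
  have G2: "(\<lambda>\<omega>. \<psi> (x i \<omega>)) -` B \<inter> space M \<in> (\<Union>i\<in>I \<times> {False}. E i)" if "i \<in> I" "B \<in> sets T" for i B
    using that by (intro UN_I[of "(i, False)"]) (auto simp: E2)
  have U: "(\<lambda>\<omega>. \<lambda>i\<in>I. \<phi> (x i \<omega>)) \<in> measurable M (PiM I (\<lambda>_. S))"
    and V: "(\<lambda>\<omega>. \<lambda>i\<in>I. \<psi> (x i \<omega>)) \<in> measurable M (PiM I (\<lambda>_. T))"
    by (intro measurable_restrict; measurable)+
  show ?thesis
    unfolding indep_pair_iff_prob
  proof (intro conjI U V ballI)
    fix A B assume A: "A \<in> sets (PiM I (\<lambda>_. S))" and B: "B \<in> sets (PiM I (\<lambda>_. T))"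
    let ?U = "(\<lambda>\<omega>. \<lambda>i\<in>I. \<phi> (x i \<omega>)) -` A \<inter> space M" and ?V = "(\<lambda>\<omega>. \<lambda>i\<in>I. \<psi> (x i \<omega>)) -` B \<inter> space M"
    have "prob (?U \<inter> ?V) = prob ?U * prob ?V"
    proof (rule *)
      show "?U \<in> sigma_sets (space M) (\<Union>i\<in>I \<times> {True}. E i)"
        by (rule vimage_restrict_in_sigma_sets[OF G0 G1 x assms(4) A])
      show "?V \<in> sigma_sets (space M) (\<Union>i\<in>I \<times> {False}. E i)"
        by (rule vimage_restrict_in_sigma_sets[OF G0 G2 x assms(5) B])
    qed
    moreover have "?U \<inter> ?V = (\<lambda>\<omega>. \<lambda>i\<in>I. \<phi> (x i \<omega>)) -` A \<inter> (\<lambda>\<omega>. \<lambda>i\<in>I. \<psi> (x i \<omega>)) -` B \<inter> space M" by auto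
    ultimately show "prob ((\<lambda>\<omega>. \<lambda>i\<in>I. \<phi> (x i \<omega>)) -` A \<inter> (\<lambda>\<omega>. \<lambda>i\<in>I. \<psi> (x i \<omega>)) -` B \<inter> space M) = prob ?U * prob ?V"
      by simp
  qed
qed

lemma (in prob_space) nn_integral_inv_root4_min_sq_residual_sample_le:
  fixes \<psi> :: "'b \<Rightarrow> real ^ 'n" and \<phi> :: "'b \<Rightarrow> real"
  assumes I: "finite I" "CARD('n) < card I" and \<tau>: "0 < \<tau>"
    and ind: "indep_vars (\<lambda>_. L) x I"
    and [measurable]: "\<phi> \<in> borel_measurable L" "\<psi> \<in> borel_measurable L"
    and pair: "\<And>i. i \<in> I \<Longrightarrow> indep_pair M borel (\<lambda>\<omega>. \<phi> (x i \<omega>)) borel (\<lambda>\<omega>. \<psi> (x i \<omega>))"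
    and law: "\<And>i. i \<in> I \<Longrightarrow> distr M borel (\<lambda>\<omega>. \<phi> (x i \<omega>)) = normal_law 0 \<tau>"
  shows "(\<integral>\<^sup>+\<omega>. inv_root4 (min_sq_residual I (\<lambda>i. \<phi> (x i \<omega>)) (\<lambda>i. \<psi> (x i \<omega>))) \<partial>M) \<le> ennreal (residual_bound \<tau> (card I))"
proof -
  have I0: "I \<noteq> {}" using I by auto
  have x[measurable]: "x i \<in> measurable M L" if "i \<in> I" for i using ind that by (auto simp: indep_vars_def)
  let ?S = "PiM I (\<lambda>_. borel :: real measure)" and ?T = "PiM I (\<lambda>_. borel :: (real ^ 'n) measure)"
  define U where "U \<omega> = (\<lambda>i\<in>I. \<phi> (x i \<omega>))" for \<omega>
  define V where "V \<omega> = (\<lambda>i\<in>I. \<psi> (x i \<omega>))" for \<omega>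
  have UV: "indep_pair M ?S U ?T V"
    unfolding U_def V_def by (rule indep_pair_PiM[OF I(1) I0 ind _ _ pair]) auto
  hence [measurable]: "U \<in> measurable M ?S" "V \<in> measurable M ?T" by (auto simp: indep_pair_def)
  have "indep_vars (\<lambda>_. borel) (\<lambda>i \<omega>. \<phi> (x i \<omega>)) I"
    by (rule indep_vars_compose2[OF ind]) auto
  hence "distr M ?S U = PiM I (\<lambda>i. distr M borel (\<lambda>\<omega>. \<phi> (x i \<omega>)))"
    unfolding U_def by (subst (asm) indep_vars_iff_distr_eq_PiM'[OF I0]) auto
  also have "\<dots> = PiM I (\<lambda>_. normal_law 0 \<tau>)" by (intro PiM_cong) (auto simp: law)
  finally have lawU: "distr M ?S U = PiM I (\<lambda>_. normal_law 0 \<tau>)" .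
  interpret U: prob_space "distr M ?S U" by (rule prob_space_distr) measurable
  interpret V: prob_space "distr M ?T V" by (rule prob_space_distr) measurable
  interpret UV: pair_prob_space "distr M ?S U" "distr M ?T V" ..
  let ?f = "\<lambda>p. inv_root4 (min_sq_residual I (fst p) (snd p))"
  have f[measurable]: "?f \<in> borel_measurable (?S \<Otimes>\<^sub>M ?T)"
  proof -
    have "(\<lambda>p. min_sq_residual I (\<lambda>i. fst p i) (\<lambda>i. snd p i)) \<in> borel_measurable (?S \<Otimes>\<^sub>M ?T)"
      by (rule borel_measurable_min_sq_residual) measurable
    from measurable_compose[OF this measurable_inv_root4] show ?thesis .
  qed
  have "(\<integral>\<^sup>+\<omega>. inv_root4 (min_sq_residual I (\<lambda>i. \<phi> (x i \<omega>)) (\<lambda>i. \<psi> (x i \<omega>))) \<partial>M) = (\<integral>\<^sup>+\<omega>. ?f (U \<omega>, V \<omega>) \<partial>M)"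
    by (intro nn_integral_cong) (simp add: U_def V_def min_sq_residual_def cong: sum.cong)
  also have "\<dots> = (\<integral>\<^sup>+p. ?f p \<partial>distr M (?S \<Otimes>\<^sub>M ?T) (\<lambda>\<omega>. (U \<omega>, V \<omega>)))"
    by (subst nn_integral_distr) auto
  also have "\<dots> = (\<integral>\<^sup>+p. ?f p \<partial>(distr M ?S U \<Otimes>\<^sub>M distr M ?T V))"
    using UV by (simp add: indep_pair_def)
  also have "\<dots> = (\<integral>\<^sup>+z. (\<integral>\<^sup>+r. ?f (r, z) \<partial>distr M ?S U) \<partial>distr M ?T V)"
    by (rule UV.nn_integral_snd[symmetric]) (use f in \<open>simp cong: measurable_cong_sets sets_pair_measure_cong\<close>)
  also have "\<dots> \<le> (\<integral>\<^sup>+z. ennreal (residual_bound \<tau> (card I)) \<partial>distr M ?T V)"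
    unfolding lawU by (intro nn_integral_mono) (use nn_integral_inv_root4_min_sq_residual_le[OF I \<tau>] in simp)
  also have "\<dots> = ennreal (residual_bound \<tau> (card I))" using V.emeasure_space_1 by (simp only: nn_integral_const mult_1_right)
  finally show ?thesis .
qed

section \<open>The inverse residual sum of squares has mean of order 1/n\<close>

text \<open>Each of the four summands is at most the sum \<open>T\<close>, so the product of their fourth roots is at most \<open>T\<close>.\<close>

lemma inverse_sum_le_prod_inv_root4:
  assumes D: "\<And>t. t < 4 \<Longrightarrow> 0 \<le> D t"
  shows "inverse (ennreal (\<Sum>t<4. D t)) \<le> (\<Prod>t<(4::nat). inv_root4 (D t))"
proof -
  define T where "T = (\<Sum>t<(4::nat). D t)"
  have T: "0 \<le> T" unfolding T_def using D by (intro sum_nonneg) auto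
  have le: "D t \<le> T" if "t < 4" for t
    unfolding T_def using D that by (intro member_le_sum) auto
  have eq: "(\<Prod>t<n. inv_root4 (D t)) = inverse (ennreal (\<Prod>t<n. sqrt (sqrt (D t))))" if "n \<le> 4" for n :: nat
    using that
  proof (induction n)
    case (Suc n)
    have "0 \<le> (\<Prod>t<n. sqrt (sqrt (D t)))" using D Suc.prems by (intro prod_nonneg) auto
    thus ?case using Suc D[of n] by (simp add: inv_root4_def ennreal_mult ennreal_inverse_mult)
  qed simp
  have "(\<Prod>t<(4::nat). sqrt (sqrt (D t))) \<le> (\<Prod>t<(4::nat). sqrt (sqrt T))"
    using D le by (intro prod_mono) auto
  also have "\<dots> = (sqrt (sqrt T)) ^ 4" by simp
  also have "\<dots> = ((sqrt (sqrt T))\<^sup>2)\<^sup>2" by (simp flip: power_mult)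
  also have "\<dots> = T" using T by simp
  finally have "inverse (ennreal T) \<le> inverse (ennreal (\<Prod>t<(4::nat). sqrt (sqrt (D t))))"
    by (intro ennreal_inverse_antimono ennreal_leI)
  thus ?thesis by (simp only: eq[OF order_refl] T_def)
qed

text \<open>The inequality between the harmonic and the arithmetic mean.\<close>

lemma inverse_sum_le_sum_inverse:
  fixes T :: "nat \<Rightarrow> real"
  assumes T: "\<And>b. b < B \<Longrightarrow> 0 \<le> T b" and B: "0 < B"
  shows "inverse (ennreal (\<Sum>b<B. T b)) \<le> ennreal (1 / (real B)\<^sup>2) * (\<Sum>b<B. inverse (ennreal (T b)))"
proof (cases "\<exists>b<B. T b = 0")
  case True
  then obtain b where b: "b < B" "T b = 0" by blast
  have "inverse (ennreal (T b)) \<le> (\<Sum>b<B. inverse (ennreal (T b)))" by (rule member_le_sum) (use b in auto)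
  hence S: "(\<Sum>b<B. inverse (ennreal (T b))) = top" unfolding b(2) by (simp only: ennreal_0 ennreal_inverse_zero top_unique)
  show ?thesis unfolding S using B by (simp add: ennreal_mult_top)
next
  case False
  hence pos: "0 < T b" if "b < B" for b using T[OF that] that by (metis less_eq_real_def)
  have S: "0 < (\<Sum>b<B. T b)" using pos B by (intro sum_pos) auto
  have "(\<Sum>b<B. sqrt (T b) * (1 / sqrt (T b))) = (\<Sum>b<B. 1)"
    by (intro sum.cong refl) (use pos in \<open>auto dest: pos\<close>)
  hence "(real B)\<^sup>2 = (\<Sum>b<B. sqrt (T b) * (1 / sqrt (T b)))\<^sup>2" by simp
  also have "\<dots> \<le> (\<Sum>b<B. (sqrt (T b))\<^sup>2) * (\<Sum>b<B. (1 / sqrt (T b))\<^sup>2)"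
    by (rule Cauchy_Schwarz_ineq_sum)
  also have "\<dots> = (\<Sum>b<B. T b) * (\<Sum>b<B. inverse (T b))"
    using pos by (intro arg_cong2[where f="(*)"] sum.cong refl) (auto simp: power_divide inverse_eq_divide less_imp_le)
  finally have "inverse (\<Sum>b<B. T b) \<le> 1 / (real B)\<^sup>2 * (\<Sum>b<B. inverse (T b))"
    using S B by (simp add: field_simps)
  hence "ennreal (inverse (\<Sum>b<B. T b)) \<le> ennreal (1 / (real B)\<^sup>2 * (\<Sum>b<B. inverse (T b)))"
    by (rule ennreal_leI)
  also have "\<dots> = ennreal (1 / (real B)\<^sup>2) * (\<Sum>b<B. ennreal (inverse (T b)))"
  proof -
    have nn: "0 \<le> inverse (T b)" if "b < B" for b using pos[OF that] by simp
    have "(\<Sum>b<B. ennreal (inverse (T b))) = ennreal (\<Sum>b<B. inverse (T b))"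
      by (rule sum_ennreal) (use nn in auto)
    moreover have "0 \<le> (\<Sum>b<B. inverse (T b))" by (rule sum_nonneg) (use nn in auto)
    ultimately show ?thesis by (subst ennreal_mult) auto
  qed
  also have "(\<Sum>b<B. ennreal (inverse (T b))) = (\<Sum>b<B. inverse (ennreal (T b)))"
    using pos by (intro sum.cong refl) (simp add: inverse_ennreal)
  finally show ?thesis using S by (simp add: inverse_ennreal)
qed

lemma sum_min_sq_residual_le:
  assumes I: "finite I" and S: "finite S" "disjoint_family_on J S" "\<And>s. s \<in> S \<Longrightarrow> J s \<subseteq> I"
  shows "(\<Sum>s\<in>S. min_sq_residual (J s) r z) \<le> min_sq_residual I r z"
proof -
  have "(\<Sum>s\<in>S. min_sq_residual (J s) r z) \<le> (\<Sum>i\<in>I. (r i + b \<bullet> z i)\<^sup>2)" for b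
  proof -
    have "(\<Sum>s\<in>S. min_sq_residual (J s) r z) \<le> (\<Sum>s\<in>S. \<Sum>i\<in>J s. (r i + b \<bullet> z i)\<^sup>2)"
      by (intro sum_mono min_sq_residual_le)
    also have "\<dots> = (\<Sum>i\<in>(\<Union>s\<in>S. J s). (r i + b \<bullet> z i)\<^sup>2)"
      using S I by (intro sum.UNION_disjoint[symmetric]) (auto simp: disjoint_family_on_def intro: finite_subset[OF S(3) I])
    also have "\<dots> \<le> (\<Sum>i\<in>I. (r i + b \<bullet> z i)\<^sup>2)"
      using S I by (intro sum_mono2) auto
    finally show ?thesis .
  qed
  thus ?thesis unfolding min_sq_residual_def[of I] by (intro cINF_greatest) auto
qed

text \<open>The rows are cut into \<open>B\<close> blocks of four samples of \<open>l = p + 1\<close> rows each, \<open>J s\<close> being the rows of the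
  \<open>s\<close>-th sample, and the at most \<open>4 l - 1\<close> remaining rows are dropped. As \<open>n \<ge> 4 l\<close>, one has \<open>B \<ge> n / (8 l)\<close>.\<close>

lemma (in prob_space) nn_integral_inverse_min_sq_residual_le:
  fixes \<psi> :: "'b \<Rightarrow> real ^ 'n" and \<phi> :: "'b \<Rightarrow> real"
  assumes \<tau>: "0 < \<tau>" and n: "4 * Suc CARD('n) \<le> n"
    and ind: "indep_vars (\<lambda>_. L) x {..<n}"
    and [measurable]: "\<phi> \<in> borel_measurable L" "\<psi> \<in> borel_measurable L"
    and pair: "\<And>i. i < n \<Longrightarrow> indep_pair M borel (\<lambda>\<omega>. \<phi> (x i \<omega>)) borel (\<lambda>\<omega>. \<psi> (x i \<omega>))"
    and law: "\<And>i. i < n \<Longrightarrow> distr M borel (\<lambda>\<omega>. \<phi> (x i \<omega>)) = normal_law 0 \<tau>"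
  shows "(\<integral>\<^sup>+\<omega>. inverse (ennreal (min_sq_residual {..<n} (\<lambda>i. \<phi> (x i \<omega>)) (\<lambda>i. \<psi> (x i \<omega>)))) \<partial>M)
    \<le> ennreal (8 * real (Suc CARD('n)) * residual_bound \<tau> (Suc CARD('n)) ^ 4 / real n)"
proof -
  define l where "l = Suc CARD('n)"
  define B where "B = n div (4 * l)"
  define J where "J s = {s * l..<Suc s * l}" for s
  define c where "c = residual_bound \<tau> l"
  have c: "0 \<le> c" unfolding c_def residual_bound_def using \<tau> by auto
  have l: "0 < l" by (simp add: l_def)
  have B: "0 < B" using n by (simp add: B_def l_def div_greater_zero_iff)
  have Bn: "B * (4 * l) \<le> n" unfolding B_def by simp
  have nB: "real n \<le> real B * (8 * real l)"
  proof -
    have "n = B * (4 * l) + n mod (4 * l)" by (simp only: B_def div_mult_mod_eq)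
    moreover have "n mod (4 * l) < 4 * l" using l by simp
    moreover have "4 * l \<le> B * (4 * l)" using B by simp
    ultimately have "n \<le> B * (8 * l)" by linarith
    hence "real n \<le> real (B * (8 * l))" by (simp only: of_nat_le_iff)
    thus ?thesis by simp
  qed
  have Jsub: "J s \<subseteq> {..<n}" if "s < B * 4" for s
  proof -
    have "Suc s * l \<le> B * 4 * l" using that by (intro mult_le_mono1) simp
    also have "\<dots> \<le> n" using Bn by (simp add: mult.assoc)
    finally show ?thesis unfolding J_def by auto
  qed
  have Jdisj: "disjoint_family_on J A" for A
  proof (unfold disjoint_family_on_def, intro ballI impI)
    fix s t :: nat assume "s \<noteq> t"
    hence "Suc s \<le> t \<or> Suc t \<le> s" by linarith
    hence "Suc s * l \<le> t * l \<or> Suc t * l \<le> s * l" by (meson mult_le_mono1)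
    thus "J s \<inter> J t = {}" unfolding J_def by auto
  qed
  have Jfin: "finite (J s)" "card (J s) = l" for s by (auto simp: J_def)
  have x[measurable]: "x i \<in> measurable M L" if "i < n" for i using ind that by (auto simp: indep_vars_def)
  define D where "D s \<omega> = min_sq_residual (J s) (\<lambda>i. \<phi> (x i \<omega>)) (\<lambda>i. \<psi> (x i \<omega>))" for s \<omega>
  have D0: "0 \<le> D s \<omega>" for s \<omega> by (simp add: D_def min_sq_residual_nonneg)
  have Dm[measurable]: "D s \<in> borel_measurable M" if "s < B * 4" for s
    unfolding D_def by (rule borel_measurable_min_sq_residual) (use Jsub[OF that] in auto)
  have ED: "(\<integral>\<^sup>+\<omega>. inv_root4 (D s \<omega>) \<partial>M) \<le> ennreal c" if "s < B * 4" for s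
  proof -
    have "(\<integral>\<^sup>+\<omega>. inv_root4 (D s \<omega>) \<partial>M) \<le> ennreal (residual_bound \<tau> (card (J s)))"
      unfolding D_def
      by (rule nn_integral_inv_root4_min_sq_residual_sample_le[where L=L])
         (use Jfin Jsub[OF that] \<tau> pair law in \<open>auto simp: l_def intro: indep_vars_subset[OF ind]\<close>)
    thus ?thesis by (simp add: Jfin c_def)
  qed
  have indD: "indep_vars (\<lambda>_. borel) (\<lambda>s \<omega>. inv_root4 (D s \<omega>)) {..<B * 4}"
  proof -
    have "indep_vars (\<lambda>s. PiM (J s) (\<lambda>_. L)) (\<lambda>s \<omega>. restrict (\<lambda>i. x i \<omega>) (J s)) {..<B * 4}"
      by (rule indep_vars_restrict[OF ind]) (use Jsub Jdisj in auto)
    hence "indep_vars (\<lambda>_. borel) (\<lambda>s \<omega>. inv_root4 (min_sq_residual (J s)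
        (\<lambda>i. \<phi> (restrict (\<lambda>i. x i \<omega>) (J s) i)) (\<lambda>i. \<psi> (restrict (\<lambda>i. x i \<omega>) (J s) i)))) {..<B * 4}"
    proof (rule indep_vars_compose2[where Y="\<lambda>s v. inv_root4 (min_sq_residual (J s) (\<lambda>i. \<phi> (v i)) (\<lambda>i. \<psi> (v i)))"])
      fix s
      have "(\<lambda>v. min_sq_residual (J s) (\<lambda>i. \<phi> (v i)) (\<lambda>i. \<psi> (v i))) \<in> borel_measurable (PiM (J s) (\<lambda>_. L))"
        by (rule borel_measurable_min_sq_residual) measurable
      from measurable_compose[OF this measurable_inv_root4]
      show "(\<lambda>v. inv_root4 (min_sq_residual (J s) (\<lambda>i. \<phi> (v i)) (\<lambda>i. \<psi> (v i)))) \<in> borel_measurable (PiM (J s) (\<lambda>_. L))" .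
    qed
    thus ?thesis by (simp add: D_def min_sq_residual_def cong: sum.cong)
  qed
  \<comment> \<open>The sum of the residual sums of squares of the four samples of the \<open>b\<close>-th block.\<close>
  define T where "T b \<omega> = (\<Sum>t<(4::nat). D (b * 4 + t) \<omega>)" for b \<omega>
  have T0: "0 \<le> T b \<omega>" for b \<omega> unfolding T_def by (intro sum_nonneg D0)
  have Tm[measurable]: "T b \<in> borel_measurable M" if "b < B" for b
    unfolding T_def by (intro borel_measurable_sum Dm) (use that in auto)
  have ET: "(\<integral>\<^sup>+\<omega>. inverse (ennreal (T b \<omega>)) \<partial>M) \<le> ennreal (c ^ 4)" if b: "b < B" for b
  proof -
    have inj: "inj_on (\<lambda>t. b * 4 + t) {..<4}" by (auto simp: inj_on_def)
    let ?A = "(\<lambda>t. b * 4 + t) ` {..<4}"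
    have "(\<integral>\<^sup>+\<omega>. inverse (ennreal (T b \<omega>)) \<partial>M) \<le> (\<integral>\<^sup>+\<omega>. (\<Prod>t<(4::nat). inv_root4 (D (b * 4 + t) \<omega>)) \<partial>M)"
      unfolding T_def by (intro nn_integral_mono inverse_sum_le_prod_inv_root4 D0)
    also have "\<dots> = (\<integral>\<^sup>+\<omega>. (\<Prod>s\<in>?A. inv_root4 (D s \<omega>)) \<partial>M)"
      by (subst prod.reindex[OF inj]) simp
    also have "\<dots> = (\<Prod>s\<in>?A. \<integral>\<^sup>+\<omega>. inv_root4 (D s \<omega>) \<partial>M)"
      by (rule indep_vars_nn_integral[OF _ indep_vars_subset[OF indD]]) (use b in auto)
    also have "\<dots> \<le> (\<Prod>s\<in>?A. ennreal c)"
    proof -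
      have pm: "finite A \<Longrightarrow> (\<And>s. s \<in> A \<Longrightarrow> f s \<le> ennreal c) \<Longrightarrow> (\<Prod>s\<in>A. f s) \<le> (\<Prod>s\<in>A. ennreal c)" for A :: "nat set" and f
        by (induction A rule: finite_induct) (auto intro: mult_mono)
      show ?thesis by (rule pm) (use b ED in auto)
    qed
    also have "\<dots> = ennreal (c ^ 4)"
      by (simp add: card_image[OF inj] ennreal_power c)
    finally show ?thesis .
  qed
  have "(\<integral>\<^sup>+\<omega>. inverse (ennreal (min_sq_residual {..<n} (\<lambda>i. \<phi> (x i \<omega>)) (\<lambda>i. \<psi> (x i \<omega>)))) \<partial>M)
     \<le> (\<integral>\<^sup>+\<omega>. ennreal (1 / (real B)\<^sup>2) * (\<Sum>b<B. inverse (ennreal (T b \<omega>))) \<partial>M)"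
  proof (rule nn_integral_mono)
    fix \<omega>
    have "(\<Sum>b<B. T b \<omega>) = (\<Sum>s<B * 4. D s \<omega>)"
    proof -
      have "(\<Sum>t<4. D (b * 4 + t) \<omega>) = (\<Sum>s=b * 4..<b * 4 + 4. D s \<omega>)" for b
        by (subst sum.atLeastLessThan_shift_0) (simp add: lessThan_atLeast0)
      thus ?thesis using sum.nat_group[of "\<lambda>s. D s \<omega>" 4 B] by (simp only: T_def)
    qed
    also have "\<dots> \<le> min_sq_residual {..<n} (\<lambda>i. \<phi> (x i \<omega>)) (\<lambda>i. \<psi> (x i \<omega>))"
      unfolding D_def by (rule sum_min_sq_residual_le) (use Jsub Jdisj in auto)
    finally have "inverse (ennreal (min_sq_residual {..<n} (\<lambda>i. \<phi> (x i \<omega>)) (\<lambda>i. \<psi> (x i \<omega>)))) \<le> inverse (ennreal (\<Sum>b<B. T b \<omega>))"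
      by (intro ennreal_inverse_antimono ennreal_leI)
    also have "\<dots> \<le> ennreal (1 / (real B)\<^sup>2) * (\<Sum>b<B. inverse (ennreal (T b \<omega>)))"
      by (rule inverse_sum_le_sum_inverse) (use T0 B in auto)
    finally show "inverse (ennreal (min_sq_residual {..<n} (\<lambda>i. \<phi> (x i \<omega>)) (\<lambda>i. \<psi> (x i \<omega>))))
      \<le> ennreal (1 / (real B)\<^sup>2) * (\<Sum>b<B. inverse (ennreal (T b \<omega>)))" .
  qed
  also have "\<dots> = ennreal (1 / (real B)\<^sup>2) * (\<Sum>b<B. \<integral>\<^sup>+\<omega>. inverse (ennreal (T b \<omega>)) \<partial>M)"
    by (subst nn_integral_cmult, simp, subst nn_integral_sum) auto
  also have "\<dots> \<le> ennreal (1 / (real B)\<^sup>2) * (\<Sum>b<B. ennreal (c ^ 4))"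
    by (intro mult_left_mono sum_mono ET) auto
  also have "\<dots> = ennreal (1 / (real B)\<^sup>2 * (real B * c ^ 4))"
    using c by (subst ennreal_mult) (auto simp: sum_ennreal ennreal_of_nat_eq_real_of_nat ennreal_mult)
  also have "\<dots> \<le> ennreal (8 * real l * c ^ 4 / real n)"
  proof (rule ennreal_leI)
    have n0: "0 < real n" using n by simp
    have "1 / (real B)\<^sup>2 * (real B * c ^ 4) = c ^ 4 * (1 / real B)" using B by (simp add: power2_eq_square)
    also have "\<dots> \<le> c ^ 4 * (8 * real l / real n)"
      using nB n0 B c by (intro mult_left_mono) (auto simp: field_simps)
    finally show "1 / (real B)\<^sup>2 * (real B * c ^ 4) \<le> 8 * real l * c ^ 4 / real n" by (simp add: field_simps)
  qed
  finally show ?thesis by (simp only: l_def c_def)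
qed

section \<open>Algebra of least squares\<close>

text \<open>The matrix of the quadratic form \<open>b \<mapsto> (\<Sum>i<n. (w i \<bullet> b)\<^sup>2) + q * (b $ j)\<^sup>2\<close>. The penalty \<open>q\<close> on the \<open>j\<close>-th coefficient
  is \<open>0\<close> in an ordinary regression. A regression without the \<open>j\<close>-th covariate is encoded by rows
  with \<open>w i $ j = 0\<close> together with \<open>q = 1\<close>, which keeps the matrix positive definite.\<close>

definition gram :: "real \<Rightarrow> 'n \<Rightarrow> nat \<Rightarrow> (nat \<Rightarrow> real ^ 'n) \<Rightarrow> real ^ 'n ^ 'n" where
  "gram q j n w = (\<chi> r c. (\<Sum>i<n. w i $ r * w i $ c) + (if r = j \<and> c = j then q else 0))"

text \<open>The \<open>k\<close>-th column of the inverse of \<open>G\<close>, written with Cramer's rule so that it depends measurably on \<open>G\<close>.\<close>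

definition inv_col :: "real ^ 'n ^ 'n \<Rightarrow> 'n \<Rightarrow> real ^ 'n" where
  "inv_col G k = (\<chi> l. det (\<chi> r c. if c = l then axis k 1 $ r else G $ r $ c) / det G)"

text \<open>The \<open>k\<close>-th least-squares coefficient of the responses \<open>e\<close> on the rows \<open>w\<close>. With the noise as responses this is
  the estimation error of the coefficient.\<close>

definition ols_error :: "real \<Rightarrow> 'n \<Rightarrow> nat \<Rightarrow> (nat \<Rightarrow> real ^ 'n) \<Rightarrow> (nat \<Rightarrow> real) \<Rightarrow> 'n \<Rightarrow> real" where
  "ols_error q j n w e k = (\<Sum>i<n. (inv_col (gram q j n w) k \<bullet> w i) * e i)"

lemma gram_mult_vec: "gram q j n w *v b = (\<Sum>i<n. (w i \<bullet> b) *\<^sub>R w i) + (q * b $ j) *\<^sub>R axis j 1"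
proof (rule vec_eq_iff[THEN iffD2], rule allI)
  fix r
  have "(gram q j n w *v b) $ r = (\<Sum>c\<in>UNIV. (\<Sum>i<n. w i $ r * w i $ c * b $ c) + (if r = j \<and> c = j then q * b $ j else 0))"
    by (auto simp: gram_def matrix_vector_mult_def distrib_right sum_distrib_right intro!: sum.cong)
  also have "\<dots> = (\<Sum>c\<in>UNIV. \<Sum>i<n. w i $ r * w i $ c * b $ c) + (\<Sum>c\<in>UNIV. if r = j \<and> c = j then q * b $ j else 0)"
    by (rule sum.distrib)
  also have "(\<Sum>c\<in>UNIV. \<Sum>i<n. w i $ r * w i $ c * b $ c) = (\<Sum>i<n. (w i \<bullet> b) * w i $ r)"
    by (subst sum.swap) (simp add: inner_vec_def sum_distrib_left sum_distrib_right mult_ac)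
  also have "(\<Sum>c\<in>UNIV. if r = j \<and> c = j then q * b $ j else 0) = (q * b $ j) * axis j 1 $ r"
    by (cases "r = j") (auto simp: axis_def)
  finally show "(gram q j n w *v b) $ r = ((\<Sum>i<n. (w i \<bullet> b) *\<^sub>R w i) + (q * b $ j) *\<^sub>R axis j 1) $ r"
    by (simp add: sum_component)
qed

lemma inner_gram_mult: "c \<bullet> (gram q j n w *v b) = (\<Sum>i<n. (w i \<bullet> c) * (w i \<bullet> b)) + q * c $ j * b $ j"
  by (simp add: gram_mult_vec inner_add_right inner_sum_right inner_axis inner_commute mult_ac)

lemma det_neq_0_if_pos_def:
  fixes G :: "real ^ 'n ^ 'n"
  assumes "\<And>b. b \<noteq> 0 \<Longrightarrow> 0 < b \<bullet> (G *v b)"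
  shows "det G \<noteq> 0"
proof -
  have "b = 0" if "G *v b = 0" for b using assms[of b] that by force
  hence "\<exists>B. B ** G = mat 1" by (simp add: matrix_left_invertible_ker)
  thus ?thesis by (simp add: invertible_left_inverse[symmetric] invertible_det_nz)
qed

lemma mult_inv_col:
  fixes G :: "real ^ 'n ^ 'n"
  assumes "det G \<noteq> 0"
  shows "G *v inv_col G k = axis k 1"
  using cramer[OF assms, of "inv_col G k" "axis k 1"] by (simp add: inv_col_def)

lemma least_squares_normal_equation:
  fixes w :: "nat \<Rightarrow> real ^ 'n"
  assumes min: "\<And>c. (\<Sum>i<n. (e i - w i \<bullet> b)\<^sup>2) + q * (b $ j)\<^sup>2 \<le> (\<Sum>i<n. (e i - w i \<bullet> c)\<^sup>2) + q * (c $ j)\<^sup>2"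
  shows "gram q j n w *v b = (\<Sum>i<n. e i *\<^sub>R w i)"
proof -
  have "v \<bullet> (gram q j n w *v b - (\<Sum>i<n. e i *\<^sub>R w i)) = 0" for v
  proof -
    define A where "A = v \<bullet> (gram q j n w *v v)"
    define S where "S = v \<bullet> (gram q j n w *v b - (\<Sum>i<n. e i *\<^sub>R w i))"
    have exp: "(\<Sum>i<n. (e i - w i \<bullet> (b + t *\<^sub>R v))\<^sup>2) + q * ((b + t *\<^sub>R v) $ j)\<^sup>2
      = (\<Sum>i<n. (e i - w i \<bullet> b)\<^sup>2) + q * (b $ j)\<^sup>2 + 2 * t * S + t\<^sup>2 * A" for t
    proof -
      have 1: "(e i - w i \<bullet> (b + t *\<^sub>R v))\<^sup>2 = (e i - w i \<bullet> b)\<^sup>2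
          + (2 * t * ((w i \<bullet> v) * (w i \<bullet> b) - e i * (w i \<bullet> v)) + t\<^sup>2 * ((w i \<bullet> v) * (w i \<bullet> v)))" for i
        by (simp add: inner_add_right power2_eq_square algebra_simps)
      have "(\<Sum>i<n. (e i - w i \<bullet> (b + t *\<^sub>R v))\<^sup>2) = (\<Sum>i<n. (e i - w i \<bullet> b)\<^sup>2)
          + (2 * t * ((\<Sum>i<n. (w i \<bullet> v) * (w i \<bullet> b)) - (\<Sum>i<n. e i * (w i \<bullet> v))) + t\<^sup>2 * (\<Sum>i<n. (w i \<bullet> v) * (w i \<bullet> v)))"
        unfolding 1 by (simp only: sum.distrib sum_subtractf sum_distrib_left[symmetric])
      thus ?thesis
        by (simp add: A_def S_def inner_gram_mult inner_diff_right inner_sum_right inner_commute[of v] power2_eq_square algebra_simps)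
    qed
    have ineq: "0 \<le> 2 * t * S + t\<^sup>2 * A" for t using min[of "b + t *\<^sub>R v"] unfolding exp by linarith
    show ?thesis
    proof (rule ccontr)
      assume "v \<bullet> (gram q j n w *v b - (\<Sum>i<n. e i *\<^sub>R w i)) \<noteq> 0"
      hence S: "S \<noteq> 0" by (simp add: S_def)
      \<comment> \<open>A step of length \<open>S / m\<close> against the slope \<open>S\<close> would decrease the criterion.\<close>
      define m where "m = \<bar>A\<bar> + 1"
      have m: "0 < m" "A < m * 2" by (auto simp: m_def)
      have "2 * (- S / m) * S + (- S / m)\<^sup>2 * A = (S\<^sup>2 / m\<^sup>2) * (A - 2 * m)"
        using m by (simp add: field_simps power2_eq_square)
      also have "\<dots> < 0" using S m by (intro mult_pos_neg) auto
      finally show False using ineq[of "- S / m"] by linarith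
    qed
  qed
  hence "gram q j n w *v b - (\<Sum>i<n. e i *\<^sub>R w i) = 0" by (metis inner_eq_zero_iff)
  thus ?thesis by simp
qed

lemma least_squares_coefficient_eq_ols_error:
  fixes w :: "nat \<Rightarrow> real ^ 'n"
  assumes pd: "\<And>c. c \<noteq> 0 \<Longrightarrow> 0 < c \<bullet> (gram q j n w *v c)"
    and min: "\<And>c. (\<Sum>i<n. (e i - w i \<bullet> b)\<^sup>2) + q * (b $ j)\<^sup>2 \<le> (\<Sum>i<n. (e i - w i \<bullet> c)\<^sup>2) + q * (c $ j)\<^sup>2"
  shows "b $ k = ols_error q j n w e k"
proof -
  let ?G = "gram q j n w" and ?h = "inv_col (gram q j n w) k"
  have h: "?G *v ?h = axis k 1" by (rule mult_inv_col[OF det_neq_0_if_pos_def[OF pd]])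
  have "b $ k = b \<bullet> (?G *v ?h)" by (simp add: h inner_axis)
  also have "\<dots> = ?h \<bullet> (?G *v b)" by (simp add: inner_gram_mult mult_ac)
  also have "\<dots> = ols_error q j n w e k"
    unfolding least_squares_normal_equation[OF min] by (simp add: inner_sum_right ols_error_def mult_ac)
  finally show ?thesis .
qed

text \<open>The sum on the left is the conditional variance of the \<open>k\<close>-th coefficient for unit noise, and the largest
  possible \<open>m\<close> is the squared distance of the \<open>k\<close>-th column from the span of the others. With \<open>h\<close> the \<open>k\<close>-th
  column of the inverse, the vector \<open>h / h\<^sub>k\<close> has \<open>k\<close>-th entry \<open>1\<close> and the value \<open>1 / h\<^sub>k\<close> under the quadratic form.\<close>

lemma sum_sq_inv_col_le:
  fixes w :: "nat \<Rightarrow> real ^ 'n"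
  assumes pd: "\<And>c. c \<noteq> 0 \<Longrightarrow> 0 < c \<bullet> (gram q j n w *v c)" and q: "0 \<le> q" and m: "0 < m"
    and le: "\<And>c. c $ k = 1 \<Longrightarrow> m \<le> (\<Sum>i<n. (w i \<bullet> c)\<^sup>2)"
  shows "(\<Sum>i<n. (inv_col (gram q j n w) k \<bullet> w i)\<^sup>2) \<le> 1 / m"
proof -
  let ?G = "gram q j n w" and ?h = "inv_col (gram q j n w) k"
  have h: "?G *v ?h = axis k 1" by (rule mult_inv_col[OF det_neq_0_if_pos_def[OF pd]])
  hence "?h \<noteq> 0" by (metis axis_eq_0_iff matrix_vector_mult_0_right zero_neq_one)
  have hk: "?h \<bullet> (?G *v ?h) = ?h $ k" by (simp add: h inner_axis)
  hence pos: "0 < ?h $ k" using pd[OF \<open>?h \<noteq> 0\<close>] by simp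
  define s where "s = (\<Sum>i<n. (w i \<bullet> ?h)\<^sup>2)"
  have "?h $ k = s + q * (?h $ j)\<^sup>2"
    using hk by (simp add: inner_gram_mult s_def power2_eq_square mult_ac)
  hence s: "s \<le> ?h $ k" using q by simp
  have "m \<le> (\<Sum>i<n. (w i \<bullet> ((1 / ?h $ k) *\<^sub>R ?h))\<^sup>2)" by (rule le) (use pos in simp)
  also have "\<dots> = s / (?h $ k)\<^sup>2" by (simp add: s_def power_divide sum_divide_distrib)
  also have "\<dots> \<le> ?h $ k / (?h $ k)\<^sup>2" by (rule divide_right_mono[OF s]) simp
  also have "\<dots> = 1 / ?h $ k" by (simp add: power2_eq_square)
  finally have "?h $ k \<le> 1 / m" using pos m by (simp add: field_simps)
  with s show ?thesis by (simp add: s_def inner_commute)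
qed

lemma borel_measurable_det [measurable (raw)]:
  fixes A :: "'a \<Rightarrow> 'n::finite \<Rightarrow> 'n \<Rightarrow> real"
  assumes "\<And>r c. (\<lambda>x. A x r c) \<in> borel_measurable M"
  shows "(\<lambda>x. det (\<chi> r c. A x r c)) \<in> borel_measurable M"
  unfolding det_def by (simp, intro borel_measurable_sum borel_measurable_times borel_measurable_const borel_measurable_prod assms)

lemma borel_measurable_inv_col_gram [measurable]:
  fixes w :: "nat \<Rightarrow> 'a \<Rightarrow> real ^ 'n"
  assumes w: "\<And>i. i < n \<Longrightarrow> w i \<in> borel_measurable M"
  shows "(\<lambda>x. inv_col (gram q j n (\<lambda>i. w i x)) k) \<in> borel_measurable M"
proof -
  have g: "(\<lambda>x. gram q j n (\<lambda>i. w i x) $ r $ c) \<in> borel_measurable M" for r c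
    unfolding gram_def using w by (auto intro!: borel_measurable_add borel_measurable_sum borel_measurable_times borel_measurable_vec_nth)
  have "(\<lambda>x. det (\<chi> r c. if c = l then axis k 1 $ r else gram q j n (\<lambda>i. w i x) $ r $ c)) \<in> borel_measurable M" for l
  proof (rule borel_measurable_det)
    fix r c show "(\<lambda>x. if c = l then axis k 1 $ r else gram q j n (\<lambda>i. w i x) $ r $ c) \<in> borel_measurable M"
      by (cases "c = l") (use g in auto)
  qed
  moreover have "(\<lambda>x. det (\<chi> r c. gram q j n (\<lambda>i. w i x) $ r $ c)) \<in> borel_measurable M"
    by (rule borel_measurable_det) (rule g)
  ultimately show ?thesis
    unfolding inv_col_def by (intro borel_measurable_vec_lambda borel_measurable_divide) simp_all
qed

lemma borel_measurable_ols_error [measurable (raw)]: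
  fixes w :: "nat \<Rightarrow> 'a \<Rightarrow> real ^ 'n"
  assumes "\<And>i. i < n \<Longrightarrow> w i \<in> borel_measurable M" "\<And>i. i < n \<Longrightarrow> e i \<in> borel_measurable M"
  shows "(\<lambda>x. ols_error q j n (\<lambda>i. w i x) (\<lambda>i. e i x) k) \<in> borel_measurable M"
  unfolding ols_error_def
  by (intro borel_measurable_sum borel_measurable_times borel_measurable_inner borel_measurable_inv_col_gram assms) auto

section \<open>Moments of the least-squares error\<close>

lemma gram_cong: "(\<And>i. i < n \<Longrightarrow> w i = w' i) \<Longrightarrow> gram q j n w = gram q j n w'"
  by (simp add: gram_def)

text \<open>Conditionally on the rows the error is a linear combination of the noise whose coefficients \<open>\<alpha>\<close> have
  sum of squares at most \<open>1 / m\<close>.\<close>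

lemma (in prob_space) ols_error_moments:
  fixes w :: "nat \<Rightarrow> 'a \<Rightarrow> real ^ 'n" and e :: "nat \<Rightarrow> 'a \<Rightarrow> real"
  assumes ind: "indep_pair M (PiM {..<n} (\<lambda>_. borel)) (\<lambda>\<omega>. \<lambda>i\<in>{..<n}. w i \<omega>)
                  (PiM {..<n} (\<lambda>_. borel)) (\<lambda>\<omega>. \<lambda>i\<in>{..<n}. e i \<omega>)"
    and w[measurable]: "\<And>i. i < n \<Longrightarrow> w i \<in> borel_measurable M"
    and e1: "\<And>i. i < n \<Longrightarrow> integrable M (e i)" "\<And>i. i < n \<Longrightarrow> (\<integral>\<omega>. e i \<omega> \<partial>M) = 0"
    and e2: "\<And>i l. i < n \<Longrightarrow> l < n \<Longrightarrow> integrable M (\<lambda>\<omega>. e i \<omega> * e l \<omega>)"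
      "\<And>i l. i < n \<Longrightarrow> l < n \<Longrightarrow> (\<integral>\<omega>. e i \<omega> * e l \<omega> \<partial>M) = (if i = l then s\<^sup>2 else 0)"
    and pd: "AE \<omega> in M. \<forall>c. c \<noteq> 0 \<longrightarrow> 0 < c \<bullet> (gram q j n (\<lambda>i. w i \<omega>) *v c)" and q: "0 \<le> q"
    and m[measurable]: "m \<in> borel_measurable M" "AE \<omega> in M. 0 < m \<omega>"
    and le: "AE \<omega> in M. \<forall>c. c $ k = 1 \<longrightarrow> m \<omega> \<le> (\<Sum>i<n. (w i \<omega> \<bullet> c)\<^sup>2)"
    and Em: "(\<integral>\<^sup>+\<omega>. inverse (ennreal (m \<omega>)) \<partial>M) \<le> ennreal C" and C: "0 \<le> C"
  defines "\<delta> \<equiv> \<lambda>\<omega>. ols_error q j n (\<lambda>i. w i \<omega>) (\<lambda>i. e i \<omega>) k"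
  shows "integrable M \<delta>" "(\<integral>\<omega>. \<delta> \<omega> \<partial>M) = 0" "integrable M (\<lambda>\<omega>. (\<delta> \<omega>)\<^sup>2)" "(\<integral>\<omega>. (\<delta> \<omega>)\<^sup>2 \<partial>M) \<le> s\<^sup>2 * C"
proof -
  let ?P = "PiM {..<n} (\<lambda>_. borel :: (real ^ 'n) measure)" and ?Q = "PiM {..<n} (\<lambda>_. borel :: real measure)"
  have e[measurable]: "e i \<in> borel_measurable M" if "i < n" for i using e1(1)[OF that] by simp
  define \<alpha> where "\<alpha> i \<omega> = inv_col (gram q j n (\<lambda>i. w i \<omega>)) k \<bullet> w i \<omega>" for i \<omega>
  define \<alpha>' where "\<alpha>' i v = inv_col (gram q j n v) k \<bullet> v i" for i and v :: "nat \<Rightarrow> real ^ 'n"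
  have \<alpha>': "\<alpha>' i \<in> borel_measurable ?P" if "i < n" for i
    unfolding \<alpha>'_def using that by (intro borel_measurable_inner borel_measurable_inv_col_gram) auto
  have \<alpha>eq: "\<alpha>' i (\<lambda>i\<in>{..<n}. w i \<omega>) = \<alpha> i \<omega>" if "i < n" for i \<omega>
    using that gram_cong[of n "\<lambda>i\<in>{..<n}. w i \<omega>" "\<lambda>i. w i \<omega>" q j] by (simp add: \<alpha>_def \<alpha>'_def)
  have \<alpha>[measurable]: "\<alpha> i \<in> borel_measurable M" if "i < n" for i
    unfolding \<alpha>_def using that by (intro borel_measurable_inner borel_measurable_inv_col_gram w) auto
  have sum: "AE \<omega> in M. (\<Sum>i<n. (\<alpha> i \<omega>)\<^sup>2) \<le> 1 / m \<omega>"
    using pd m(2) le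
    by eventually_elim (auto simp: \<alpha>_def intro!: sum_sq_inv_col_le q)
  have "(\<integral>\<^sup>+\<omega>. ennreal (1 / m \<omega>) \<partial>M) = (\<integral>\<^sup>+\<omega>. inverse (ennreal (m \<omega>)) \<partial>M)"
    by (rule nn_integral_cong_AE) (use m(2) in eventually_elim, auto simp: inverse_ennreal inverse_eq_divide)
  hence Em': "(\<integral>\<^sup>+\<omega>. ennreal (1 / m \<omega>) \<partial>M) \<le> ennreal C" using Em by simp
  have m0: "AE \<omega> in M. 0 \<le> 1 / m \<omega>" using m(2) by eventually_elim auto
  have im: "integrable M (\<lambda>\<omega>. 1 / m \<omega>)"
    by (rule integrableI_nonneg) (use m0 Em' in \<open>auto intro: le_less_trans\<close>)
  have imC: "(\<integral>\<omega>. 1 / m \<omega> \<partial>M) \<le> C"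
    using Em' C m0 im by (subst (asm) nn_integral_eq_integral) auto
  have \<alpha>2: "integrable M (\<lambda>\<omega>. (\<alpha> i \<omega>)\<^sup>2)" if "i < n" for i
  proof (rule Bochner_Integration.integrable_bound[OF im])
    show "AE \<omega> in M. norm ((\<alpha> i \<omega>)\<^sup>2) \<le> norm (1 / m \<omega>)"
      using sum
    proof eventually_elim
      case (elim \<omega>)
      have "(\<alpha> i \<omega>)\<^sup>2 \<le> (\<Sum>i<n. (\<alpha> i \<omega>)\<^sup>2)" by (rule member_le_sum) (use that in auto)
      thus ?case using elim abs_ge_self[of "1 / m \<omega>"] by (simp only: real_norm_def abs_power2)
    qed
  qed (use that in measurable)
  have \<alpha>1: "integrable M (\<alpha> i)" if "i < n" for i
    by (rule square_integrable_imp_integrable) (use \<alpha> \<alpha>2 that in auto)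
  have \<alpha>\<alpha>: "integrable M (\<lambda>\<omega>. \<alpha> i \<omega> * \<alpha> l \<omega>)" if "i < n" "l < n" for i l
    by (rule integrable_mult_of_sq) (use \<alpha> \<alpha>2 that in auto)
  have \<delta>: "\<delta> \<omega> = (\<Sum>i<n. \<alpha> i \<omega> * e i \<omega>)" for \<omega> by (simp add: \<delta>_def ols_error_def \<alpha>_def)
  have i1: "integrable M (\<lambda>\<omega>. \<alpha> i \<omega> * e i \<omega>)" "(\<integral>\<omega>. \<alpha> i \<omega> * e i \<omega> \<partial>M) = 0" if i: "i < n" for i
  proof -
    have "(\<lambda>v. v i) \<in> borel_measurable ?Q" by (rule measurable_component_singleton) (use i in simp)
    from indep_pair_compose[OF ind \<alpha>'[OF i] this]
    have "indep_pair M borel (\<alpha> i) borel (e i)" using i by (simp add: \<alpha>eq)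
    from indep_pair_integral[OF this \<alpha>1[OF i] e1(1)[OF i]]
    show "integrable M (\<lambda>\<omega>. \<alpha> i \<omega> * e i \<omega>)" "(\<integral>\<omega>. \<alpha> i \<omega> * e i \<omega> \<partial>M) = 0" using e1(2)[OF i] by auto
  qed
  show "integrable M \<delta>" "(\<integral>\<omega>. \<delta> \<omega> \<partial>M) = 0"
    unfolding \<delta> using i1 by (auto intro!: Bochner_Integration.integrable_sum)
  have i2: "integrable M (\<lambda>\<omega>. (\<alpha> i \<omega> * \<alpha> l \<omega>) * (e i \<omega> * e l \<omega>))"
    "(\<integral>\<omega>. (\<alpha> i \<omega> * \<alpha> l \<omega>) * (e i \<omega> * e l \<omega>) \<partial>M) = (if i = l then s\<^sup>2 * (\<integral>\<omega>. (\<alpha> i \<omega>)\<^sup>2 \<partial>M) else 0)"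
    if i: "i < n" "l < n" for i l
  proof -
    have 1: "(\<lambda>v. v i * v l) \<in> borel_measurable ?Q"
      by (intro borel_measurable_times measurable_component_singleton) (use i in auto)
    have 2: "(\<lambda>v. \<alpha>' i v * \<alpha>' l v) \<in> borel_measurable ?P" by (intro borel_measurable_times \<alpha>' i)
    from indep_pair_compose[OF ind 2 1]
    have "indep_pair M borel (\<lambda>\<omega>. \<alpha> i \<omega> * \<alpha> l \<omega>) borel (\<lambda>\<omega>. e i \<omega> * e l \<omega>)" using i by (simp add: \<alpha>eq)
    from indep_pair_integral[OF this \<alpha>\<alpha>[OF i] e2(1)[OF i]] e2(2)[OF i]
    show "integrable M (\<lambda>\<omega>. (\<alpha> i \<omega> * \<alpha> l \<omega>) * (e i \<omega> * e l \<omega>))"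
      "(\<integral>\<omega>. (\<alpha> i \<omega> * \<alpha> l \<omega>) * (e i \<omega> * e l \<omega>) \<partial>M) = (if i = l then s\<^sup>2 * (\<integral>\<omega>. (\<alpha> i \<omega>)\<^sup>2 \<partial>M) else 0)"
      by (auto simp: power2_eq_square)
  qed
  have \<delta>2: "(\<delta> \<omega>)\<^sup>2 = (\<Sum>i<n. \<Sum>l<n. (\<alpha> i \<omega> * \<alpha> l \<omega>) * (e i \<omega> * e l \<omega>))" for \<omega>
    unfolding \<delta> power2_eq_square sum_product by (intro sum.cong refl) (simp add: mult_ac)
  show "integrable M (\<lambda>\<omega>. (\<delta> \<omega>)\<^sup>2)"
    unfolding \<delta>2 using i2 by (auto intro!: Bochner_Integration.integrable_sum)
  have "(\<integral>\<omega>. (\<delta> \<omega>)\<^sup>2 \<partial>M) = (\<Sum>i<n. \<Sum>l<n. (\<integral>\<omega>. (\<alpha> i \<omega> * \<alpha> l \<omega>) * (e i \<omega> * e l \<omega>) \<partial>M))"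
    unfolding \<delta>2 using i2(1) by (subst Bochner_Integration.integral_sum) (auto intro!: Bochner_Integration.integrable_sum sum.cong Bochner_Integration.integral_sum)
  also have "\<dots> = (\<Sum>i<n. s\<^sup>2 * (\<integral>\<omega>. (\<alpha> i \<omega>)\<^sup>2 \<partial>M))"
    by (intro sum.cong refl) (simp add: i2(2))
  also have "\<dots> = s\<^sup>2 * (\<integral>\<omega>. (\<Sum>i<n. (\<alpha> i \<omega>)\<^sup>2) \<partial>M)"
    using \<alpha>2 by (subst Bochner_Integration.integral_sum) (auto simp: sum_distrib_left)
  also have "\<dots> \<le> s\<^sup>2 * (\<integral>\<omega>. 1 / m \<omega> \<partial>M)"
    by (intro mult_left_mono integral_mono_AE) (use im sum \<alpha>2 in auto)
  also have "\<dots> \<le> s\<^sup>2 * C" by (intro mult_left_mono imC) simp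
  finally show "(\<integral>\<omega>. (\<delta> \<omega>)\<^sup>2 \<partial>M) \<le> s\<^sup>2 * C" .
qed

text \<open>The constant of the bound \<open>E(1 / \<rho>) \<le> C / n\<close> for the residual sum of squares \<open>\<rho>\<close> of \<open>n\<close> rows.\<close>

definition inverse_residual_bound :: "'n itself \<Rightarrow> real \<Rightarrow> real" where
  "inverse_residual_bound _ \<tau> = 8 * real (Suc CARD('n)) * residual_bound \<tau> (Suc CARD('n)) ^ 4"

lemma inverse_residual_bound_nonneg: "0 < \<tau> \<Longrightarrow> 0 \<le> inverse_residual_bound TYPE('n) \<tau>"
  by (simp add: inverse_residual_bound_def residual_bound_def)

text \<open>A regression whose rows are functions of independent vectors \<open>\<xi> (z i)\<close>. The set \<open>K\<close> contains the coefficients of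
  genuine coordinates: by assumption \<open>rep\<close>, every combination of the columns with coefficient \<open>1\<close> at \<open>k\<close>
  is the residual of the \<open>k\<close>-th coordinate plus a combination of covariates independent of it. The last
  assumption covers the position outside \<open>K\<close>, which holds the intercept or is unused.\<close>

lemma (in prob_space) ols_error_moments_sample:
  fixes z :: "nat \<Rightarrow> 'a \<Rightarrow> 'b" and \<xi> :: "'b \<Rightarrow> real ^ 'n" and err :: "'b \<Rightarrow> real" and row :: "real ^ 'n \<Rightarrow> real ^ 'n"
    and a \<tau> :: "'n \<Rightarrow> real" and g :: "'n \<Rightarrow> real ^ 'n"
  assumes n: "4 * Suc CARD('n) \<le> n"
    and ind: "indep_vars (\<lambda>_. L) z {..<n}"
    and [measurable]: "\<xi> \<in> borel_measurable L" "err \<in> borel_measurable L" "row \<in> borel_measurable borel"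
    and noise: "\<And>i. i < n \<Longrightarrow> indep_pair M borel (\<lambda>\<omega>. row (\<xi> (z i \<omega>))) borel (\<lambda>\<omega>. err (z i \<omega>))"
      "\<And>i. i < n \<Longrightarrow> distr M borel (\<lambda>\<omega>. err (z i \<omega>)) = normal_law 0 s"
    and reg: "\<And>k i. k \<in> K \<Longrightarrow> i < n \<Longrightarrow>
        indep_pair M borel (\<lambda>\<omega>. \<xi> (z i \<omega>) $ k - (a k + g k \<bullet> \<xi> (z i \<omega>))) borel (\<lambda>\<omega>. with_one k (\<xi> (z i \<omega>)))"
      "\<And>k i. k \<in> K \<Longrightarrow> i < n \<Longrightarrow> distr M borel (\<lambda>\<omega>. \<xi> (z i \<omega>) $ k - (a k + g k \<bullet> \<xi> (z i \<omega>))) = normal_law 0 (\<tau> k)"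
      "\<And>k. k \<in> K \<Longrightarrow> 0 < \<tau> k"
    and rep: "\<And>k c. k \<in> K \<Longrightarrow> c $ k = 1 \<Longrightarrow> \<exists>b. \<forall>x. row x \<bullet> c = (x $ k - (a k + g k \<bullet> x)) + b \<bullet> with_one k x"
    and q: "0 \<le> q"
    and deg: "\<And>c. c \<noteq> 0 \<Longrightarrow> (\<And>k. k \<in> K \<Longrightarrow> c $ k = 0) \<Longrightarrow> 0 < q * (c $ j)\<^sup>2 \<or> (\<forall>x. row x \<bullet> c \<noteq> 0)"
  defines "\<delta> \<equiv> \<lambda>k \<omega>. ols_error q j n (\<lambda>i. row (\<xi> (z i \<omega>))) (\<lambda>i. err (z i \<omega>)) k"
  shows "AE \<omega> in M. \<forall>c. c \<noteq> 0 \<longrightarrow> 0 < c \<bullet> (gram q j n (\<lambda>i. row (\<xi> (z i \<omega>))) *v c)"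
    and "k \<in> K \<Longrightarrow> integrable M (\<delta> k)"
    and "k \<in> K \<Longrightarrow> (\<integral>\<omega>. \<delta> k \<omega> \<partial>M) = 0"
    and "k \<in> K \<Longrightarrow> integrable M (\<lambda>\<omega>. (\<delta> k \<omega>)\<^sup>2)"
    and "k \<in> K \<Longrightarrow> (\<integral>\<omega>. (\<delta> k \<omega>)\<^sup>2 \<partial>M)
      \<le> s\<^sup>2 * (inverse_residual_bound TYPE('n) (\<tau> k) / real n)"
proof -
  define \<phi> where "\<phi> k x = x $ k - (a k + g k \<bullet> x)" for k x
  define m where "m k \<omega> = min_sq_residual {..<n} (\<lambda>i. \<phi> k (\<xi> (z i \<omega>))) (\<lambda>i. with_one k (\<xi> (z i \<omega>)))" for k \<omega>
  have n0: "0 < n" using n by simp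
  have [measurable]: "\<phi> k \<in> borel_measurable borel" for k unfolding \<phi>_def by measurable
  have z[measurable]: "z i \<in> measurable M L" if "i < n" for i using ind that by (auto simp: indep_vars_def)
  have m[measurable]: "m k \<in> borel_measurable M" for k
    unfolding m_def by (rule borel_measurable_min_sq_residual) auto
  have Em: "(\<integral>\<^sup>+\<omega>. inverse (ennreal (m k \<omega>)) \<partial>M) \<le> ennreal (inverse_residual_bound TYPE('n) (\<tau> k) / real n)" if k: "k \<in> K" for k
    unfolding m_def inverse_residual_bound_def
    by (rule nn_integral_inverse_min_sq_residual_le[OF reg(3)[OF k] n ind, where \<phi>="\<lambda>v. \<phi> k (\<xi> v)" and \<psi>="\<lambda>v. with_one k (\<xi> v)"])
       (use reg(1,2)[OF k] in \<open>auto simp: \<phi>_def\<close>)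
  have mpos: "AE \<omega> in M. 0 < m k \<omega>" if k: "k \<in> K" for k
  proof -
    have "(\<integral>\<^sup>+\<omega>. inverse (ennreal (m k \<omega>)) \<partial>M) \<noteq> \<infinity>"
      using Em[OF k] by (auto simp: top_unique)
    hence "AE \<omega> in M. inverse (ennreal (m k \<omega>)) \<noteq> \<infinity>" by (intro nn_integral_PInf_AE) auto
    thus ?thesis
    proof eventually_elim
      case (elim \<omega>)
      thus ?case using min_sq_residual_nonneg[of "{..<n}" "\<lambda>i. \<phi> k (\<xi> (z i \<omega>))" "\<lambda>i. with_one k (\<xi> (z i \<omega>))"]
        by (auto simp: m_def less_le)
    qed
  qed
  have mle: "m k \<omega> \<le> (\<Sum>i<n. (row (\<xi> (z i \<omega>)) \<bullet> c)\<^sup>2)" if k: "k \<in> K" and c: "c $ k = 1" for k c \<omega>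
  proof -
    obtain b where "row x \<bullet> c = \<phi> k x + b \<bullet> with_one k x" for x using rep[OF k c] by (auto simp: \<phi>_def)
    thus ?thesis unfolding m_def using min_sq_residual_le[of "{..<n}" _ _ b] by simp
  qed
  show pd: "AE \<omega> in M. \<forall>c. c \<noteq> 0 \<longrightarrow> 0 < c \<bullet> (gram q j n (\<lambda>i. row (\<xi> (z i \<omega>))) *v c)"
  proof -
    have "AE \<omega> in M. \<forall>k\<in>K. 0 < m k \<omega>"
      by (rule AE_finite_allI) (use mpos in auto)
    thus ?thesis
    proof eventually_elim
      case (elim \<omega>)
      show ?case
      proof (intro allI impI)
        fix c :: "real ^ 'n" assume c: "c \<noteq> 0"
        let ?w = "\<lambda>i. row (\<xi> (z i \<omega>))"
        have Q: "c \<bullet> (gram q j n ?w *v c) = (\<Sum>i<n. (?w i \<bullet> c)\<^sup>2) + q * (c $ j)\<^sup>2"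
          by (simp add: inner_gram_mult power2_eq_square)
        have S0: "0 \<le> (\<Sum>i<n. (?w i \<bullet> c)\<^sup>2)" "0 \<le> q * (c $ j)\<^sup>2" using q by (auto intro: sum_nonneg)
        show "0 < c \<bullet> (gram q j n ?w *v c)"
        proof (cases "\<exists>k\<in>K. c $ k \<noteq> 0")
          case True
          then obtain k where k: "k \<in> K" "c $ k \<noteq> 0" by blast
          have "0 < m k \<omega>" using elim k by blast
          also have "\<dots> \<le> (\<Sum>i<n. (?w i \<bullet> ((1 / c $ k) *\<^sub>R c))\<^sup>2)" by (rule mle[OF k(1)]) (use k in simp)
          also have "\<dots> = (\<Sum>i<n. (?w i \<bullet> c)\<^sup>2) / (c $ k)\<^sup>2" by (simp add: power_divide sum_divide_distrib)
          finally have "0 < (\<Sum>i<n. (?w i \<bullet> c)\<^sup>2)" using k by (simp add: zero_less_divide_iff)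
          thus ?thesis using S0 Q by linarith
        next
          case False
          hence "0 < q * (c $ j)\<^sup>2 \<or> (\<forall>x. row x \<bullet> c \<noteq> 0)" by (intro deg c) auto
          thus ?thesis
          proof
            assume "\<forall>x. row x \<bullet> c \<noteq> 0"
            hence "0 < (\<Sum>i<n. (?w i \<bullet> c)\<^sup>2)" using n0 by (intro sum_pos) auto
            thus ?thesis using S0 Q by linarith
          qed (use S0 Q in linarith)
        qed
      qed
    qed
  qed
  have indP: "indep_pair M (PiM {..<n} (\<lambda>_. borel)) (\<lambda>\<omega>. \<lambda>i\<in>{..<n}. row (\<xi> (z i \<omega>)))
                  (PiM {..<n} (\<lambda>_. borel)) (\<lambda>\<omega>. \<lambda>i\<in>{..<n}. err (z i \<omega>))"
    by (rule indep_pair_PiM[where L=L and \<phi>="\<lambda>v. row (\<xi> v)", OF _ _ ind]) (use n0 noise in auto)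
  have em: "(\<lambda>\<omega>. err (z i \<omega>)) \<in> borel_measurable M" if "i < n" for i using that by measurable
  note e = normal_law_moments[OF em noise(2)]
  have inde: "indep_vars (\<lambda>_. borel) (\<lambda>i \<omega>. err (z i \<omega>)) {..<n}"
    by (rule indep_vars_compose2[OF ind]) auto
  have e2: "integrable M (\<lambda>\<omega>. err (z i \<omega>) * err (z l \<omega>))"
      "(\<integral>\<omega>. err (z i \<omega>) * err (z l \<omega>) \<partial>M) = (if i = l then s\<^sup>2 else 0)" if il: "i < n" "l < n" for i l
  proof -
    show "integrable M (\<lambda>\<omega>. err (z i \<omega>) * err (z l \<omega>))"
      by (rule integrable_mult_of_sq) (use em e il in auto)
    show "(\<integral>\<omega>. err (z i \<omega>) * err (z l \<omega>) \<partial>M) = (if i = l then s\<^sup>2 else 0)"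
    proof (cases "i = l")
      case True thus ?thesis using e(4)[of i] il by (simp add: power2_eq_square)
    next
      case False
      have "(\<integral>\<omega>. (\<Prod>r\<in>{i, l}. err (z r \<omega>)) \<partial>M) = (\<Prod>r\<in>{i, l}. (\<integral>\<omega>. err (z r \<omega>) \<partial>M))"
        by (rule indep_vars_lebesgue_integral[OF _ indep_vars_subset[OF inde]]) (use il e in auto)
      thus ?thesis using False e(3) il by simp
    qed
  qed
  assume k: "k \<in> K"
  have C: "0 \<le> inverse_residual_bound TYPE('n) (\<tau> k) / real n"
    using inverse_residual_bound_nonneg[OF reg(3)[OF k], where ?'n='n] by simp
  have w: "(\<lambda>\<omega>. row (\<xi> (z i \<omega>))) \<in> borel_measurable M" if "i < n" for i using that by measurable
  note * = ols_error_moments[where w="\<lambda>i \<omega>. row (\<xi> (z i \<omega>))" and e="\<lambda>i \<omega>. err (z i \<omega>)" and m="m k" and k=k,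
      OF indP w e(1) e(3) e2 pd q m mpos[OF k] _ Em[OF k] C]
  show "integrable M (\<delta> k)"
    and "(\<integral>\<omega>. \<delta> k \<omega> \<partial>M) = 0"
    and "integrable M (\<lambda>\<omega>. (\<delta> k \<omega>)\<^sup>2)"
    and "(\<integral>\<omega>. (\<delta> k \<omega>)\<^sup>2 \<partial>M)
      \<le> s\<^sup>2 * (inverse_residual_bound TYPE('n) (\<tau> k) / real n)"
    unfolding \<delta>_def by (rule *; use mle[OF k] in auto)+
qed

section \<open>The expectation of one summand of the importance\<close>

lemma (in prob_space) indep_triple_integral:
  fixes W :: "sample \<Rightarrow> 'a \<Rightarrow> 'b" and U V T :: "'b \<Rightarrow> real"
  assumes W: "indep_vars N W UNIV"
    and [measurable]: "U \<in> borel_measurable (N Train_m)" "V \<in> borel_measurable (N Train_nu)" "T \<in> borel_measurable (N Test)"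
    and i: "integrable M (\<lambda>\<omega>. U (W Train_m \<omega>))" "integrable M (\<lambda>\<omega>. V (W Train_nu \<omega>))" "integrable M (\<lambda>\<omega>. T (W Test \<omega>))"
  shows "has_bochner_integral M (\<lambda>\<omega>. U (W Train_m \<omega>) * V (W Train_nu \<omega>) * T (W Test \<omega>))
     ((\<integral>\<omega>. U (W Train_m \<omega>) \<partial>M) * (\<integral>\<omega>. V (W Train_nu \<omega>) \<partial>M) * (\<integral>\<omega>. T (W Test \<omega>) \<partial>M))"
proof -
  define Y where "Y s = (case s of Train_m \<Rightarrow> U | Train_nu \<Rightarrow> V | Test \<Rightarrow> T)" for s
  have UN: "(UNIV :: sample set) = {Train_m, Train_nu, Test}" using sample.exhaust by blast
  have Y: "Y s \<in> borel_measurable (N s)" for s by (cases s) (auto simp: Y_def)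
  have ind: "indep_vars (\<lambda>_. borel) (\<lambda>s \<omega>. Y s (W s \<omega>)) UNIV"
    by (rule indep_vars_compose2[OF W Y])
  have iY: "integrable M (\<lambda>\<omega>. Y s (W s \<omega>))" for s using i by (cases s) (auto simp: Y_def)
  have fin: "finite (UNIV :: sample set)" by (simp add: UN)
  show ?thesis
    using indep_vars_integrable[OF fin ind iY] indep_vars_lebesgue_integral[OF fin ind iY]
    by (simp add: has_bochner_integral_iff UN Y_def mult.assoc)
qed

text \<open>Here \<open>u\<close> and \<open>d\<close> are the errors of the two regressions, \<open>v\<close> and \<open>v'\<close> the coordinates of the test point and of the
  observation that provides the residual, \<open>r\<close> and \<open>r'\<close> their population residuals, and \<open>e\<close> the noise.\<close>

lemma (in prob_space) expectation_cpi_term: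
  fixes W :: "sample \<Rightarrow> 'a \<Rightarrow> 'b" and u d v v' :: "'n::finite \<Rightarrow> 'b \<Rightarrow> real" and r r' e :: "'b \<Rightarrow> real"
  assumes W: "indep_vars N W UNIV"
    and um[measurable]: "\<And>k. u k \<in> borel_measurable (N Train_m)" and dm[measurable]: "\<And>k. d k \<in> borel_measurable (N Train_nu)"
    and vm[measurable]: "\<And>k. v k \<in> borel_measurable (N Test)" "\<And>k. v' k \<in> borel_measurable (N Test)"
      "r \<in> borel_measurable (N Test)" "r' \<in> borel_measurable (N Test)" "e \<in> borel_measurable (N Test)"
    and u2: "\<And>k. integrable M (\<lambda>\<omega>. (u k (W Train_m \<omega>))\<^sup>2)" and d2: "\<And>k. integrable M (\<lambda>\<omega>. (d k (W Train_nu \<omega>))\<^sup>2)"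
    and t2: "\<And>k. integrable M (\<lambda>\<omega>. (v k (W Test \<omega>))\<^sup>2)" "\<And>k. integrable M (\<lambda>\<omega>. (v' k (W Test \<omega>))\<^sup>2)"
      "integrable M (\<lambda>\<omega>. (r (W Test \<omega>))\<^sup>2)" "integrable M (\<lambda>\<omega>. (r' (W Test \<omega>))\<^sup>2)" "integrable M (\<lambda>\<omega>. (e (W Test \<omega>))\<^sup>2)"
    and u0: "(\<integral>\<omega>. u j (W Train_m \<omega>) \<partial>M) = 0" and d0: "\<And>k. (\<integral>\<omega>. d k (W Train_nu \<omega>) \<partial>M) = 0"
    and r2: "(\<integral>\<omega>. (r' (W Test \<omega>) - r (W Test \<omega>))\<^sup>2 \<partial>M) = 2 * t"
    and rv: "\<And>l. (\<integral>\<omega>. (r' (W Test \<omega>) - r (W Test \<omega>)) * v l (W Test \<omega>) \<partial>M) = (if l = j then - t else 0)"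
    and Au: "(\<integral>\<omega>. (u j (W Train_m \<omega>))\<^sup>2 \<partial>M) \<le> A" and Bd: "\<And>k. (\<integral>\<omega>. (d k (W Train_nu \<omega>))\<^sup>2 \<partial>M) \<le> B"
    and S: "\<And>k. (\<integral>\<omega>. (v' k (W Test \<omega>) - v k (W Test \<omega>))\<^sup>2 \<partial>M) \<le> S"
  defines "D \<equiv> \<lambda>\<omega>. (r' (W Test \<omega>) - r (W Test \<omega>)) - (\<Sum>k\<in>UNIV. d k (W Train_nu \<omega>) * (v' k (W Test \<omega>) - v k (W Test \<omega>)))"
  defines "term \<equiv> \<lambda>\<omega>. (u j (W Train_m \<omega>) * D \<omega>)\<^sup>2
      + 2 * (u j (W Train_m \<omega>) * D \<omega>) * ((\<Sum>l\<in>UNIV. u l (W Train_m \<omega>) * v l (W Test \<omega>)) - e (W Test \<omega>))"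
  shows "integrable M term" "\<bar>\<integral>\<omega>. term \<omega> \<partial>M\<bar> \<le> A * ((real CARD('n))\<^sup>2 * B * S)"
proof -
  have Wm[measurable]: "W s \<in> measurable M (N s)" for s using W by (auto simp: indep_vars_def)
  let ?Wm = "W Train_m" and ?Wn = "W Train_nu" and ?Wt = "W Test"
  define \<Delta> where "\<Delta> k w = v' k w - v k w" for k w
  define p where "p w = r' w - r w" for w
  have [measurable]: "\<Delta> k \<in> borel_measurable (N Test)" "p \<in> borel_measurable (N Test)" for k
    unfolding \<Delta>_def p_def by measurable
  have \<Delta>2: "integrable M (\<lambda>\<omega>. (\<Delta> k (?Wt \<omega>))\<^sup>2)" for k
    unfolding \<Delta>_def using integrable_sq_add[of "\<lambda>\<omega>. v' k (?Wt \<omega>)" M "\<lambda>\<omega>. - v k (?Wt \<omega>)"] t2(1,2) by simp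
  have p2: "integrable M (\<lambda>\<omega>. (p (?Wt \<omega>))\<^sup>2)"
    unfolding p_def using integrable_sq_add[of "\<lambda>\<omega>. r' (?Wt \<omega>)" M "\<lambda>\<omega>. - r (?Wt \<omega>)"] t2(3,4) by simp
  have iu: "integrable M (\<lambda>\<omega>. u k (?Wm \<omega>))" for k by (rule square_integrable_imp_integrable) (use u2 in auto)
  have id: "integrable M (\<lambda>\<omega>. d k (?Wn \<omega>))" for k by (rule square_integrable_imp_integrable) (use d2 in auto)
  have iuu: "integrable M (\<lambda>\<omega>. u k (?Wm \<omega>) * u l (?Wm \<omega>))" for k l by (rule integrable_mult_of_sq) (use u2 in auto)
  have idd: "integrable M (\<lambda>\<omega>. d k (?Wn \<omega>) * d l (?Wn \<omega>))" for k l by (rule integrable_mult_of_sq) (use d2 in auto)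
  have i\<Delta>\<Delta>: "integrable M (\<lambda>\<omega>. \<Delta> k (?Wt \<omega>) * \<Delta> l (?Wt \<omega>))" for k l by (rule integrable_mult_of_sq) (use \<Delta>2 in auto)
  have ip\<Delta>: "integrable M (\<lambda>\<omega>. p (?Wt \<omega>) * \<Delta> k (?Wt \<omega>))" for k by (rule integrable_mult_of_sq) (use \<Delta>2 p2 in auto)
  have ipv: "integrable M (\<lambda>\<omega>. p (?Wt \<omega>) * v k (?Wt \<omega>))" for k by (rule integrable_mult_of_sq) (use t2 p2 in auto)
  have i\<Delta>v: "integrable M (\<lambda>\<omega>. \<Delta> k (?Wt \<omega>) * v l (?Wt \<omega>))" for k l by (rule integrable_mult_of_sq) (use t2 \<Delta>2 in auto)
  have ipe: "integrable M (\<lambda>\<omega>. p (?Wt \<omega>) * e (?Wt \<omega>))" by (rule integrable_mult_of_sq) (use t2 p2 in auto)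
  have i\<Delta>e: "integrable M (\<lambda>\<omega>. \<Delta> k (?Wt \<omega>) * e (?Wt \<omega>))" for k by (rule integrable_mult_of_sq) (use t2 \<Delta>2 in auto)
  define Euu where "Euu k l = (\<integral>\<omega>. u k (?Wm \<omega>) * u l (?Wm \<omega>) \<partial>M)" for k l
  define Edd where "Edd k l = (\<integral>\<omega>. d k (?Wn \<omega>) * d l (?Wn \<omega>) \<partial>M)" for k l
  define E\<Delta>\<Delta> where "E\<Delta>\<Delta> k l = (\<integral>\<omega>. \<Delta> k (?Wt \<omega>) * \<Delta> l (?Wt \<omega>) \<partial>M)" for k l
  have muu: "(\<lambda>w. u k w * u l w) \<in> borel_measurable (N Train_m)" for k l by measurable
  have mdd: "(\<lambda>w. d k w * d l w) \<in> borel_measurable (N Train_nu)" for k l by measurable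
  have m1: "(\<lambda>w. 1) \<in> borel_measurable (N Train_nu)" by measurable
  have mp2: "(\<lambda>w. (p w)\<^sup>2) \<in> borel_measurable (N Test)" by measurable
  have mp\<Delta>: "(\<lambda>w. p w * \<Delta> k w) \<in> borel_measurable (N Test)" for k by measurable
  have mpv: "(\<lambda>w. p w * v k w) \<in> borel_measurable (N Test)" for k by measurable
  have m\<Delta>\<Delta>: "(\<lambda>w. \<Delta> k w * \<Delta> l w) \<in> borel_measurable (N Test)" for k l by measurable
  have m\<Delta>v: "(\<lambda>w. \<Delta> k w * v l w) \<in> borel_measurable (N Test)" for k l by measurable
  have mpe: "(\<lambda>w. p w * e w) \<in> borel_measurable (N Test)" by measurable
  have m\<Delta>e: "(\<lambda>w. \<Delta> k w * e w) \<in> borel_measurable (N Test)" for k by measurable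
  have i1: "integrable M (\<lambda>\<omega>. 1 :: real)" by simp
  have e1: "(\<integral>\<omega>. (1::real) \<partial>M) = 1" by (simp add: prob_space)
  have Ep: "(\<integral>\<omega>. (p (?Wt \<omega>))\<^sup>2 \<partial>M) = 2 * t" unfolding p_def by (rule r2)
  have Epv: "(\<integral>\<omega>. p (?Wt \<omega>) * v l (?Wt \<omega>) \<partial>M) = (if l = j then - t else 0)" for l unfolding p_def by (rule rv)
  note tri = indep_triple_integral[OF W]
  have h1: "has_bochner_integral M (\<lambda>\<omega>. (u j (?Wm \<omega>) * u j (?Wm \<omega>)) * 1 * (p (?Wt \<omega>))\<^sup>2) (Euu j j * (2 * t))"
    using tri[OF muu m1 mp2 iuu i1 p2, of j j] by (simp only: e1 Ep Euu_def mult_1_right)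
  have h2: "has_bochner_integral M (\<lambda>\<omega>. (u j (?Wm \<omega>) * u j (?Wm \<omega>)) * d k (?Wn \<omega>) * (p (?Wt \<omega>) * \<Delta> k (?Wt \<omega>))) 0" for k
    using tri[OF muu dm mp\<Delta> iuu id ip\<Delta>, of j j k k] by (simp only: d0 mult_zero_left mult_zero_right)
  have h3: "has_bochner_integral M (\<lambda>\<omega>. (u j (?Wm \<omega>) * u j (?Wm \<omega>)) * (d k (?Wn \<omega>) * d l (?Wn \<omega>)) * (\<Delta> k (?Wt \<omega>) * \<Delta> l (?Wt \<omega>)))
      (Euu j j * Edd k l * E\<Delta>\<Delta> k l)" for k l
    using tri[OF muu mdd m\<Delta>\<Delta> iuu idd i\<Delta>\<Delta>, of j j k l k l] by (simp only: Euu_def Edd_def E\<Delta>\<Delta>_def)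
  have h4: "has_bochner_integral M (\<lambda>\<omega>. (u j (?Wm \<omega>) * u l (?Wm \<omega>)) * 1 * (p (?Wt \<omega>) * v l (?Wt \<omega>))) (Euu j l * (if l = j then - t else 0))" for l
    using tri[OF muu m1 mpv iuu i1 ipv, of j l l] by (simp only: e1 Epv Euu_def mult_1_right)
  have h5: "has_bochner_integral M (\<lambda>\<omega>. (u j (?Wm \<omega>) * u l (?Wm \<omega>)) * d k (?Wn \<omega>) * (\<Delta> k (?Wt \<omega>) * v l (?Wt \<omega>))) 0" for k l
    using tri[OF muu dm m\<Delta>v iuu id i\<Delta>v, of j l k k l] by (simp only: d0 mult_zero_left mult_zero_right)
  have h6: "has_bochner_integral M (\<lambda>\<omega>. u j (?Wm \<omega>) * 1 * (p (?Wt \<omega>) * e (?Wt \<omega>))) 0"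
    using tri[OF um m1 mpe iu i1 ipe, of j] by (simp only: u0 mult_zero_left)
  have h7: "has_bochner_integral M (\<lambda>\<omega>. u j (?Wm \<omega>) * d k (?Wn \<omega>) * (\<Delta> k (?Wt \<omega>) * e (?Wt \<omega>))) 0" for k
    using tri[OF um dm m\<Delta>e iu id i\<Delta>e, of j k k] by (simp only: d0 mult_zero_left mult_zero_right)
  let ?I = "Euu j j * (2 * t) - (\<Sum>k\<in>(UNIV::'n set). 2 * 0) + (\<Sum>k\<in>UNIV. \<Sum>l\<in>UNIV. Euu j j * Edd k l * E\<Delta>\<Delta> k l)
     + (\<Sum>l\<in>UNIV. 2 * (Euu j l * (if l = j then - t else 0))) - (\<Sum>k\<in>(UNIV::'n set). \<Sum>l\<in>(UNIV::'n set). 2 * 0) - 2 * 0 + (\<Sum>k\<in>(UNIV::'n set). 2 * 0)"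
  let ?F = "\<lambda>\<omega>. (u j (?Wm \<omega>) * u j (?Wm \<omega>)) * 1 * (p (?Wt \<omega>))\<^sup>2
     - (\<Sum>k\<in>UNIV. 2 * ((u j (?Wm \<omega>) * u j (?Wm \<omega>)) * d k (?Wn \<omega>) * (p (?Wt \<omega>) * \<Delta> k (?Wt \<omega>))))
     + (\<Sum>k\<in>UNIV. \<Sum>l\<in>UNIV. (u j (?Wm \<omega>) * u j (?Wm \<omega>)) * (d k (?Wn \<omega>) * d l (?Wn \<omega>)) * (\<Delta> k (?Wt \<omega>) * \<Delta> l (?Wt \<omega>)))
     + (\<Sum>l\<in>UNIV. 2 * ((u j (?Wm \<omega>) * u l (?Wm \<omega>)) * 1 * (p (?Wt \<omega>) * v l (?Wt \<omega>))))
     - (\<Sum>k\<in>UNIV. \<Sum>l\<in>UNIV. 2 * ((u j (?Wm \<omega>) * u l (?Wm \<omega>)) * d k (?Wn \<omega>) * (\<Delta> k (?Wt \<omega>) * v l (?Wt \<omega>))))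
     - 2 * (u j (?Wm \<omega>) * 1 * (p (?Wt \<omega>) * e (?Wt \<omega>)))
     + (\<Sum>k\<in>UNIV. 2 * (u j (?Wm \<omega>) * d k (?Wn \<omega>) * (\<Delta> k (?Wt \<omega>) * e (?Wt \<omega>))))"
  have "has_bochner_integral M ?F ?I"
    by (intro has_bochner_integral_add has_bochner_integral_diff has_bochner_integral_sum
        has_bochner_integral_mult_right h1 h2 h3 h4 h5 h6 h7)
  moreover have "term = ?F"
  proof
    fix \<omega>
    define c where "c = u j (?Wm \<omega>)"
    define P where "P = p (?Wt \<omega>)"
    define E where "E = e (?Wt \<omega>)"
    define s1 where "s1 = (\<Sum>k\<in>UNIV. d k (?Wn \<omega>) * \<Delta> k (?Wt \<omega>))"
    define s2 where "s2 = (\<Sum>l\<in>UNIV. u l (?Wm \<omega>) * v l (?Wt \<omega>))"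
    have "term \<omega> = (c * (P - s1))\<^sup>2 + 2 * (c * (P - s1)) * (s2 - E)"
      by (simp add: term_def D_def c_def P_def E_def s1_def s2_def p_def \<Delta>_def)
    also have "\<dots> = c * c * P\<^sup>2 - 2 * c * c * P * s1 + c * c * (s1 * s1) + 2 * c * P * s2 - 2 * c * (s1 * s2) - 2 * c * P * E + 2 * c * E * s1"
      by (simp add: power2_eq_square algebra_simps)
    also have "\<dots> = ?F \<omega>"
    proof -
      have "(\<Sum>k\<in>UNIV. 2 * ((c * c) * d k (?Wn \<omega>) * (P * \<Delta> k (?Wt \<omega>)))) = 2 * c * c * P * s1"
        by (simp add: s1_def sum_distrib_left mult_ac)
      moreover have "(\<Sum>k\<in>UNIV. \<Sum>l\<in>UNIV. (c * c) * (d k (?Wn \<omega>) * d l (?Wn \<omega>)) * (\<Delta> k (?Wt \<omega>) * \<Delta> l (?Wt \<omega>)))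
          = c * c * (s1 * s1)"
        unfolding s1_def by (subst sum_product, subst sum_distrib_left, intro sum.cong refl, subst sum_distrib_left) (simp add: mult_ac)
      moreover have "(\<Sum>l\<in>UNIV. 2 * ((c * u l (?Wm \<omega>)) * 1 * (P * v l (?Wt \<omega>)))) = 2 * c * P * s2"
        by (simp add: s2_def sum_distrib_left mult_ac)
      moreover have "(\<Sum>k\<in>UNIV. \<Sum>l\<in>UNIV. 2 * ((c * u l (?Wm \<omega>)) * d k (?Wn \<omega>) * (\<Delta> k (?Wt \<omega>) * v l (?Wt \<omega>))))
          = 2 * c * (s1 * s2)"
        unfolding s1_def s2_def by (subst sum_product, subst sum_distrib_left, intro sum.cong refl, subst sum_distrib_left) (simp add: mult_ac)
      moreover have "(\<Sum>k\<in>UNIV. 2 * (c * d k (?Wn \<omega>) * (\<Delta> k (?Wt \<omega>) * E))) = 2 * c * E * s1"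
        by (simp add: s1_def sum_distrib_left mult_ac)
      ultimately show ?thesis
        unfolding c_def[symmetric] P_def[symmetric] E_def[symmetric] by (simp add: mult_ac)
    qed
    finally show "term \<omega> = ?F \<omega>" .
  qed
  ultimately have hb: "has_bochner_integral M term ?I" by simp
  thus "integrable M term" by (rule integrable.intros)
  have "(\<Sum>l\<in>UNIV. 2 * (Euu j l * (if l = j then - t else 0))) = (\<Sum>l\<in>UNIV. if l = j then - 2 * Euu j j * t else 0)"
    by (intro sum.cong) auto
  hence "(\<integral>\<omega>. term \<omega> \<partial>M) = (\<Sum>k\<in>UNIV. \<Sum>l\<in>UNIV. Euu j j * Edd k l * E\<Delta>\<Delta> k l)"
    using has_bochner_integral_integral_eq[OF hb] by simp
  also have "\<bar>\<dots>\<bar> \<le> (\<Sum>k\<in>(UNIV::'n set). \<Sum>l\<in>(UNIV::'n set). A * B * S)"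
  proof (rule order_trans[OF sum_abs sum_mono], rule order_trans[OF sum_abs sum_mono])
    fix k l
    have half: "\<bar>\<integral>\<omega>. f \<omega> * h \<omega> \<partial>M\<bar> \<le> b"
      if "f \<in> borel_measurable M" "h \<in> borel_measurable M" "integrable M (\<lambda>\<omega>. (f \<omega>)\<^sup>2)" "integrable M (\<lambda>\<omega>. (h \<omega>)\<^sup>2)"
        "(\<integral>\<omega>. (f \<omega>)\<^sup>2 \<partial>M) \<le> b" "(\<integral>\<omega>. (h \<omega>)\<^sup>2 \<partial>M) \<le> b" for f h :: "'a \<Rightarrow> real" and b
    proof -
      have i: "integrable M (\<lambda>\<omega>. f \<omega> * h \<omega>)" by (rule integrable_mult_of_sq) (use that in auto)
      have "\<bar>\<integral>\<omega>. f \<omega> * h \<omega> \<partial>M\<bar> \<le> (\<integral>\<omega>. \<bar>f \<omega> * h \<omega>\<bar> \<partial>M)" by (rule integral_abs_bound)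
      also have "\<dots> \<le> (\<integral>\<omega>. ((f \<omega>)\<^sup>2 + (h \<omega>)\<^sup>2) / 2 \<partial>M)"
      proof (rule integral_mono)
        fix \<omega> show "\<bar>f \<omega> * h \<omega>\<bar> \<le> ((f \<omega>)\<^sup>2 + (h \<omega>)\<^sup>2) / 2"
          using sum_squares_bound[of "\<bar>f \<omega>\<bar>" "\<bar>h \<omega>\<bar>"] by (simp add: abs_mult)
      qed (use i that in auto)
      also have "\<dots> = ((\<integral>\<omega>. (f \<omega>)\<^sup>2 \<partial>M) + (\<integral>\<omega>. (h \<omega>)\<^sup>2 \<partial>M)) / 2" using that by simp
      also have "\<dots> \<le> b" using that(5,6) by simp
      finally show ?thesis .
    qed
    have a: "\<bar>Euu j j\<bar> \<le> A" unfolding Euu_def by (rule half) (use u2 Au in auto)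
    have b: "\<bar>Edd k l\<bar> \<le> B" unfolding Edd_def by (rule half) (use d2 Bd in auto)
    have s: "\<bar>E\<Delta>\<Delta> k l\<bar> \<le> S" unfolding E\<Delta>\<Delta>_def by (rule half) (use \<Delta>2 S in \<open>auto simp: \<Delta>_def\<close>)
    show "\<bar>Euu j j * Edd k l * E\<Delta>\<Delta> k l\<bar> \<le> A * B * S"
      unfolding abs_mult using a b s by (intro mult_mono) (auto intro: order_trans[OF abs_ge_zero])
  qed
  also have "\<dots> = A * ((real CARD('n))\<^sup>2 * B * S)" by (simp add: power2_eq_square)
  finally show "\<bar>\<integral>\<omega>. term \<omega> \<partial>M\<bar> \<le> A * ((real CARD('n))\<^sup>2 * B * S)" .
qed

section \<open>The estimators and the sampler in terms of the errors\<close>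

lemma ols_error_cong:
  assumes "\<And>i. i < n \<Longrightarrow> w i = w' i" "\<And>i. i < n \<Longrightarrow> e i = e' i"
  shows "ols_error q j n w e k = ols_error q j n w' e' k"
  unfolding ols_error_def using assms by (simp add: gram_cong[of n w w'])

lemma least_squares_error_eq:
  assumes pd: "\<And>c. c \<noteq> 0 \<Longrightarrow> 0 < c \<bullet> (gram 0 j n x *v c)" and ls: "least_squares n x y b"
  shows "b $ k - \<beta> $ k = ols_error 0 j n x (\<lambda>i. y i - x i \<bullet> \<beta>) k"
proof -
  have "(b - \<beta>) $ k = ols_error 0 j n x (\<lambda>i. y i - x i \<bullet> \<beta>) k"
  proof (rule least_squares_coefficient_eq_ols_error[OF pd])
    fix c
    have "\<not> (\<Sum>i<n. (y i - x i \<bullet> (\<beta> + c))\<^sup>2) < (\<Sum>i<n. (y i - x i \<bullet> b)\<^sup>2)"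
      using ls by (auto simp: least_squares_def is_arg_min_def)
    thus "(\<Sum>i<n. (y i - x i \<bullet> \<beta> - x i \<bullet> (b - \<beta>))\<^sup>2) + 0 * ((b - \<beta>) $ j)\<^sup>2
       \<le> (\<Sum>i<n. (y i - x i \<bullet> \<beta> - x i \<bullet> c)\<^sup>2) + 0 * (c $ j)\<^sup>2"
      by (simp add: inner_diff_right inner_add_right algebra_simps)
  qed
  thus ?thesis by simp
qed

text \<open>The row of the regression of the \<open>j\<close>-th coordinate on the others: position \<open>j\<close> holds the constant covariate
  if there is an intercept, and \<open>0\<close> otherwise.\<close>

definition design_row :: "bool \<Rightarrow> 'n::finite \<Rightarrow> real ^ 'n \<Rightarrow> real ^ 'n" where
  "design_row intercept j x = (\<chi> l. if l = j then of_bool intercept else x $ l)"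

lemma design_row_inner:
  "design_row intercept j x \<bullet> c = of_bool intercept * c $ j + (\<Sum>l\<in>-{j}. c $ l * x $ l)"
proof -
  have "design_row intercept j x \<bullet> c = (\<Sum>l\<in>insert j (-{j}). design_row intercept j x $ l * c $ l)"
    by (simp add: inner_vec_def insert_absorb Compl_eq_Diff_UNIV insert_Diff_if)
  also have "\<dots> = of_bool intercept * c $ j + (\<Sum>l\<in>-{j}. c $ l * x $ l)"
    by (subst sum.insert) (auto simp: design_row_def mult.commute intro!: sum.cong)
  finally show ?thesis .
qed

lemma inner_eq_sum_Compl: "(g::real^'n) $ j = 0 \<Longrightarrow> g \<bullet> x = (\<Sum>l\<in>-{j}. g $ l * x $ l)"
  unfolding inner_vec_def inner_real_def by (rule sum.mono_neutral_right) auto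

text \<open>In the parametrisation \<open>h\<close> of the linear models by their deviation from the population regression, the
  residual of a model is the population residual minus the prediction of the deviation.\<close>

lemma least_squares_coord_error_eq:
  fixes x :: "nat \<Rightarrow> real ^ 'n"
  assumes pd: "\<And>c. c \<noteq> 0 \<Longrightarrow> 0 < c \<bullet> (gram (of_bool (\<not> intercept)) j n (\<lambda>i. design_row intercept j (x i)) *v c)"
    and ls: "least_squares_coord intercept j n x f"
    and g: "g $ j = 0" and a: "intercept \<or> a = 0"
  shows "\<exists>A. f = (\<lambda>v. A + (\<Sum>l\<in>-{j}. (g $ l + ols_error (of_bool (\<not> intercept)) j n (\<lambda>i. design_row intercept j (x i))
           (\<lambda>i. x i $ j - (a + g \<bullet> x i)) l) * v l))"
proof -
  let ?e = "\<lambda>i. x i $ j - (a + g \<bullet> x i)"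
  have "f \<in> linear_models intercept j" using ls by (simp add: least_squares_coord_def is_arg_min_def)
  then obtain A \<gamma> where f: "f = (\<lambda>v. A + (\<Sum>l\<in>-{j}. \<gamma> l * v l))" and A: "intercept \<or> A = 0"
    unfolding linear_models_def by blast
  define b where "b = (\<chi> l. if l = j then (if intercept then A - a else 0) else \<gamma> l - g $ l)"
  define h where "h c = (\<lambda>v. (if intercept then c $ j + a else 0) + (\<Sum>l\<in>-{j}. (c $ l + g $ l) * v l))" for c :: "real ^ 'n"
  have h_in: "h c \<in> linear_models intercept j" for c
    unfolding linear_models_def h_def
    by (rule CollectI, rule exI[of _ "if intercept then c $ j + a else 0"], rule exI[of _ "\<lambda>l. c $ l + g $ l"]) auto
  have h_eq: "x i $ j - h c (drop_coord j (x i)) = ?e i - design_row intercept j (x i) \<bullet> c" for i c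
  proof -
    have "(\<Sum>l\<in>-{j}. (c $ l + g $ l) * drop_coord j (x i) l) = (\<Sum>l\<in>-{j}. c $ l * x i $ l) + g \<bullet> x i"
      unfolding inner_eq_sum_Compl[OF g] by (auto simp: drop_coord_def distrib_right sum.distrib[symmetric] intro!: sum.cong)
    thus ?thesis using a by (auto simp: h_def design_row_inner)
  qed
  have fb: "h b = f"
  proof
    fix v
    have "(\<Sum>l\<in>-{j}. (b $ l + g $ l) * v l) = (\<Sum>l\<in>-{j}. \<gamma> l * v l)" by (rule sum.cong) (auto simp: b_def)
    thus "h b v = f v" using A by (auto simp: h_def f b_def)
  qed
  have "b $ k = ols_error (of_bool (\<not> intercept)) j n (\<lambda>i. design_row intercept j (x i)) ?e k" for k
  proof (rule least_squares_coefficient_eq_ols_error[OF pd])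
    fix c
    have "\<not> (\<Sum>i<n. (x i $ j - h c (drop_coord j (x i)))\<^sup>2) < (\<Sum>i<n. (x i $ j - h b (drop_coord j (x i)))\<^sup>2)"
      using ls h_in[of c] unfolding fb by (auto simp: least_squares_coord_def is_arg_min_def)
    hence "(\<Sum>i<n. (?e i - design_row intercept j (x i) \<bullet> b)\<^sup>2) \<le> (\<Sum>i<n. (?e i - design_row intercept j (x i) \<bullet> c)\<^sup>2)"
      by (simp only: h_eq not_less)
    moreover have "of_bool (\<not> intercept) * (b $ j)\<^sup>2 \<le> of_bool (\<not> intercept) * (c $ j)\<^sup>2"
      by (simp add: b_def)
    ultimately show "(\<Sum>i<n. (?e i - design_row intercept j (x i) \<bullet> b)\<^sup>2) + of_bool (\<not> intercept) * (b $ j)\<^sup>2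
       \<le> (\<Sum>i<n. (?e i - design_row intercept j (x i) \<bullet> c)\<^sup>2) + of_bool (\<not> intercept) * (c $ j)\<^sup>2"
      by (rule add_mono)
  qed
  moreover have "\<gamma> l = g $ l + b $ l" if "l \<in> -{j}" for l using that by (simp add: b_def)
  ultimately have "f = (\<lambda>v. A + (\<Sum>l\<in>-{j}. (g $ l + ols_error (of_bool (\<not> intercept)) j n (\<lambda>i. design_row intercept j (x i)) ?e l) * v l))"
    unfolding f by simp
  thus ?thesis by blast
qed

lemma cond_sample_inner:
  assumes \<nu>: "\<nu> = (\<lambda>v. A + (\<Sum>l\<in>-{j}. (g $ l + d l) * v l))" and g: "(g::real^'n) $ j = 0" and d: "d j = 0"
  shows "cond_sample \<nu> j x x' \<bullet> b = x \<bullet> b + b $ j *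
     (((x' $ j - (a + g \<bullet> x')) - (x $ j - (a + g \<bullet> x))) - (\<Sum>k\<in>UNIV. d k * (x' $ k - x $ k)))"
proof -
  have \<nu>x: "\<nu> (drop_coord j x) = A + g \<bullet> x + (\<Sum>k\<in>UNIV. d k * x $ k)" for x
  proof -
    have "(\<Sum>k\<in>UNIV. d k * x $ k) = (\<Sum>l\<in>-{j}. d l * x $ l)"
      by (rule sum.mono_neutral_right) (use d in auto)
    moreover have "(\<Sum>l\<in>-{j}. (g $ l + d l) * drop_coord j x l) = g \<bullet> x + (\<Sum>l\<in>-{j}. d l * x $ l)"
      unfolding inner_eq_sum_Compl[OF g] by (auto simp: drop_coord_def distrib_right sum.distrib[symmetric] intro!: sum.cong)
    ultimately show ?thesis by (simp add: \<nu>)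
  qed
  have "cond_sample \<nu> j x x' = x + (\<nu> (drop_coord j x) + (x' $ j - \<nu> (drop_coord j x')) - x $ j) *\<^sub>R axis j 1"
    by (auto simp: vec_eq_iff cond_sample_def axis_def)
  hence "cond_sample \<nu> j x x' \<bullet> b = x \<bullet> b + b $ j * (\<nu> (drop_coord j x) + (x' $ j - \<nu> (drop_coord j x')) - x $ j)"
    by (simp only: inner_add_left inner_scaleR_left inner_axis') (simp add: mult.commute)
  also have "\<nu> (drop_coord j x) + (x' $ j - \<nu> (drop_coord j x')) - x $ j
     = ((x' $ j - (a + g \<bullet> x')) - (x $ j - (a + g \<bullet> x))) - (\<Sum>k\<in>UNIV. d k * (x' $ k - x $ k))"
    by (simp add: \<nu>x right_diff_distrib sum_subtractf)
  finally show ?thesis .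
qed

lemma linear_models_eval:
  assumes "f \<in> linear_models intercept j"
  shows "f v = f (\<lambda>_. 0) + (\<Sum>l\<in>-{j}. (f (\<lambda>m. if m = l then 1 else 0) - f (\<lambda>_. 0)) * v l)"
proof -
  obtain A \<gamma> where f: "f = (\<lambda>v. A + (\<Sum>l\<in>-{j}. \<gamma> l * v l))" using assms unfolding linear_models_def by blast
  have "f (\<lambda>m. if m = l then 1 else 0) - f (\<lambda>_. 0) = \<gamma> l" if "l \<in> -{j}" for l
  proof -
    have "(\<Sum>m\<in>-{j}. \<gamma> m * (if m = l then 1 else 0)) = (\<Sum>m\<in>-{j}. if m = l then \<gamma> l else 0)"
      by (rule sum.cong) auto
    thus ?thesis using that by (simp add: f)
  qed
  thus ?thesis by (simp add: f)
qed

section \<open>The rate of the importance\<close>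

lemma (in prob_space) indep_vars_inj:
  assumes ind: "indep_vars (\<lambda>_. N) X I" and f: "inj_on f J" "f ` J \<subseteq> I"
  shows "indep_vars (\<lambda>_. N) (\<lambda>i. X (f i)) J"
proof -
  have "indep_vars (\<lambda>i. PiM {f i} (\<lambda>_. N)) (\<lambda>i \<omega>. restrict (\<lambda>p. X p \<omega>) {f i}) J"
    by (rule indep_vars_restrict[OF ind]) (use f in \<open>auto simp: disjoint_family_on_def inj_on_def\<close>)
  hence "indep_vars (\<lambda>_. N) (\<lambda>i \<omega>. restrict (\<lambda>p. X p \<omega>) {f i} (f i)) J"
    by (rule indep_vars_compose2[where Y="\<lambda>i v. v (f i)"]) simp
  thus ?thesis by simp
qed

lemma (in prob_space) indep_vars_imp_indep_pair:
  assumes ind: "indep_vars (\<lambda>_. N) X I" and ij: "i \<in> I" "j \<in> I" "i \<noteq> j"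
  shows "indep_pair M N (X i) N (X j)"
proof -
  have ind2: "indep_pair M (PiM {i} (\<lambda>_. N)) (\<lambda>\<omega>. restrict (\<lambda>p. X p \<omega>) {i}) (PiM {j} (\<lambda>_. N)) (\<lambda>\<omega>. restrict (\<lambda>p. X p \<omega>) {j})"
    unfolding indep_var_iff_indep_pair[symmetric] by (rule indep_var_restrict[OF ind]) (use ij in auto)
  have m: "(\<lambda>w. w i) \<in> measurable (PiM {i} (\<lambda>_. N)) N" "(\<lambda>w. w j) \<in> measurable (PiM {j} (\<lambda>_. N)) N" by measurable
  from indep_pair_compose[OF ind2 m] show ?thesis by simp
qed

lemma measurable_design_row [measurable]: "design_row intercept (j::'n::finite) \<in> borel_measurable borel"
  unfolding design_row_def[abs_def]
proof (rule borel_measurable_vec_lambda)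
  fix l show "(\<lambda>x::real^'n. if l = j then of_bool intercept else x $ l) \<in> borel_measurable borel"
    by (cases "l = j") auto
qed

lemma design_row_with_one: "design_row intercept j (with_one j x) = design_row intercept j x"
  by (simp add: design_row_def with_one_def vec_eq_iff)

text \<open>Substituting the regression of the \<open>k\<close>-th coordinate on the others.\<close>

lemma inner_eq_residual_add_with_one:
  fixes x c :: "real ^ 'n"
  assumes "c $ k = 1" "g $ k = 0"
  shows "x \<bullet> c = (x $ k - (a + g \<bullet> x)) + (\<chi> l. if l = k then a else c $ l + g $ l) \<bullet> with_one k x"
proof -
  have U: "(\<Sum>l\<in>UNIV. f l) = f k + (\<Sum>l\<in>-{k}. f l)" for f :: "'n \<Rightarrow> real"
    using sum.remove[of UNIV k f] by (simp add: Compl_eq_Diff_UNIV)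
  have "(\<chi> l. if l = k then a else c $ l + g $ l) \<bullet> with_one k x = a + (\<Sum>l\<in>-{k}. (c $ l + g $ l) * x $ l)"
    unfolding inner_vec_def U by (auto simp: with_one_def intro!: sum.cong)
  also have "(\<Sum>l\<in>-{k}. (c $ l + g $ l) * x $ l) = (\<Sum>l\<in>-{k}. c $ l * x $ l) + g \<bullet> x"
    unfolding inner_eq_sum_Compl[OF assms(2)] by (simp add: distrib_right sum.distrib)
  finally have e: "(\<chi> l. if l = k then a else c $ l + g $ l) \<bullet> with_one k x = a + ((\<Sum>l\<in>-{k}. c $ l * x $ l) + g \<bullet> x)" .
  have "x \<bullet> c = x $ k + (\<Sum>l\<in>-{k}. c $ l * x $ l)"
    unfolding inner_vec_def U using assms(1) by (simp add: mult.commute)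
  thus ?thesis unfolding e by simp
qed

lemma design_row_eq_residual_add_with_one:
  fixes x c :: "real ^ 'n"
  assumes c: "c $ k = 1" and g: "g $ k = 0" and kj: "k \<noteq> j"
  shows "\<exists>b. \<forall>x. design_row intercept j x \<bullet> c = (x $ k - (a + g \<bullet> x)) + b \<bullet> with_one k x"
proof -
  define c' where "c' = c - (c $ j) *\<^sub>R axis j 1"
  define b where "b = (\<chi> l. if l = k then a else c' $ l + g $ l) + (of_bool intercept * c $ j) *\<^sub>R axis k 1"
  have c': "c' $ k = 1" using c kj by (simp add: c'_def axis_def)
  have "design_row intercept j x \<bullet> c = (x $ k - (a + g \<bullet> x)) + b \<bullet> with_one k x" for x
  proof -
    have "x \<bullet> c' = (\<Sum>l\<in>-{j}. c $ l * x $ l)"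
      unfolding inner_commute[of x c'] by (subst inner_eq_sum_Compl[of c' j]) (auto simp: c'_def axis_def intro!: sum.cong)
    hence "design_row intercept j x \<bullet> c = of_bool intercept * c $ j + x \<bullet> c'" by (simp add: design_row_inner)
    also have "x \<bullet> c' = (x $ k - (a + g \<bullet> x)) + (\<chi> l. if l = k then a else c' $ l + g $ l) \<bullet> with_one k x"
      by (rule inner_eq_residual_add_with_one[OF c' g])
    finally show ?thesis by (simp add: b_def inner_add_left inner_axis' with_one_def)
  qed
  thus ?thesis by blast
qed

lemma (in prob_space) indep_pair_sym:
  assumes "indep_pair M S X T Y" shows "indep_pair M T Y S X"
  using assms unfolding indep_pair_iff_prob by (metis inf_commute mult.commute)

theorem lemma3p10:
  fixes M :: "'w measure"
    and X :: "'w \<Rightarrow> real ^ 'p" and Y \<epsilon> :: "'w \<Rightarrow> real"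
    and \<beta> :: "real ^ 'p" and \<sigma> :: real and j :: 'p
    and x :: "sample \<Rightarrow> nat \<Rightarrow> 'w \<Rightarrow> real ^ 'p" and y :: "sample \<Rightarrow> nat \<Rightarrow> 'w \<Rightarrow> real"
    and n_test :: "nat \<Rightarrow> nat" and \<pi> :: "nat \<Rightarrow> nat \<Rightarrow> nat"
    and intercept :: bool
    and \<beta>_hat :: "nat \<Rightarrow> 'w \<Rightarrow> real ^ 'p" and \<nu>_hat :: "nat \<Rightarrow> 'w \<Rightarrow> ('p \<Rightarrow> real) \<Rightarrow> real"
  assumes "prob_space M"
    \<comment> \<open>the population model\<close>
    and "gaussian_vector M X"
    and "invertible (covariance_matrix M X)"
    and "\<sigma> \<ge> 0" and "\<epsilon> \<in> borel_measurable M" and "distr M borel \<epsilon> = normal_law 0 \<sigma>"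
    and "prob_space.indep_set M (vimage_algebra (space M) X borel) (vimage_algebra (space M) \<epsilon> borel)"
    and "Y = (\<lambda>\<omega>. X \<omega> \<bullet> \<beta> + \<epsilon> \<omega>)"
    and "cond_indep_var M borel (\<lambda>\<omega>. X \<omega> $ j) borel Y
           (PiM (- {j}) (\<lambda>_. borel)) (\<lambda>\<omega>. drop_coord j (X \<omega>))"
    \<comment> \<open>all observations are i.i.d. copies of \<open>(X, Y)\<close>; the two training samples and the test
      sample are separate\<close>
    and "prob_space.indep_vars M (\<lambda>_. borel) (\<lambda>(s, i) \<omega>. (x s i \<omega>, y s i \<omega>)) UNIV"
    and "\<And>s i. distr M borel (\<lambda>\<omega>. (x s i \<omega>, y s i \<omega>)) = distr M borel (\<lambda>\<omega>. (X \<omega>, Y \<omega>))"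
    \<comment> \<open>the test set is the first \<open>n_test n\<close> test observations; the residual added at the \<open>i\<close>-th
      one is that of another independent observation, with index \<open>\<pi> n i\<close>, which may be a further
      member of the test set or lie outside of it\<close>
    and "\<And>n. n_test n \<ge> 1"
    and "\<And>n i. i < n_test n \<Longrightarrow> \<pi> n i \<noteq> i"
    \<comment> \<open>the estimators, trained on disjoint samples of size \<open>n\<close>\<close>
    and "\<And>n. \<beta>_hat n \<in> borel_measurable M"
    and "\<And>n \<omega>. \<omega> \<in> space M \<Longrightarrow>
           least_squares n (\<lambda>i. x Train_m i \<omega>) (\<lambda>i. y Train_m i \<omega>) (\<beta>_hat n \<omega>)"
    and "(LINT \<omega>|M. X \<omega>) \<noteq> 0 \<Longrightarrow> intercept"
    and "\<And>n v. (\<lambda>\<omega>. \<nu>_hat n \<omega> v) \<in> borel_measurable M"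
    and "\<And>n \<omega>. \<omega> \<in> space M \<Longrightarrow>
           least_squares_coord intercept j n (\<lambda>i. x Train_nu i \<omega>) (\<nu>_hat n \<omega>)"
  shows "let \<psi> = (\<lambda>n \<omega>. psi_CPI (\<lambda>v. v \<bullet> \<beta>_hat n \<omega>) (\<nu>_hat n \<omega>) j (n_test n)
                       (\<lambda>i. x Test i \<omega>) (\<lambda>i. y Test i \<omega>) (\<lambda>i. x Test (\<pi> n i) \<omega>))
         in (\<forall>\<^sub>F n in sequentially. integrable M (\<psi> n)) \<and>
            (\<lambda>n. LINT \<omega>|M. \<psi> n \<omega>) \<in> O(\<lambda>n. 1 / real n ^ 2)"
proof -
  interpret prob_space M by fact
  let ?L = "borel :: ((real ^ 'p) \<times> real) measure"
  note X_gauss = \<open>gaussian_vector M X\<close> and X_inv = \<open>invertible (covariance_matrix M X)\<close>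
  have X[measurable]: "X \<in> borel_measurable M" using X_gauss by (simp add: gaussian_vector_def)
  have \<epsilon>m[measurable]: "\<epsilon> \<in> borel_measurable M" by fact
  have Y: "Y = (\<lambda>\<omega>. X \<omega> \<bullet> \<beta> + \<epsilon> \<omega>)" by fact
  have [measurable]: "Y \<in> borel_measurable M" unfolding Y by measurable
  have [measurable]: "fst \<in> borel_measurable ?L"
    "snd \<in> borel_measurable ?L"
    by (auto intro!: borel_measurable_continuous_onI continuous_intros)
  have X2: "integrable M (\<lambda>\<omega>. (X \<omega> $ k)\<^sup>2)" for k
    by (rule gaussian_vector_integrable_sq[OF prob_space_axioms X_gauss])
  have X1: "integrable M (\<lambda>\<omega>. X \<omega> $ k)" for k by (rule square_integrable_imp_integrable) (use X2 in auto)
  have \<epsilon>law: "distr M borel \<epsilon> = normal_law 0 \<sigma>" by fact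
  note \<epsilon> = normal_law_moments[OF \<epsilon>m \<epsilon>law]
  have X\<epsilon>: "indep_pair M borel X borel \<epsilon>"
    unfolding indep_pair_iff_prob
  proof (intro conjI X \<epsilon>m ballI)
    fix A :: "(real ^ 'p) set" and B :: "real set" assume "A \<in> sets borel" "B \<in> sets borel"
    hence "X -` A \<inter> space M \<in> sets (vimage_algebra (space M) X borel)" "\<epsilon> -` B \<inter> space M \<in> sets (vimage_algebra (space M) \<epsilon> borel)"
      by (simp_all add: in_vimage_algebra)
    from indep_setD[OF assms(7) this]
    have "prob (X -` A \<inter> space M \<inter> (\<epsilon> -` B \<inter> space M)) = prob (X -` A \<inter> space M) * prob (\<epsilon> -` B \<inter> space M)" .
    moreover have "X -` A \<inter> space M \<inter> (\<epsilon> -` B \<inter> space M) = X -` A \<inter> \<epsilon> -` B \<inter> space M" by auto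
    ultimately show "prob (X -` A \<inter> \<epsilon> -` B \<inter> space M) = prob (X -` A \<inter> space M) * prob (\<epsilon> -` B \<inter> space M)" by simp
  qed
  define Q where "Q k t = (case t of (a, g, \<tau>) \<Rightarrow> 0 < \<tau> \<and> g $ k = 0 \<and>
    distr M borel (\<lambda>\<omega>. X \<omega> $ k - (a + g \<bullet> X \<omega>)) = normal_law 0 \<tau> \<and>
    indep_pair M borel (\<lambda>\<omega>. X \<omega> $ k - (a + g \<bullet> X \<omega>)) borel (\<lambda>\<omega>. with_one k (X \<omega>)))"
    for k and t :: "real \<times> (real ^ 'p) \<times> real"
  have "\<exists>t. Q k t" for k
  proof (rule gaussian_vector_coordinate_regression[OF prob_space_axioms X_gauss X_inv, of k])
    fix a g \<tau> assume "0 < \<tau>" "g $ k = 0" "distr M borel (\<lambda>\<omega>. X \<omega> $ k - (a + g \<bullet> X \<omega>)) = normal_law 0 \<tau>"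
      "indep_pair M borel (\<lambda>\<omega>. X \<omega> $ k - (a + g \<bullet> X \<omega>)) borel (\<lambda>\<omega>. with_one k (X \<omega>))"
    hence "Q k (a, g, \<tau>)" by (simp add: Q_def)
    thus "\<exists>t. Q k t" ..
  qed
  hence Q: "Q k (SOME t. Q k t)" for k by (rule someI_ex)
  define a where "a k = fst (SOME t. Q k t)" for k
  define g where "g k = fst (snd (SOME t. Q k t))" for k
  define \<tau> where "\<tau> k = snd (snd (SOME t. Q k t))" for k
  have reg: "0 < \<tau> k" "g k $ k = 0"
    "distr M borel (\<lambda>\<omega>. X \<omega> $ k - (a k + g k \<bullet> X \<omega>)) = normal_law 0 (\<tau> k)"
    "indep_pair M borel (\<lambda>\<omega>. X \<omega> $ k - (a k + g k \<bullet> X \<omega>)) borel (\<lambda>\<omega>. with_one k (X \<omega>))" for k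
    using Q[of k] by (simp_all add: Q_def a_def g_def \<tau>_def case_prod_beta)
  define \<phi> where "\<phi> k v = v $ k - (a k + g k \<bullet> v)" for k and v :: "real ^ 'p"
  have [measurable]: "\<phi> k \<in> borel_measurable borel" for k unfolding \<phi>_def by measurable
  have \<phi>Xm: "(\<lambda>\<omega>. \<phi> k (X \<omega>)) \<in> borel_measurable M" for k by measurable
  have \<phi>law: "distr M borel (\<lambda>\<omega>. \<phi> k (X \<omega>)) = normal_law 0 (\<tau> k)" for k unfolding \<phi>_def by (rule reg(3))
  note \<phi>X = normal_law_moments[OF \<phi>Xm \<phi>law]
  have \<phi>X_X: "(\<integral>\<omega>. \<phi> j (X \<omega>) * X \<omega> $ l \<partial>M) = (if l = j then (\<tau> j)\<^sup>2 else 0)" for l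
    unfolding \<phi>_def by (rule coordinate_regression_orthogonal(2)[OF prob_space_axioms X X2 reg(2,3,4)])
  have \<beta>j: "\<beta> $ j = 0"
    by (rule cond_indep_coefficient_eq_zero[OF prob_space_axioms X X2 reg(2,1,3,4) \<epsilon>(1) X\<epsilon> Y assms(9)])
  \<comment> \<open>Without an intercept the mean of \<open>X\<close> vanishes, hence so does the constant of the population regression.\<close>
  have aj: "intercept \<or> a j = 0"
  proof (cases intercept)
    case False
    hence "(LINT \<omega>|M. X \<omega>) = 0" using assms(16) by blast
    moreover have "integrable M X"
    proof -
      have "integrable M (\<lambda>\<omega>. \<Sum>k\<in>UNIV. X \<omega> $ k *\<^sub>R (axis k 1 :: real ^ 'p))"
        by (intro Bochner_Integration.integrable_sum integrable_scaleR_left X1)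
      moreover have "(\<Sum>k\<in>UNIV. v $ k *\<^sub>R axis k 1) = v" for v :: "real ^ 'p"
        using basis_expansion[of v] by (simp add: scalar_mult_eq_scaleR)
      ultimately show ?thesis by simp
    qed
    ultimately have X0: "(\<integral>\<omega>. X \<omega> \<bullet> v \<partial>M) = 0" for v by (subst integral_inner_left) auto
    have "(\<integral>\<omega>. \<phi> j (X \<omega>) \<partial>M) = (\<integral>\<omega>. X \<omega> \<bullet> (axis j 1 - g j) - a j \<partial>M)"
      by (intro Bochner_Integration.integral_cong refl) (simp add: \<phi>_def inner_diff_right inner_axis inner_commute)
    also have "\<dots> = - a j"
      using X0 \<open>integrable M X\<close> by (subst Bochner_Integration.integral_diff) (auto simp: prob_space)
    finally show ?thesis using \<phi>X(3)[of j] by simp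
  qed simp

  \<comment> \<open>All observations have the law of \<open>(X, Y)\<close> and inherit its properties.\<close>
  define obs where "obs p \<omega> = (x (fst p) (snd p) \<omega>, y (fst p) (snd p) \<omega>)" for p \<omega>
  have obs_ind: "indep_vars (\<lambda>_. borel) obs UNIV"
  proof -
    have "(\<lambda>(s, i) \<omega>. (x s i \<omega>, y s i \<omega>)) = obs" by (auto simp: fun_eq_iff obs_def)
    thus ?thesis using assms(10) by simp
  qed
  have obs[measurable]: "obs p \<in> borel_measurable M" for p using obs_ind unfolding indep_vars_def by blast
  have XYm: "(\<lambda>\<omega>. (X \<omega>, Y \<omega>)) \<in> borel_measurable M" by measurable
  have obs_law: "distr M borel (obs p) = distr M borel (\<lambda>\<omega>. (X \<omega>, Y \<omega>))" for p
    unfolding obs_def by (rule assms(11))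
  have obs_int: "integrable M (\<lambda>\<omega>. f (obs p \<omega>)) \<longleftrightarrow> integrable M (\<lambda>\<omega>. f (X \<omega>, Y \<omega>))"
    "(\<integral>\<omega>. f (obs p \<omega>) \<partial>M) = (\<integral>\<omega>. f (X \<omega>, Y \<omega>) \<partial>M)"
    if f: "f \<in> borel_measurable borel" for f :: "(real ^ 'p) \<times> real \<Rightarrow> real" and p
    using obs_law[of p] integrable_distr_eq[OF obs f, of p] integrable_distr_eq[OF XYm f]
      integral_distr[OF obs f, of p] integral_distr[OF XYm f] by simp_all
  have fst_m: "fst \<in> borel_measurable ?L" by measurable
  define noise where "noise v = snd v - fst v \<bullet> \<beta>" for v :: "(real ^ 'p) \<times> real"
  have noise_m[measurable]: "noise \<in> borel_measurable borel" unfolding noise_def by measurable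
  have noise_XY: "noise (X \<omega>, Y \<omega>) = \<epsilon> \<omega>" for \<omega> by (simp add: noise_def Y)
  have m\<phi>: "(\<lambda>v. \<phi> k (fst v)) \<in> borel_measurable ?L" for k by measurable
  have mw: "(\<lambda>v. with_one k (fst v)) \<in> borel_measurable ?L" for k by measurable
  have mf: "(\<lambda>v. fst v) \<in> borel_measurable ?L" by measurable
  have obs_reg: "indep_pair M borel (\<lambda>\<omega>. \<phi> k (fst (obs p \<omega>))) borel (\<lambda>\<omega>. with_one k (fst (obs p \<omega>)))" for k p
    by (rule indep_pair_cong_law[OF obs XYm obs_law m\<phi> mw]) (simp add: \<phi>_def reg(4))
  have obs_\<phi>law: "distr M borel (\<lambda>\<omega>. \<phi> k (fst (obs p \<omega>))) = normal_law 0 (\<tau> k)" for k p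
    using distr_compose_cong_law[OF obs XYm obs_law m\<phi>] \<phi>law by simp
  have obs_noise: "indep_pair M borel (\<lambda>\<omega>. fst (obs p \<omega>)) borel (\<lambda>\<omega>. noise (obs p \<omega>))" for p
    by (rule indep_pair_cong_law[OF obs XYm obs_law mf noise_m]) (simp add: noise_XY X\<epsilon>)
  have obs_noise_law: "distr M borel (\<lambda>\<omega>. noise (obs p \<omega>)) = normal_law 0 \<sigma>" for p
    using distr_compose_cong_law[OF obs XYm obs_law noise_m] \<epsilon>law by (simp add: noise_XY)

  have obs_reg': "indep_pair M borel (\<lambda>\<omega>. fst (obs p \<omega>) $ k - (a k + g k \<bullet> fst (obs p \<omega>))) borel (\<lambda>\<omega>. with_one k (fst (obs p \<omega>)))"
    "distr M borel (\<lambda>\<omega>. fst (obs p \<omega>) $ k - (a k + g k \<bullet> fst (obs p \<omega>))) = normal_law 0 (\<tau> k)" for k p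
    using obs_reg obs_\<phi>law by (simp_all add: \<phi>_def)
  define C where "C k = inverse_residual_bound TYPE('p) (\<tau> k)" for k
  have C0: "0 \<le> C k" for k unfolding C_def by (rule inverse_residual_bound_nonneg[OF reg(1)])
  define S where "S = 4 * (\<Sum>k\<in>UNIV. (\<integral>\<omega>. (X \<omega> $ k)\<^sup>2 \<partial>M))"
  define \<psi> where "\<psi> n \<omega> = psi_CPI (\<lambda>v. v \<bullet> \<beta>_hat n \<omega>) (\<nu>_hat n \<omega>) j (n_test n)
                       (\<lambda>i. x Test i \<omega>) (\<lambda>i. y Test i \<omega>) (\<lambda>i. x Test (\<pi> n i) \<omega>)" for n \<omega>
  define bound where "bound n = (\<sigma>\<^sup>2 * (C j / real n)) * ((real CARD('p))\<^sup>2 * ((\<tau> j)\<^sup>2 * ((\<Sum>k\<in>UNIV. C k) / real n)) * S)" for n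
  have main: "integrable M (\<psi> n) \<and> \<bar>\<integral>\<omega>. \<psi> n \<omega> \<partial>M\<bar> \<le> bound n" if n: "4 * Suc CARD('p) \<le> n" for n
  proof -
    have n0: "0 < n" using n by simp
    define q :: real where "q = of_bool (\<not> intercept)"
    \<comment> \<open>The errors of the two regressions.\<close>
    define um where "um k \<omega> = ols_error 0 j n (\<lambda>i. fst (obs (Train_m, i) \<omega>)) (\<lambda>i. noise (obs (Train_m, i) \<omega>)) k" for k \<omega>
    define dn where "dn k \<omega> = (if k = j then 0 else ols_error q j n (\<lambda>i. design_row intercept j (fst (obs (Train_nu, i) \<omega>)))
         (\<lambda>i. \<phi> j (fst (obs (Train_nu, i) \<omega>))) k)" for k \<omega>
    have ind_m: "indep_vars (\<lambda>_. borel) (\<lambda>i. obs (Train_m, i)) {..<n}"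
      by (rule indep_vars_inj[OF obs_ind, where f="\<lambda>i. (Train_m, i)"]) (auto simp: inj_on_def)
    have ind_n: "indep_vars (\<lambda>_. borel) (\<lambda>i. obs (Train_nu, i)) {..<n}"
      by (rule indep_vars_inj[OF obs_ind, where f="\<lambda>i. (Train_nu, i)"]) (auto simp: inj_on_def)
    have rep_m: "\<exists>b. \<forall>x. x \<bullet> c = (x $ k - (a k + g k \<bullet> x)) + b \<bullet> with_one k x" if "c $ k = 1" for k and c :: "real ^ 'p"
      using inner_eq_residual_add_with_one[OF that reg(2)] by blast
    have pd_m: "AE \<omega> in M. \<forall>c. c \<noteq> 0 \<longrightarrow> 0 < c \<bullet> (gram 0 j n (\<lambda>i. fst (obs (Train_m, i) \<omega>)) *v c)"
      and um: "integrable M (um k)" "(\<integral>\<omega>. um k \<omega> \<partial>M) = 0" "integrable M (\<lambda>\<omega>. (um k \<omega>)\<^sup>2)"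
        "(\<integral>\<omega>. (um k \<omega>)\<^sup>2 \<partial>M) \<le> \<sigma>\<^sup>2 * (C k / real n)" for k
    proof -
      have mid: "(\<lambda>t. t) \<in> borel_measurable (borel :: (real ^ 'p) measure)" by simp
      have deg: "0 < 0 * (c $ j)\<^sup>2 \<or> (\<forall>x. x \<bullet> c \<noteq> 0)" if "c \<noteq> 0" "\<And>k. k \<in> UNIV \<Longrightarrow> c $ k = 0" for c :: "real ^ 'p"
        using that by (simp add: vec_eq_iff)
      note mm = ols_error_moments_sample[where \<xi>=fst and err=noise and row="\<lambda>x. x" and K=UNIV and q=0 and j=j and s=\<sigma>
          and a=a and g=g and \<tau>=\<tau> and z="\<lambda>i. obs (Train_m, i)" and L=borel and n=n,
          OF n ind_m fst_m noise_m mid obs_noise obs_noise_law obs_reg' reg(1) rep_m order_refl deg]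
      show "AE \<omega> in M. \<forall>c. c \<noteq> 0 \<longrightarrow> 0 < c \<bullet> (gram 0 j n (\<lambda>i. fst (obs (Train_m, i) \<omega>)) *v c)"
        by (rule mm(1))
      show "integrable M (um k)"
        unfolding um_def[abs_def] by (rule mm(2)) simp_all
      show "(\<integral>\<omega>. um k \<omega> \<partial>M) = 0"
        unfolding um_def by (rule mm(3)) simp_all
      show "integrable M (\<lambda>\<omega>. (um k \<omega>)\<^sup>2)"
        unfolding um_def by (rule mm(4)) simp_all
      show "(\<integral>\<omega>. (um k \<omega>)\<^sup>2 \<partial>M) \<le> \<sigma>\<^sup>2 * (C k / real n)"
        unfolding um_def C_def by (rule mm(5)) simp_all
    qed
    have noise_n: "indep_pair M borel (\<lambda>\<omega>. design_row intercept j (fst (obs p \<omega>))) borel (\<lambda>\<omega>. \<phi> j (fst (obs p \<omega>)))" for p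
    proof -
      have mid: "(\<lambda>t. t) \<in> borel_measurable (borel :: real measure)" by simp
      from indep_pair_sym[OF indep_pair_compose[OF obs_reg[of j p] mid measurable_design_row[of intercept j]]]
      show ?thesis by (simp only: design_row_with_one)
    qed
    have deg: "0 < q * (c $ j)\<^sup>2 \<or> (\<forall>x. design_row intercept j x \<bullet> c \<noteq> 0)"
      if "c \<noteq> 0" "\<And>k. k \<in> -{j} \<Longrightarrow> c $ k = 0" for c :: "real ^ 'p"
    proof -
      have "c $ j \<noteq> 0"
      proof
        assume "c $ j = 0"
        hence "c $ k = 0" for k using that(2)[of k] by (cases "k = j") auto
        thus False using that(1) by (simp add: vec_eq_iff)
      qed
      moreover have "(\<Sum>l\<in>-{j}. c $ l * x $ l) = 0" for x :: "real ^ 'p" using that(2) by (intro sum.neutral) auto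
      ultimately show ?thesis by (cases intercept) (simp_all add: q_def design_row_inner)
    qed
    have rep_n: "\<exists>b. \<forall>x. design_row intercept j x \<bullet> c = (x $ k - (a k + g k \<bullet> x)) + b \<bullet> with_one k x"
      if "k \<in> -{j}" "c $ k = 1" for k and c :: "real ^ 'p"
      by (rule design_row_eq_residual_add_with_one[OF that(2) reg(2)]) (use that(1) in simp)
    have q0: "0 \<le> q" by (simp add: q_def)
    have mrow: "design_row intercept j \<in> borel_measurable borel" by measurable
    note nu = ols_error_moments_sample[where \<xi>=fst and err="\<lambda>v. \<phi> j (fst v)" and row="design_row intercept j" and K="-{j}" and q=q and j=j
        and s="\<tau> j" and a=a and g=g and \<tau>=\<tau> and z="\<lambda>i. obs (Train_nu, i)" and L=borel and n=n,
        OF n ind_n fst_m m\<phi> mrow noise_n obs_\<phi>law obs_reg' reg(1) rep_n q0 deg]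
    have pd_n: "AE \<omega> in M. \<forall>c. c \<noteq> 0 \<longrightarrow> 0 < c \<bullet> (gram q j n (\<lambda>i. design_row intercept j (fst (obs (Train_nu, i) \<omega>))) *v c)"
      by (rule nu(1))
    have Ck: "(\<tau> j)\<^sup>2 * (C k / real n) \<le> (\<tau> j)\<^sup>2 * ((\<Sum>k\<in>UNIV. C k) / real n)" for k
      by (intro mult_left_mono divide_right_mono member_le_sum) (auto intro: C0)
    have le0: "0 \<le> (\<tau> j)\<^sup>2 * ((\<Sum>k\<in>UNIV. C k) / real n)"
      by (intro mult_nonneg_nonneg divide_nonneg_nonneg sum_nonneg C0) auto
    have dn_all: "integrable M (dn k) \<and> (\<integral>\<omega>. dn k \<omega> \<partial>M) = 0 \<and> integrable M (\<lambda>\<omega>. (dn k \<omega>)\<^sup>2) \<and>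
        (\<integral>\<omega>. (dn k \<omega>)\<^sup>2 \<partial>M) \<le> (\<tau> j)\<^sup>2 * ((\<Sum>k\<in>UNIV. C k) / real n)" for k
    proof (cases "k = j")
      case True
      thus "integrable M (dn k) \<and> (\<integral>\<omega>. dn k \<omega> \<partial>M) = 0 \<and> integrable M (\<lambda>\<omega>. (dn k \<omega>)\<^sup>2) \<and>
        (\<integral>\<omega>. (dn k \<omega>)\<^sup>2 \<partial>M) \<le> (\<tau> j)\<^sup>2 * ((\<Sum>k\<in>UNIV. C k) / real n)"
        using le0 by (simp add: dn_def[abs_def])
    next
      case False
      hence kj: "k \<in> -{j}" by simp
      let ?D = "\<lambda>\<omega>. ols_error q j n (\<lambda>i. design_row intercept j (fst (obs (Train_nu, i) \<omega>))) (\<lambda>i. \<phi> j (fst (obs (Train_nu, i) \<omega>))) k"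
      have dn_eq: "dn k = (\<lambda>\<omega>. ols_error q j n (\<lambda>i. design_row intercept j (fst (obs (Train_nu, i) \<omega>)))
       (\<lambda>i. \<phi> j (fst (obs (Train_nu, i) \<omega>))) k)" using False by (simp add: dn_def[abs_def])
      show "integrable M (dn k) \<and> (\<integral>\<omega>. dn k \<omega> \<partial>M) = 0 \<and> integrable M (\<lambda>\<omega>. (dn k \<omega>)\<^sup>2) \<and>
        (\<integral>\<omega>. (dn k \<omega>)\<^sup>2 \<partial>M) \<le> (\<tau> j)\<^sup>2 * ((\<Sum>k\<in>UNIV. C k) / real n)"
        unfolding dn_eq
      proof (intro conjI)
        show "integrable M (\<lambda>\<omega>. ?D \<omega>)"
          by (rule nu(2)) (use False in simp_all)
        show "(\<integral>\<omega>. ?D \<omega> \<partial>M) = 0"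
          by (rule nu(3)) (use False in simp_all)
        show "integrable M (\<lambda>\<omega>. (?D \<omega>)\<^sup>2)"
          by (rule nu(4)) (use False in simp_all)
        have "(\<integral>\<omega>. (?D \<omega>)\<^sup>2 \<partial>M)
          \<le> (\<tau> j)\<^sup>2 * (C k / real n)"
          unfolding C_def by (rule nu(5)) (use False in simp_all)
        thus "(\<integral>\<omega>. (?D \<omega>)\<^sup>2 \<partial>M)
          \<le> (\<tau> j)\<^sup>2 * ((\<Sum>k\<in>UNIV. C k) / real n)" using Ck[of k] by linarith
      qed
    qed
    have dn: "integrable M (dn k)" "(\<integral>\<omega>. dn k \<omega> \<partial>M) = 0" "integrable M (\<lambda>\<omega>. (dn k \<omega>)\<^sup>2)"
      "(\<integral>\<omega>. (dn k \<omega>)\<^sup>2 \<partial>M) \<le> (\<tau> j)\<^sup>2 * ((\<Sum>k\<in>UNIV. C k) / real n)" for k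
      using dn_all[of k] by blast+
    define D where "D i \<omega> = (\<phi> j (fst (obs (Test, \<pi> n i) \<omega>)) - \<phi> j (fst (obs (Test, i) \<omega>)))
       - (\<Sum>k\<in>UNIV. dn k \<omega> * (fst (obs (Test, \<pi> n i) \<omega>) $ k - fst (obs (Test, i) \<omega>) $ k))" for i \<omega>
    \<comment> \<open>\<open>T i\<close> is the \<open>i\<close>-th summand of the importance on the event that both Gram matrices are positive definite.\<close>
    define T where "T i \<omega> = (um j \<omega> * D i \<omega>)\<^sup>2
       + 2 * (um j \<omega> * D i \<omega>) * ((\<Sum>l\<in>UNIV. um l \<omega> * fst (obs (Test, i) \<omega>) $ l) - noise (obs (Test, i) \<omega>))" for i \<omega>
    have T: "integrable M (T i) \<and> \<bar>\<integral>\<omega>. T i \<omega> \<partial>M\<bar> \<le> bound n" if i: "i < n_test n" for i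
    proof -
      have \<pi>i: "\<pi> n i \<noteq> i" using assms(13)[OF i] .
      define K where "K s = (case s of Train_m \<Rightarrow> {Train_m} \<times> {..<n} | Train_nu \<Rightarrow> {Train_nu} \<times> {..<n} | Test \<Rightarrow> {Test} \<times> {i, \<pi> n i})" for s
      define N where "N s = PiM (K s) (\<lambda>_. borel :: ((real ^ 'p) \<times> real) measure)" for s
      define W where "W s \<omega> = restrict (\<lambda>p. obs p \<omega>) (K s)" for s \<omega>
      have W: "indep_vars N W UNIV"
        unfolding N_def W_def by (rule indep_vars_restrict[OF obs_ind]) (auto simp: disjoint_family_on_def K_def split: sample.splits)
      define u where "u k w = ols_error 0 j n (\<lambda>i. fst (w (Train_m, i))) (\<lambda>i. noise (w (Train_m, i))) k" for k and w :: "sample \<times> nat \<Rightarrow> (real ^ 'p) \<times> real"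
      define d where "d k w = (if k = j then 0 else ols_error q j n (\<lambda>i. design_row intercept j (fst (w (Train_nu, i)))) (\<lambda>i. \<phi> j (fst (w (Train_nu, i)))) k)"
        for k and w :: "sample \<times> nat \<Rightarrow> (real ^ 'p) \<times> real"
      have uW: "u k (W Train_m \<omega>) = um k \<omega>" for k \<omega>
        unfolding u_def um_def by (rule ols_error_cong) (auto simp: W_def K_def)
      have dW: "d k (W Train_nu \<omega>) = dn k \<omega>" for k \<omega>
        unfolding d_def dn_def by (intro if_cong refl ols_error_cong) (auto simp: W_def K_def)
      have tW: "W Test \<omega> (Test, i) = obs (Test, i) \<omega>" "W Test \<omega> (Test, \<pi> n i) = obs (Test, \<pi> n i) \<omega>" for \<omega>
        by (auto simp: W_def K_def)
      have comp: "(\<lambda>w. f (w p)) \<in> measurable (N s) L" if "p \<in> K s" "f \<in> measurable borel L" for f p s L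
        unfolding N_def by (rule measurable_compose[OF measurable_component_singleton[OF that(1)] that(2)])
      have um_meas: "u k \<in> borel_measurable (N Train_m)" for k
        unfolding u_def by (intro borel_measurable_ols_error comp fst_m noise_m) (auto simp: K_def)
      have mdr: "(\<lambda>v. design_row intercept j (fst v)) \<in> borel_measurable ?L" by measurable
      have d_meas: "d k \<in> borel_measurable (N Train_nu)" for k
      proof (cases "k = j")
        case False
        have "(\<lambda>w. ols_error q j n (\<lambda>i. design_row intercept j (fst (w (Train_nu, i)))) (\<lambda>i. \<phi> j (fst (w (Train_nu, i)))) k) \<in> borel_measurable (N Train_nu)"
          by (intro borel_measurable_ols_error comp[OF _ mdr] comp[OF _ m\<phi>]) (auto simp: K_def)
        thus ?thesis using False by (simp add: d_def[abs_def])
      qed (simp add: d_def[abs_def])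
      have mk: "(\<lambda>v. fst v $ k) \<in> borel_measurable ?L" for k by measurable
      have mk2: "(\<lambda>v. (fst v $ k)\<^sup>2) \<in> borel_measurable ?L" for k by measurable
      have m\<phi>2: "(\<lambda>v. (\<phi> k (fst v))\<^sup>2) \<in> borel_measurable ?L" for k by measurable
      have m\<phi>k: "(\<lambda>v. \<phi> j (fst v) * fst v $ k) \<in> borel_measurable ?L" for k by measurable
      have mn2: "(\<lambda>v. (noise v)\<^sup>2) \<in> borel_measurable ?L" by measurable
      let ?x = "\<lambda>\<omega>. fst (obs (Test, i) \<omega>)" and ?x' = "\<lambda>\<omega>. fst (obs (Test, \<pi> n i) \<omega>)"
      have Kt: "(Test, i) \<in> K Test" "(Test, \<pi> n i) \<in> K Test" by (auto simp: K_def)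
      have x2: "integrable M (\<lambda>\<omega>. (fst (obs p \<omega>) $ k)\<^sup>2)" "(\<integral>\<omega>. (fst (obs p \<omega>) $ k)\<^sup>2 \<partial>M) = (\<integral>\<omega>. (X \<omega> $ k)\<^sup>2 \<partial>M)" for p k
        using obs_int[OF mk2] X2 by simp_all
      have x1: "integrable M (\<lambda>\<omega>. fst (obs p \<omega>) $ k)" for p k using obs_int(1)[OF mk] X1 by simp
      note \<phi>o = normal_law_moments[OF measurable_compose[OF obs m\<phi>] obs_\<phi>law]
      have no: "integrable M (\<lambda>\<omega>. (noise (obs p \<omega>))\<^sup>2)" for p
        using obs_int(1)[OF mn2] \<epsilon>(2) by (simp add: noise_XY)
      have ip: "indep_pair M borel (obs (Test, \<pi> n i)) borel (obs (Test, i))"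
        by (rule indep_vars_imp_indep_pair[OF obs_ind]) (use \<pi>i in auto)
      have c1: "integrable M (\<lambda>\<omega>. \<phi> j (?x' \<omega>) * \<phi> j (?x \<omega>))"
        "(\<integral>\<omega>. \<phi> j (?x' \<omega>) * \<phi> j (?x \<omega>) \<partial>M) = 0"
        using indep_pair_integral[OF indep_pair_compose[OF ip m\<phi> m\<phi>] \<phi>o(1) \<phi>o(1)] \<phi>o(3) by simp_all
      have c2: "integrable M (\<lambda>\<omega>. \<phi> j (?x' \<omega>) * ?x \<omega> $ l)"
        "(\<integral>\<omega>. \<phi> j (?x' \<omega>) * ?x \<omega> $ l \<partial>M) = 0" for l
        using indep_pair_integral[OF indep_pair_compose[OF ip m\<phi> mk] \<phi>o(1) x1] \<phi>o(3) by simp_all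
      have c3: "integrable M (\<lambda>\<omega>. \<phi> j (?x \<omega>) * ?x \<omega> $ l)" for l
        by (rule integrable_mult_of_sq) (use \<phi>o x2 in auto)
      have c4: "(\<integral>\<omega>. \<phi> j (?x \<omega>) * ?x \<omega> $ l \<partial>M) = (if l = j then (\<tau> j)\<^sup>2 else 0)" for l
        using obs_int(2)[OF m\<phi>k, of "(Test, i)" l] \<phi>X_X[of l] by simp
      have r2: "(\<integral>\<omega>. (\<phi> j (?x' \<omega>) - \<phi> j (?x \<omega>))\<^sup>2 \<partial>M) = 2 * (\<tau> j)\<^sup>2"
      proof -
        have "(\<integral>\<omega>. (\<phi> j (?x' \<omega>) - \<phi> j (?x \<omega>))\<^sup>2 \<partial>M)
          = (\<integral>\<omega>. (\<phi> j (?x' \<omega>))\<^sup>2 + (\<phi> j (?x \<omega>))\<^sup>2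
             - 2 * (\<phi> j (?x' \<omega>) * \<phi> j (?x \<omega>)) \<partial>M)"
          by (simp add: power2_diff mult.assoc)
        also have "\<dots> = 2 * (\<tau> j)\<^sup>2" using \<phi>o(2,4) c1 by simp
        finally show ?thesis .
      qed
      have rv: "(\<integral>\<omega>. (\<phi> j (?x' \<omega>) - \<phi> j (?x \<omega>)) * ?x \<omega> $ l \<partial>M)
        = (if l = j then - (\<tau> j)\<^sup>2 else 0)" for l
        unfolding left_diff_distrib using c2[of l] c3[of l] c4[of l] by simp
      have S: "(\<integral>\<omega>. (?x' \<omega> $ k - ?x \<omega> $ k)\<^sup>2 \<partial>M) \<le> S" for k
      proof -
        have "(\<integral>\<omega>. (?x' \<omega> $ k - ?x \<omega> $ k)\<^sup>2 \<partial>M)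
          \<le> (\<integral>\<omega>. 2 * (?x' \<omega> $ k)\<^sup>2 + 2 * (?x \<omega> $ k)\<^sup>2 \<partial>M)"
        proof (rule integral_mono)
          show "integrable M (\<lambda>\<omega>. (?x' \<omega> $ k - ?x \<omega> $ k)\<^sup>2)"
            using integrable_sq_add[of "\<lambda>\<omega>. ?x' \<omega> $ k" M "\<lambda>\<omega>. - ?x \<omega> $ k"] x2 by simp
          fix \<omega>
          have "(a - b)\<^sup>2 \<le> 2 * a\<^sup>2 + 2 * b\<^sup>2" for a b :: real
            using sum_squares_bound[of a "- b"] by (simp add: power2_diff)
          thus "(?x' \<omega> $ k - ?x \<omega> $ k)\<^sup>2
            \<le> 2 * (?x' \<omega> $ k)\<^sup>2 + 2 * (?x \<omega> $ k)\<^sup>2" .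
        qed (use x2 in auto)
        also have "\<dots> = 4 * (\<integral>\<omega>. (X \<omega> $ k)\<^sup>2 \<partial>M)" using x2 by simp
        also have "\<dots> \<le> S" unfolding S_def by (intro mult_left_mono member_le_sum) auto
        finally show ?thesis .
      qed
      note E = expectation_cpi_term[where W=W and N=N and u=u and d=d and v="\<lambda>k w. fst (w (Test, i)) $ k"
          and v'="\<lambda>k w. fst (w (Test, \<pi> n i)) $ k" and r="\<lambda>w. \<phi> j (fst (w (Test, i)))" and r'="\<lambda>w. \<phi> j (fst (w (Test, \<pi> n i)))"
          and e="\<lambda>w. noise (w (Test, i))" and j=j and t="(\<tau> j)\<^sup>2" and A="\<sigma>\<^sup>2 * (C j / real n)"
          and B="(\<tau> j)\<^sup>2 * ((\<Sum>k\<in>UNIV. C k) / real n)" and S=S, unfolded uW dW tW,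
          OF W um_meas d_meas comp[OF Kt(1) mk] comp[OF Kt(2) mk] comp[OF Kt(1) m\<phi>] comp[OF Kt(2) m\<phi>] comp[OF Kt(1) noise_m]
            um(3) dn(3) x2(1) x2(1) \<phi>o(2) \<phi>o(2) no um(2) dn(2) r2 rv um(4) dn(4) S]
      show ?thesis using E by (simp add: T_def[abs_def] D_def bound_def)
    qed
    have x_m[measurable]: "x s i \<in> borel_measurable M" and y_m[measurable]: "y s i \<in> borel_measurable M" for s i
      using measurable_compose[OF obs[of "(s, i)"] fst_m] measurable_compose[OF obs[of "(s, i)"], of snd borel]
      by (simp_all add: obs_def)
    have [measurable]: "\<beta>_hat n \<in> borel_measurable M" by (rule assms(14))
    \<comment> \<open>A linear model is determined by finitely many of its values, so its value at a random argument is measurable.\<close>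
    have \<nu>_m: "(\<lambda>\<omega>. \<nu>_hat n \<omega> (drop_coord j (x s i \<omega>))) \<in> borel_measurable M" for s i
    proof -
      let ?h = "\<lambda>\<omega>. \<nu>_hat n \<omega> (\<lambda>_. 0) + (\<Sum>l\<in>-{j}. (\<nu>_hat n \<omega> (\<lambda>m. if m = l then 1 else 0) - \<nu>_hat n \<omega> (\<lambda>_. 0)) * x s i \<omega> $ l)"
      have "\<nu>_hat n \<omega> (drop_coord j (x s i \<omega>)) = ?h \<omega>" if "\<omega> \<in> space M" for \<omega>
      proof -
        have "\<nu>_hat n \<omega> \<in> linear_models intercept j"
          using assms(18)[OF that, of n] by (simp add: least_squares_coord_def is_arg_min_def)
        from linear_models_eval[OF this, of "drop_coord j (x s i \<omega>)"]
        show ?thesis by (simp add: drop_coord_def)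
      qed
      moreover have "?h \<in> borel_measurable M"
        by (intro borel_measurable_add borel_measurable_sum borel_measurable_times borel_measurable_diff assms(17) borel_measurable_vec_nth x_m)
      ultimately show ?thesis by (simp cong: measurable_cong)
    qed
    have cs_m: "(\<lambda>\<omega>. cond_sample (\<nu>_hat n \<omega>) j (x Test i \<omega>) (x Test i' \<omega>)) \<in> borel_measurable M" for i i'
      unfolding cond_sample_def
    proof (rule borel_measurable_vec_lambda)
      fix l
      show "(\<lambda>\<omega>. if l = j then \<nu>_hat n \<omega> (drop_coord j (x Test i \<omega>)) + (x Test i' \<omega> $ j - \<nu>_hat n \<omega> (drop_coord j (x Test i' \<omega>)))
          else x Test i \<omega> $ l) \<in> borel_measurable M"
        by (cases "l = j") (auto intro!: borel_measurable_add borel_measurable_diff \<nu>_m borel_measurable_vec_nth x_m)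
    qed
    have \<psi>_m: "\<psi> n \<in> borel_measurable M"
      unfolding \<psi>_def[abs_def] psi_CPI_def
      by (intro borel_measurable_times borel_measurable_const borel_measurable_sum borel_measurable_diff borel_measurable_power
          borel_measurable_inner cs_m x_m y_m assms(14))
    have AE_\<psi>: "AE \<omega> in M. \<psi> n \<omega> = (1 / real (n_test n)) * (\<Sum>i<n_test n. T i \<omega>)"
      using pd_m pd_n AE_space
    proof eventually_elim
      case (elim \<omega>)
      have obs_eq: "fst (obs (s, i) \<omega>) = x s i \<omega>" "noise (obs (s, i) \<omega>) = y s i \<omega> - x s i \<omega> \<bullet> \<beta>" for s i
        by (simp_all add: obs_def noise_def)
      have b: "\<beta>_hat n \<omega> $ k = \<beta> $ k + um k \<omega>" for k
      proof -
        have "\<beta>_hat n \<omega> $ k - \<beta> $ k = ols_error 0 j n (\<lambda>i. x Train_m i \<omega>) (\<lambda>i. y Train_m i \<omega> - x Train_m i \<omega> \<bullet> \<beta>) k"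
          by (rule least_squares_error_eq) (use elim(1) assms(15)[OF elim(3)] in \<open>simp_all add: obs_eq\<close>)
        thus ?thesis by (simp add: um_def obs_eq)
      qed
      have "\<exists>A. \<nu>_hat n \<omega> = (\<lambda>v. A + (\<Sum>l\<in>-{j}. (g j $ l + ols_error q j n (\<lambda>i. design_row intercept j (x Train_nu i \<omega>))
           (\<lambda>i. x Train_nu i \<omega> $ j - (a j + g j \<bullet> x Train_nu i \<omega>)) l) * v l))"
        unfolding q_def
        by (rule least_squares_coord_error_eq[OF _ assms(18)[OF elim(3)] reg(2) aj]) (use elim(2) in \<open>simp add: obs_eq q_def\<close>)
      then obtain A0 where A0: "\<nu>_hat n \<omega> = (\<lambda>v. A0 + (\<Sum>l\<in>-{j}. (g j $ l + ols_error q j n (\<lambda>i. design_row intercept j (x Train_nu i \<omega>))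
           (\<lambda>i. x Train_nu i \<omega> $ j - (a j + g j \<bullet> x Train_nu i \<omega>)) l) * v l))" by blast
      have \<nu>: "\<nu>_hat n \<omega> = (\<lambda>v. A0 + (\<Sum>l\<in>-{j}. (g j $ l + dn l \<omega>) * v l))"
        unfolding A0 by (intro ext arg_cong2[where f="(+)"] sum.cong refl) (simp add: dn_def obs_eq \<phi>_def)
      have dj: "dn j \<omega> = 0" by (simp add: dn_def)
      have "(cond_sample (\<nu>_hat n \<omega>) j (x Test i \<omega>) (x Test (\<pi> n i) \<omega>) \<bullet> \<beta>_hat n \<omega> - y Test i \<omega>)\<^sup>2
          - (x Test i \<omega> \<bullet> \<beta>_hat n \<omega> - y Test i \<omega>)\<^sup>2 = T i \<omega>" for i
      proof -
        define s where "s = (\<Sum>l\<in>UNIV. um l \<omega> * x Test i \<omega> $ l) - noise (obs (Test, i) \<omega>)"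
        have "x Test i \<omega> \<bullet> \<beta>_hat n \<omega> = x Test i \<omega> \<bullet> \<beta> + (\<Sum>l\<in>UNIV. um l \<omega> * x Test i \<omega> $ l)"
          unfolding inner_vec_def inner_real_def b by (simp add: distrib_left sum.distrib mult.commute)
        hence 1: "x Test i \<omega> \<bullet> \<beta>_hat n \<omega> - y Test i \<omega> = s" by (simp add: s_def obs_eq)
        have "cond_sample (\<nu>_hat n \<omega>) j (x Test i \<omega>) (x Test (\<pi> n i) \<omega>) \<bullet> \<beta>_hat n \<omega>
            = x Test i \<omega> \<bullet> \<beta>_hat n \<omega> + um j \<omega> * D i \<omega>"
          using cond_sample_inner[where d="\<lambda>l. dn l \<omega>" and a="a j", OF \<nu> reg(2) dj] by (simp add: b \<beta>j D_def obs_eq \<phi>_def)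
        hence 2: "cond_sample (\<nu>_hat n \<omega>) j (x Test i \<omega>) (x Test (\<pi> n i) \<omega>) \<bullet> \<beta>_hat n \<omega> - y Test i \<omega> = s + um j \<omega> * D i \<omega>"
          using 1 by simp
        have 3: "T i \<omega> = (um j \<omega> * D i \<omega>)\<^sup>2 + 2 * (um j \<omega> * D i \<omega>) * s" by (simp add: T_def s_def obs_eq(1))
        show ?thesis unfolding 1 2 3 by (simp add: power2_sum)
      qed
      thus ?case by (simp add: \<psi>_def psi_CPI_def)
    qed
    have iT: "integrable M (\<lambda>\<omega>. (1 / real (n_test n)) * (\<Sum>i<n_test n. T i \<omega>))"
      by (intro integrable_mult_right Bochner_Integration.integrable_sum) (use T in auto)
    have "integrable M (\<psi> n)"
      by (rule integrable_cong_AE_imp[OF iT \<psi>_m]) (use AE_\<psi> in auto)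
    moreover have "\<bar>\<integral>\<omega>. \<psi> n \<omega> \<partial>M\<bar> \<le> bound n"
    proof -
      have nt: "0 < real (n_test n)" using assms(12)[of n] by linarith
      have "(\<integral>\<omega>. \<psi> n \<omega> \<partial>M) = (\<integral>\<omega>. (1 / real (n_test n)) * (\<Sum>i<n_test n. T i \<omega>) \<partial>M)"
        by (rule integral_cong_AE[OF \<psi>_m _ AE_\<psi>]) (use iT in auto)
      also have "\<dots> = (1 / real (n_test n)) * (\<Sum>i<n_test n. (\<integral>\<omega>. T i \<omega> \<partial>M))"
        using T by simp
      finally have "\<bar>\<integral>\<omega>. \<psi> n \<omega> \<partial>M\<bar> = (1 / real (n_test n)) * \<bar>\<Sum>i<n_test n. (\<integral>\<omega>. T i \<omega> \<partial>M)\<bar>"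
        by (simp add: abs_mult)
      also have "\<dots> \<le> (1 / real (n_test n)) * (\<Sum>i<n_test n. bound n)"
        by (intro mult_left_mono order_trans[OF sum_abs sum_mono]) (use T in auto)
      also have "\<dots> = bound n" using nt by simp
      finally show ?thesis .
    qed
    ultimately show ?thesis ..
  qed
  define c where "c = \<sigma>\<^sup>2 * C j * ((real CARD('p))\<^sup>2 * ((\<tau> j)\<^sup>2 * (\<Sum>k\<in>UNIV. C k)) * S)"
  have bound_eq: "bound n = c * (1 / real n ^ 2)" for n
    by (simp add: bound_def c_def power2_eq_square)
  have "\<forall>\<^sub>F n in sequentially. integrable M (\<psi> n)"
    by (rule eventually_sequentiallyI[of "4 * Suc CARD('p)"]) (use main in blast)
  moreover have "(\<lambda>n. LINT \<omega>|M. \<psi> n \<omega>) \<in> O(\<lambda>n. 1 / real n ^ 2)"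
  proof (rule bigoI[of _ c], rule eventually_sequentiallyI[of "4 * Suc CARD('p)"])
    fix n assume "4 * Suc CARD('p) \<le> n"
    from main[OF this] show "norm (LINT \<omega>|M. \<psi> n \<omega>) \<le> c * norm (1 / real n ^ 2)"
      by (simp add: bound_eq)
  qed
  ultimately show ?thesis unfolding Let_def \<psi>_def[abs_def] ..
qed

end
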